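(* Let $(N,J_1,J_2,J_3,\omega_1,\omega_2,\omega_3,k)$ be a compact hyperKähler manifold, and let $\{e^1(t),e^2(t),e^3(t)\}_{t\in[0,1]}$ be an admissible family of coframes on $\mathbb{T}^3$ with coefficients $a_1,b_2,b_3$ and $l=b_2^2+b_3^2$ (as defined in the context). Suppose that there exist (i) a diffeomorphism $\rho$ of $\mathbb{T}^3$ such that $\rho^*\big(e^i(1)_{\rho(\underline{x})}\big)=e^i(0)_{\underline{x}}$ for all $\underline{x}\in\mathbb{T}^3$ and $i=1,2,3$, and such that the function $t\mapsto \big(\tfrac{1}{l(t)}\big)'\cdot\tfrac{1}{a_1(t)}$ is a nonzero constant on $[0,1]$; (ii) a diffeomorphism $\psi$ of $N$ preserving the hyperKähler structure, i.e. $\psi$ is holomorphic with respect to each $J_i$ and $\psi^*\omega_i=\omega_i$, for $i=1,2,3$. Then the mapping torus $M_f$ of $M=\mathbb{T}^3\times N$ by the diffeomorphism $f(\underline{x},p)=(\rho(\underline{x}),\psi(p))$ admits a non-split generalized Kähler structure $(I_\pm,g,\omega_\pm)$.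
   Context: Mapping torus: for a diffeomorphism $f$ of a manifold $M$, $M_f=\dfrac{M\times[0,1]}{(x,0)\sim(f(x),1)}$; equivalently the quotient of $M\times\mathbb{R}$ by the $\mathbb{Z}$-action $n\cdot(x,t)=(f^n(x),t+n)$. Generalized Kähler structure on a $2n$-dimensional manifold: a triple $(g,I_+,I_-)$, where $g$ is a Riemannian metric and $I_\pm$ are two (integrable) complex structures, each compatible with $g$, such that the fundamental forms $\omega_\pm$ of $(g,I_\pm)$ satisfy $d^c_+\omega_+=-d^c_-\omega_-=H$ with $H$ a closed $3$-form. Here $d^c_\pm=I_\pm^{-1}\,d\,I_\pm$ is the real Dolbeault operator of $I_\pm$ ($I_\pm$ acting on forms by evaluating on $I_\pm X_1,\dots,I_\pm X_r$). The structure is split if $[I_+,I_-]=0$ and non-split otherwise. HyperKähler manifold: a manifold of real dimension $4m$, $m\ge 1$, with a Riemannian metric $k$ and complex structures $J_1,J_2,J_3$ with $J_1J_2=-J_2J_1=J_3$, such that $k$ is Kähler with respect to each $J_i$, with Kähler form $\omega_i$. Admissible family of coframes on $\mathbb{T}^3$: let $\mathbb{T}^3=\Gamma_0\backslash\mathbb{R}^3$, where $\Gamma_0\cong\mathbb{Z}^3$ is a lattice in $\mathbb{R}^3$, with local coordinates $(x^1,x^2,x^3)$ induced by the standard coordinates of $\mathbb{R}^3$. Let $a_1,b_2,b_3:[0,1]\to\mathbb{R}$ be smooth functions such that for every $t$ the vector fields $$e_1(t)=a_1(t)\tfrac{\partial}{\partial x^1},\quad e_2(t)=b_2(t)\tfrac{\partial}{\partial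 x^2}+b_3(t)\tfrac{\partial}{\partial x^3},\quad e_3(t)=-b_3(t)\tfrac{\partial}{\partial x^2}+b_2(t)\tfrac{\partial}{\partial x^3}$$ form a frame of $\mathbb{T}^3$. Put $l=b_2^2+b_3^2>0$, $v=b_2b_2'+b_3b_3'=\tfrac12 l'$, $w=b_2b_3'-b_3b_2'$, and require $$\frac{v(1)}{l(1)}=\frac{v(0)}{l(0)},\qquad \frac{w(1)}{l(1)}=\frac{w(0)}{l(0)}.$$ The dual coframe is $$e^1(t)=\tfrac{1}{a_1(t)}dx^1,\quad e^2(t)=\tfrac{b_2(t)}{l(t)}dx^2+\tfrac{b_3(t)}{l(t)}dx^3,\quad e^3(t)=-\tfrac{b_3(t)}{l(t)}dx^2+\tfrac{b_2(t)}{l(t)}dx^3 .$$ *)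

theory Defs
  imports "HOL-Analysis.Analysis"
begin

section \<open>Smooth functions\<close>

text \<open>For open \<open>S\<close>: all iterated directional derivatives up to order \<open>k\<close> exist and are continuous
  on \<open>S\<close>, together with total differentiability below order \<open>k\<close>.\<close>

fun Ck_on :: "nat \<Rightarrow> 'a::real_normed_vector set \<Rightarrow> ('a \<Rightarrow> 'b::real_normed_vector) \<Rightarrow> bool" where
  "Ck_on 0 S f \<longleftrightarrow> continuous_on S f"
| "Ck_on (Suc k) S f \<longleftrightarrow>
     (\<forall>x\<in>S. f differentiable (at x)) \<and> (\<forall>v. Ck_on k S (\<lambda>x. frechet_derivative f (at x) v))"

definition smooth_on :: "'a::real_normed_vector set \<Rightarrow> ('a \<Rightarrow> 'b::real_normed_vector) \<Rightarrow> bool" where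
  "smooth_on S f \<longleftrightarrow> (\<forall>k. Ck_on k S f)"

text \<open>Functions on the closed interval \<open>[0,1]\<close> are differentiated one-sidedly at the end points.\<close>

definition D01 :: "(real \<Rightarrow> real) \<Rightarrow> real \<Rightarrow> real" where
  "D01 f t = vector_derivative f (at t within {0..1})"

definition smooth01 :: "(real \<Rightarrow> real) \<Rightarrow> bool" where
  "smooth01 f \<longleftrightarrow> (\<forall>k. \<forall>t\<in>{0..1}. ((D01 ^^ k) f) differentiable (at t within {0..1}))"


section \<open>Smooth manifolds\<close>

text \<open>A chart is its domain together with its coordinate map, whose values off the domain are
  irrelevant. The atlas need not be maximal; it determines the smooth structure.\<close>

type_synonym ('p, 'e) chart = "'p set \<times> ('p \<Rightarrow> 'e)"

record ('p, 'e) manifold =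
  mtop :: "'p topology"
  atlas :: "('p, 'e) chart set"

definition local_rep :: "('p, 'e) chart \<Rightarrow> ('q, 'f) chart \<Rightarrow> ('p \<Rightarrow> 'q) \<Rightarrow> 'e \<Rightarrow> 'f" where
  "local_rep c d F = snd d \<circ> F \<circ> inv_into (fst c) (snd c)"

definition local_dom :: "('p, 'e) chart \<Rightarrow> ('q, 'f) chart \<Rightarrow> ('p \<Rightarrow> 'q) \<Rightarrow> 'e set" where
  "local_dom c d F = snd c ` {p \<in> fst c. F p \<in> fst d}"

definition smooth_manifold :: "('p, 'e::euclidean_space) manifold \<Rightarrow> bool" where
  "smooth_manifold M \<longleftrightarrow>
     Hausdorff_space (mtop M) \<and> second_countable (mtop M) \<and>
     (\<Union>c\<in>atlas M. fst c) = topspace (mtop M) \<and>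
     (\<forall>c\<in>atlas M. openin (mtop M) (fst c) \<and> open (snd c ` fst c) \<and>
        homeomorphic_map (subtopology (mtop M) (fst c)) (top_of_set (snd c ` fst c)) (snd c)) \<and>
     (\<forall>c\<in>atlas M. \<forall>d\<in>atlas M. smooth_on (local_dom c d id) (local_rep c d id))"

definition smooth_map ::
  "('p, 'e::euclidean_space) manifold \<Rightarrow> ('q, 'f::euclidean_space) manifold \<Rightarrow> ('p \<Rightarrow> 'q) \<Rightarrow> bool" where
  "smooth_map M N F \<longleftrightarrow> continuous_map (mtop M) (mtop N) F \<and>
     (\<forall>c\<in>atlas M. \<forall>d\<in>atlas N. smooth_on (local_dom c d F) (local_rep c d F))"

definition diffeomorphism :: "('p, 'e::euclidean_space) manifold \<Rightarrow> ('p \<Rightarrow> 'p) \<Rightarrow> bool" where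
  "diffeomorphism M F \<longleftrightarrow>
     bij_betw F (topspace (mtop M)) (topspace (mtop M)) \<and>
     smooth_map M M F \<and> smooth_map M M (inv_into (topspace (mtop M)) F)"

definition euclidean_manifold :: "('e::euclidean_space, 'e) manifold" where
  "euclidean_manifold = \<lparr>mtop = euclidean, atlas = {(UNIV, id)}\<rparr>"

definition product_manifold ::
  "('p, 'e) manifold \<Rightarrow> ('q, 'f) manifold \<Rightarrow> ('p \<times> 'q, 'e \<times> 'f) manifold" where
  "product_manifold M N =
     \<lparr>mtop = prod_topology (mtop M) (mtop N),
      atlas = {(fst c \<times> fst d, map_prod (snd c) (snd d)) | c d. c \<in> atlas M \<and> d \<in> atlas N}\<rparr>"

definition quotient_topology :: "'a topology \<Rightarrow> ('a \<Rightarrow> 'b) \<Rightarrow> 'b topology" where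
  "quotient_topology X q =
     topology (\<lambda>V. V \<subseteq> q ` topspace X \<and> openin X {x \<in> topspace X. q x \<in> V})"

lemma openin_quotient_topology:
  "openin (quotient_topology X q) V \<longleftrightarrow>
     V \<subseteq> q ` topspace X \<and> openin X {x \<in> topspace X. q x \<in> V}"
proof -
  have "istopology (\<lambda>V. V \<subseteq> q ` topspace X \<and> openin X {x \<in> topspace X. q x \<in> V})"
    unfolding istopology_def
  proof (intro conjI allI impI)
    fix S T
    assume S: "S \<subseteq> q ` topspace X \<and> openin X {x \<in> topspace X. q x \<in> S}"
      and T: "T \<subseteq> q ` topspace X \<and> openin X {x \<in> topspace X. q x \<in> T}"
    have "{x \<in> topspace X. q x \<in> S \<inter> T} =
        {x \<in> topspace X. q x \<in> S} \<inter> {x \<in> topspace X. q x \<in> T}"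
      by blast
    then show "openin X {x \<in> topspace X. q x \<in> S \<inter> T}"
      using S T by (simp only: openin_Int)
    show "S \<inter> T \<subseteq> q ` topspace X"
      using S by blast
  next
    fix K
    assume K: "\<forall>V\<in>K. V \<subseteq> q ` topspace X \<and> openin X {x \<in> topspace X. q x \<in> V}"
    have "{x \<in> topspace X. q x \<in> \<Union>K} = (\<Union>V\<in>K. {x \<in> topspace X. q x \<in> V})"
      by blast
    moreover have "openin X (\<Union>V\<in>K. {x \<in> topspace X. q x \<in> V})"
      using K by (intro openin_Union) blast
    ultimately show "openin X {x \<in> topspace X. q x \<in> \<Union>K}"
      by (simp only:)
    show "\<Union>K \<subseteq> q ` topspace X"
      using K by blast
  qed
  then show ?thesis
    unfolding quotient_topology_def by (simp only: topology_inverse')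
qed

lemma quotient_map_quotient_topology: "quotient_map X (quotient_topology X q) q"
proof -
  have "{x \<in> topspace X. q x \<in> q ` topspace X} = topspace X"
    by blast
  then have "openin (quotient_topology X q) (q ` topspace X)"
    unfolding openin_quotient_topology by simp
  then have "q ` topspace X \<subseteq> topspace (quotient_topology X q)"
    by (rule openin_subset)
  moreover have "topspace (quotient_topology X q) \<subseteq> q ` topspace X"
    using openin_topspace[of "quotient_topology X q"] unfolding openin_quotient_topology by (rule conjunct1)
  ultimately show ?thesis
    unfolding quotient_map_def openin_quotient_topology by blast
qed

text \<open>Quotient by an equivalence relation \<open>R\<close> on the points; a point of the quotient is an
  equivalence class. The charts are the charts of \<open>M\<close> composed with local inverses of the
  projection. This is the usual smooth structure when \<open>R\<close> is the orbit relation of a free, properly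
  discontinuous action by diffeomorphisms, which is the only case used below.\<close>

definition quotient_manifold :: "('p, 'e) manifold \<Rightarrow> ('p \<times> 'p) set \<Rightarrow> ('p set, 'e) manifold" where
  "quotient_manifold M R =
     \<lparr>mtop = quotient_topology (mtop M) (\<lambda>x. R `` {x}),
      atlas = {((\<lambda>x. R `` {x}) ` U, snd c \<circ> inv_into U (\<lambda>x. R `` {x})) | c U.
                 c \<in> atlas M \<and> U \<subseteq> fst c \<and> openin (mtop M) U \<and> inj_on (\<lambda>x. R `` {x}) U}\<rparr>"

definition lattice3 :: "(real^3) set \<Rightarrow> bool" where
  "lattice3 \<Gamma> \<longleftrightarrow> (\<exists>B. independent B \<and> span B = UNIV \<and>
     \<Gamma> = {\<Sum>b\<in>B. of_int (m b) *\<^sub>R b | m :: real^3 \<Rightarrow> int. True})"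

definition torus3 :: "(real^3) set \<Rightarrow> ((real^3) set, real^3) manifold" where
  "torus3 \<Gamma> = quotient_manifold euclidean_manifold {(x, x + \<gamma>) | x \<gamma>. \<gamma> \<in> \<Gamma>}"

definition int_iterate :: "'a set \<Rightarrow> ('a \<Rightarrow> 'a) \<Rightarrow> int \<Rightarrow> 'a \<Rightarrow> 'a" where
  "int_iterate S f n = (if 0 \<le> n then f ^^ nat n else inv_into S f ^^ nat (- n))"

definition mapping_torus ::
  "('p, 'e) manifold \<Rightarrow> ('p \<Rightarrow> 'p) \<Rightarrow> (('p \<times> real) set, 'e \<times> real) manifold" where
  "mapping_torus M f = quotient_manifold (product_manifold M euclidean_manifold)
     {((x, t), (int_iterate (topspace (mtop M)) f n x, t + of_int n)) | x t n.
        x \<in> topspace (mtop M)}"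


section \<open>Tensor fields\<close>

text \<open>A tensor field is given by its local representatives: one function of the coordinate point for
  each chart of the atlas, related on overlaps by the derivatives of the transition maps. A
  covariant tensor of degree \<open>r\<close> takes a list of \<open>r\<close> vectors; its values on lists of other lengths
  are irrelevant.\<close>

type_synonym ('p, 'e) cov_field = "('p, 'e) chart \<Rightarrow> 'e \<Rightarrow> 'e list \<Rightarrow> real"
type_synonym ('p, 'e) endo_field = "('p, 'e) chart \<Rightarrow> 'e \<Rightarrow> 'e \<Rightarrow> 'e"

text \<open>\<open>\<beta>\<close> is the pullback \<open>F\<^sup>*\<alpha>\<close>, for covariant fields of degree \<open>r\<close>.\<close>

definition is_pullback ::
  "nat \<Rightarrow> ('p, 'e::euclidean_space) manifold \<Rightarrow> ('q, 'f::euclidean_space) manifold \<Rightarrow> ('p \<Rightarrow> 'q) \<Rightarrow>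
     ('q, 'f) cov_field \<Rightarrow> ('p, 'e) cov_field \<Rightarrow> bool" where
  "is_pullback r M N F \<alpha> \<beta> \<longleftrightarrow>
     (\<forall>c\<in>atlas M. \<forall>d\<in>atlas N. \<forall>p\<in>fst c. F p \<in> fst d \<longrightarrow>
        (\<forall>vs. length vs = r \<longrightarrow>
           \<beta> c (snd c p) vs =
           \<alpha> d (snd d (F p)) (map (frechet_derivative (local_rep c d F) (at (snd c p))) vs)))"

text \<open>\<open>dF \<circ> J = K \<circ> dF\<close>.\<close>

definition intertwines ::
  "('p, 'e::euclidean_space) manifold \<Rightarrow> ('q, 'f::euclidean_space) manifold \<Rightarrow> ('p \<Rightarrow> 'q) \<Rightarrow>
     ('p, 'e) endo_field \<Rightarrow> ('q, 'f) endo_field \<Rightarrow> bool" where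
  "intertwines M N F J K \<longleftrightarrow>
     (\<forall>c\<in>atlas M. \<forall>d\<in>atlas N. \<forall>p\<in>fst c. F p \<in> fst d \<longrightarrow>
        (\<forall>v. frechet_derivative (local_rep c d F) (at (snd c p)) (J c (snd c p) v) =
             K d (snd d (F p)) (frechet_derivative (local_rep c d F) (at (snd c p)) v)))"

text \<open>In the next two definitions the last conjunct, with \<open>F = id\<close>, is the transformation law under
  change of chart.\<close>

definition covariant_tensor :: "nat \<Rightarrow> ('p, 'e::euclidean_space) manifold \<Rightarrow> ('p, 'e) cov_field \<Rightarrow> bool" where
  "covariant_tensor r M \<alpha> \<longleftrightarrow>
     (\<forall>c\<in>atlas M. \<forall>vs. length vs = r \<longrightarrow>
        smooth_on (snd c ` fst c) (\<lambda>x. \<alpha> c x vs) \<and>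
        (\<forall>x\<in>snd c ` fst c. \<forall>i<r. linear (\<lambda>v. \<alpha> c x (vs[i := v])))) \<and>
     is_pullback r M M id \<alpha> \<alpha>"

definition endomorphism_field :: "('p, 'e::euclidean_space) manifold \<Rightarrow> ('p, 'e) endo_field \<Rightarrow> bool" where
  "endomorphism_field M J \<longleftrightarrow>
     (\<forall>c\<in>atlas M. (\<forall>v. smooth_on (snd c ` fst c) (\<lambda>x. J c x v)) \<and>
        (\<forall>x\<in>snd c ` fst c. linear (J c x))) \<and>
     intertwines M M id J J"

definition differential_form :: "nat \<Rightarrow> ('p, 'e::euclidean_space) manifold \<Rightarrow> ('p, 'e) cov_field \<Rightarrow> bool" where
  "differential_form r M \<alpha> \<longleftrightarrow> covariant_tensor r M \<alpha> \<and>
     (\<forall>c\<in>atlas M. \<forall>x\<in>snd c ` fst c. \<forall>vs. length vs = r \<longrightarrow>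
        (\<forall>i j. i < j \<and> j < r \<and> vs ! i = vs ! j \<longrightarrow> \<alpha> c x vs = 0))"

text \<open>Equality of covariant fields of degree \<open>r\<close>, disregarding irrelevant arguments.\<close>

definition field_eq ::
  "nat \<Rightarrow> ('p, 'e) manifold \<Rightarrow> ('p, 'e) cov_field \<Rightarrow> ('p, 'e) cov_field \<Rightarrow> bool" where
  "field_eq r M \<alpha> \<beta> \<longleftrightarrow>
     (\<forall>c\<in>atlas M. \<forall>x\<in>snd c ` fst c. \<forall>vs. length vs = r \<longrightarrow> \<alpha> c x vs = \<beta> c x vs)"

text \<open>Exterior derivative in coordinates. The general formula is
  \<open>d\<alpha>(X\<^sub>0,\<dots>,X\<^sub>r) = \<Sum>\<^sub>i (-1)\<^sup>i X\<^sub>i(\<alpha>(\<dots>,X\<^sub>i omitted,\<dots>)) + (bracket terms)\<close>; for constant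
  vectors in a chart the brackets vanish.\<close>

definition ext_d :: "('p, 'e::euclidean_space) cov_field \<Rightarrow> ('p, 'e) cov_field" where
  "ext_d \<alpha> c x vs =
     (\<Sum>i<length vs. (-1) ^ i *
        frechet_derivative (\<lambda>y. \<alpha> c y (take i vs @ drop (Suc i) vs)) (at x) (vs ! i))"

definition closed_form :: "nat \<Rightarrow> ('p, 'e::euclidean_space) manifold \<Rightarrow> ('p, 'e) cov_field \<Rightarrow> bool" where
  "closed_form r M \<alpha> \<longleftrightarrow> field_eq (Suc r) M (ext_d \<alpha>) (\<lambda>c x vs. 0)"

definition form_act :: "('p, 'e) endo_field \<Rightarrow> ('p, 'e) cov_field \<Rightarrow> ('p, 'e) cov_field" where
  "form_act A \<alpha> c x vs = \<alpha> c x (map (A c x) vs)"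

definition d_c :: "('p, 'e::euclidean_space) endo_field \<Rightarrow> ('p, 'e) cov_field \<Rightarrow> ('p, 'e) cov_field" where
  "d_c J \<alpha> = form_act (\<lambda>c x. inv (J c x)) (ext_d (form_act J \<alpha>))"


section \<open>Complex, Hermitian, hyperKaehler and generalized Kaehler structures\<close>

definition riemannian_metric :: "('p, 'e::euclidean_space) manifold \<Rightarrow> ('p, 'e) cov_field \<Rightarrow> bool" where
  "riemannian_metric M g \<longleftrightarrow> covariant_tensor 2 M g \<and>
     (\<forall>c\<in>atlas M. \<forall>x\<in>snd c ` fst c.
        (\<forall>u v. g c x [u, v] = g c x [v, u]) \<and> (\<forall>v. v \<noteq> 0 \<longrightarrow> g c x [v, v] > 0))"

definition almost_complex_structure :: "('p, 'e::euclidean_space) manifold \<Rightarrow> ('p, 'e) endo_field \<Rightarrow> bool" where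
  "almost_complex_structure M J \<longleftrightarrow> endomorphism_field M J \<and>
     (\<forall>c\<in>atlas M. \<forall>x\<in>snd c ` fst c. \<forall>v. J c x (J c x v) = - v)"

text \<open>Integrability means existence of local holomorphic coordinates: near every point there is a
  smooth change of coordinates \<open>h\<close> carrying \<open>J\<close> to a constant linear complex structure \<open>J\<^sub>0\<close>, that
  is, to the standard one of the complex vector space \<open>('e, J\<^sub>0)\<close>. Two such coordinate systems are
  related by holomorphic maps.\<close>

definition complex_structure :: "('p, 'e::euclidean_space) manifold \<Rightarrow> ('p, 'e) endo_field \<Rightarrow> bool" where
  "complex_structure M J \<longleftrightarrow> almost_complex_structure M J \<and>
     (\<forall>c\<in>atlas M. \<forall>x\<in>snd c ` fst c.
        \<exists>W (h :: 'e \<Rightarrow> 'e) J\<^sub>0. open W \<and> x \<in> W \<and> W \<subseteq> snd c ` fst c \<and>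
          inj_on h W \<and> open (h ` W) \<and> smooth_on W h \<and> smooth_on (h ` W) (inv_into W h) \<and>
          linear J\<^sub>0 \<and> (\<forall>v. J\<^sub>0 (J\<^sub>0 v) = - v) \<and>
          (\<forall>y\<in>W. \<forall>v. frechet_derivative h (at y) (J c y v) = J\<^sub>0 (frechet_derivative h (at y) v)))"

definition compatible :: "('p, 'e) manifold \<Rightarrow> ('p, 'e) cov_field \<Rightarrow> ('p, 'e) endo_field \<Rightarrow> bool" where
  "compatible M g J \<longleftrightarrow>
     (\<forall>c\<in>atlas M. \<forall>x\<in>snd c ` fst c. \<forall>u v. g c x [J c x u, J c x v] = g c x [u, v])"

text \<open>Sign convention: \<open>\<omega>(X,Y) = g(JX,Y)\<close>.\<close>

definition fundamental_form :: "('p, 'e) cov_field \<Rightarrow> ('p, 'e) endo_field \<Rightarrow> ('p, 'e) cov_field" where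
  "fundamental_form g J c x vs = g c x [J c x (vs ! 0), vs ! 1]"

definition kaehler ::
  "('p, 'e::euclidean_space) manifold \<Rightarrow> ('p, 'e) cov_field \<Rightarrow> ('p, 'e) endo_field \<Rightarrow> bool" where
  "kaehler M k J \<longleftrightarrow> riemannian_metric M k \<and> complex_structure M J \<and> compatible M k J \<and>
     closed_form 2 M (fundamental_form k J)"

definition hyperkaehler ::
  "('p, 'e::euclidean_space) manifold \<Rightarrow> ('p, 'e) cov_field \<Rightarrow>
     ('p, 'e) endo_field \<Rightarrow> ('p, 'e) endo_field \<Rightarrow> ('p, 'e) endo_field \<Rightarrow> bool" where
  "hyperkaehler M k J\<^sub>1 J\<^sub>2 J\<^sub>3 \<longleftrightarrow>
     smooth_manifold M \<and> topspace (mtop M) \<noteq> {} \<and> (\<exists>m\<ge>1. DIM('e) = 4 * m) \<and>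
     kaehler M k J\<^sub>1 \<and> kaehler M k J\<^sub>2 \<and> kaehler M k J\<^sub>3 \<and>
     (\<forall>c\<in>atlas M. \<forall>x\<in>snd c ` fst c. \<forall>v.
        J\<^sub>1 c x (J\<^sub>2 c x v) = J\<^sub>3 c x v \<and> - J\<^sub>2 c x (J\<^sub>1 c x v) = J\<^sub>3 c x v)"

definition generalized_kaehler ::
  "('p, 'e::euclidean_space) manifold \<Rightarrow> ('p, 'e) cov_field \<Rightarrow>
     ('p, 'e) endo_field \<Rightarrow> ('p, 'e) endo_field \<Rightarrow> bool" where
  "generalized_kaehler M g I\<^sub>p I\<^sub>m \<longleftrightarrow>
     smooth_manifold M \<and> (\<exists>n. DIM('e) = 2 * n) \<and> riemannian_metric M g \<and>
     complex_structure M I\<^sub>p \<and> complex_structure M I\<^sub>m \<and> compatible M g I\<^sub>p \<and> compatible M g I\<^sub>m \<and>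
     (\<exists>H. differential_form 3 M H \<and> closed_form 3 M H \<and>
        field_eq 3 M (d_c I\<^sub>p (fundamental_form g I\<^sub>p)) H \<and>
        field_eq 3 M (\<lambda>c x vs. - d_c I\<^sub>m (fundamental_form g I\<^sub>m) c x vs) H)"

definition split_structure ::
  "('p, 'e) manifold \<Rightarrow> ('p, 'e) endo_field \<Rightarrow> ('p, 'e) endo_field \<Rightarrow> bool" where
  "split_structure M I\<^sub>p I\<^sub>m \<longleftrightarrow>
     (\<forall>c\<in>atlas M. \<forall>x\<in>snd c ` fst c. \<forall>v. I\<^sub>p c x (I\<^sub>m c x v) = I\<^sub>m c x (I\<^sub>p c x v))"


section \<open>Admissible families of coframes on the three-torus\<close>

text \<open>Row \<open>i\<close> of the matrix consists of the components of \<open>e\<^sub>i(t)\<close>, respectively \<open>e\<^sup>i(t)\<close>, in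
  the standard coordinates.\<close>

definition frame3 :: "(real \<Rightarrow> real) \<Rightarrow> (real \<Rightarrow> real) \<Rightarrow> (real \<Rightarrow> real) \<Rightarrow> real \<Rightarrow> real^3^3" where
  "frame3 a\<^sub>1 b\<^sub>2 b\<^sub>3 t = vector
     [vector [a\<^sub>1 t, 0, 0],
      vector [0, b\<^sub>2 t, b\<^sub>3 t],
      vector [0, - b\<^sub>3 t, b\<^sub>2 t]]"

definition l_coeff :: "(real \<Rightarrow> real) \<Rightarrow> (real \<Rightarrow> real) \<Rightarrow> real \<Rightarrow> real" where
  "l_coeff b\<^sub>2 b\<^sub>3 t = (b\<^sub>2 t)\<^sup>2 + (b\<^sub>3 t)\<^sup>2"

definition v_coeff :: "(real \<Rightarrow> real) \<Rightarrow> (real \<Rightarrow> real) \<Rightarrow> real \<Rightarrow> real" where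
  "v_coeff b\<^sub>2 b\<^sub>3 t = b\<^sub>2 t * D01 b\<^sub>2 t + b\<^sub>3 t * D01 b\<^sub>3 t"

definition w_coeff :: "(real \<Rightarrow> real) \<Rightarrow> (real \<Rightarrow> real) \<Rightarrow> real \<Rightarrow> real" where
  "w_coeff b\<^sub>2 b\<^sub>3 t = b\<^sub>2 t * D01 b\<^sub>3 t - b\<^sub>3 t * D01 b\<^sub>2 t"

definition coframe3 :: "(real \<Rightarrow> real) \<Rightarrow> (real \<Rightarrow> real) \<Rightarrow> (real \<Rightarrow> real) \<Rightarrow> real \<Rightarrow> real^3^3" where
  "coframe3 a\<^sub>1 b\<^sub>2 b\<^sub>3 t = vector
     [vector [1 / a\<^sub>1 t, 0, 0],
      vector [0, b\<^sub>2 t / l_coeff b\<^sub>2 b\<^sub>3 t, b\<^sub>3 t / l_coeff b\<^sub>2 b\<^sub>3 t],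
      vector [0, - b\<^sub>3 t / l_coeff b\<^sub>2 b\<^sub>3 t, b\<^sub>2 t / l_coeff b\<^sub>2 b\<^sub>3 t]]"

definition admissible :: "(real \<Rightarrow> real) \<Rightarrow> (real \<Rightarrow> real) \<Rightarrow> (real \<Rightarrow> real) \<Rightarrow> bool" where
  "admissible a\<^sub>1 b\<^sub>2 b\<^sub>3 \<longleftrightarrow>
     smooth01 a\<^sub>1 \<and> smooth01 b\<^sub>2 \<and> smooth01 b\<^sub>3 \<and>
     (\<forall>t\<in>{0..1}. independent (rows (frame3 a\<^sub>1 b\<^sub>2 b\<^sub>3 t)) \<and> span (rows (frame3 a\<^sub>1 b\<^sub>2 b\<^sub>3 t)) = UNIV) \<and>
     v_coeff b\<^sub>2 b\<^sub>3 1 / l_coeff b\<^sub>2 b\<^sub>3 1 = v_coeff b\<^sub>2 b\<^sub>3 0 / l_coeff b\<^sub>2 b\<^sub>3 0 \<and>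
     w_coeff b\<^sub>2 b\<^sub>3 1 / l_coeff b\<^sub>2 b\<^sub>3 1 = w_coeff b\<^sub>2 b\<^sub>3 0 / l_coeff b\<^sub>2 b\<^sub>3 0"

text \<open>The one-form \<open>\<theta>\<^sub>1 dx\<^sup>1 + \<theta>\<^sub>2 dx\<^sup>2 + \<theta>\<^sub>3 dx\<^sup>3\<close> on the torus. Every chart of \<open>torus3 \<Gamma>\<close> is a local
  inverse of the projection from \<open>\<real>\<^sup>3\<close>, so its coordinates are the standard ones up to translation and
  the form has the same components in all charts.\<close>

definition torus_one_form :: "real^3 \<Rightarrow> ((real^3) set, real^3) cov_field" where
  "torus_one_form \<theta> c x vs = \<theta> \<bullet> (vs ! 0)"

end

theory Submission
  imports Defs
begin

text \<open>Because \<open>\<rho>\<close> carries the constant coframe \<open>e(1)\<close> to \<open>e(0)\<close>, its derivative is a constant matrix: a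
  scaling by \<open>\<mu> = a\<^sub>1(1) / a\<^sub>1(0) > 0\<close> on the first axis and multiplication by a complex number of square
  modulus \<open>l(1) / l(0)\<close> on the plane of the other two. A lift of \<open>\<rho>\<close> to \<open>\<real>\<^sup>3\<close> is affine and its linear
  part preserves the lattice, so this matrix has determinant 1; by Rolle's theorem the condition on
  \<open>(1/l)'\<close> gives \<open>l(1) \<noteq> l(0)\<close>, hence \<open>\<mu> \<noteq> 1\<close>. With \<open>\<lambda> = ln \<mu>\<close> and \<open>y = e\<^sup>\<lambda>\<^sup>t\<close>, the Inoue-type metric
  \<open>(dx\<^sub>1\<^sup>2 + dy\<^sup>2) / y\<^sup>2 + y (dx\<^sub>2\<^sup>2 + dx\<^sub>3\<^sup>2) + k\<close> on the product of \<open>\<T>\<^sup>3\<close>, \<open>N\<close> and \<open>\<real>\<close> is invariant under the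
  deck transformation. The complex structures \<open>I\<^sub>\<plusminus>\<close> have holomorphic coordinates \<open>x\<^sub>1 + i y\<close> and
  \<open>x\<^sub>2 \<plusminus> i x\<^sub>3\<close>, and are \<open>J\<^sub>1\<close> and \<open>J\<^sub>2\<close> on \<open>N\<close>. Reversing the orientation of the plane changes the sign of
  \<open>d\<^sup>c\<omega> = \<minusplus>dx\<^sub>1 \<and> dx\<^sub>2 \<and> dx\<^sub>3\<close>, to which the Kaehler factor does not contribute, and \<open>J\<^sub>1 J\<^sub>2 \<noteq> J\<^sub>2 J\<^sub>1\<close> makes
  the structure non-split. Since \<open>y\<close> is used in place of the given coframes for \<open>0 < t < 1\<close>, no
  smoothing at the seam of the mapping torus is needed.\<close>

section \<open>Calculus of smooth functions\<close>

text \<open>The metric is dictated by the scaling of the deck transformation. It multiplies x1 and y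
  alike by \<mu>, so the hyperbolic metric of the half-plane is invariant; on the plane of x2 and x3
  it multiplies squared lengths by l(1) / l(0) = 1 / \<mu>, and the weight y compensates exactly
  that. Determinant 1 is thus the agreement of the two weights, and \<open>\<mu> \<noteq> 1\<close>
  is what lets y serve as a coordinate in place of t. The fundamental forms are dx1 \<and> dy / y^2
  + \<sigma> y dx2 \<and> dx3 + k(J., .) with \<sigma> = 1 or -1. The first term is closed, being of
  top degree in the half-plane, and the last by the Kaehler condition; so d sees only the weight y,
  leaving \<sigma> dy \<and> dx2 \<and> dx3, and the complex structure turns dy into dx1 up to sign.
  On the four-dimensional factor the two structures commute: they agree on the half-plane and are
  opposite on the other plane. Noncommutation can come only from N, hence two different members of
  the quaternionic triple. All tensors are computed on the cover and checked against one generator;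
  a general descent principle carries them to the quotient.\<close>

lemma frechet_derivative_cong_open:
  assumes "open S" "x \<in> S" "\<And>y. y \<in> S \<Longrightarrow> f y = g y"
  shows "frechet_derivative f (at x) = frechet_derivative g (at x)"
proof -
  \<comment> \<open>\<open>frechet_derivative\<close> is a choice among the maps \<open>D\<close>
    with this property, so it suffices that f and g admit the same \<open>D\<close>; this covers
    points of non-differentiability too.\<close>
  have "(f has_derivative D) (at x) = (g has_derivative D) (at x)" for D
    using has_derivative_transform_within_open[OF _ assms(1,2), of f D UNIV g]
      has_derivative_transform_within_open[OF _ assms(1,2), of g D UNIV f] assms(3) by auto
  then show ?thesis
    unfolding frechet_derivative_def by simp
qed

lemma Ck_on_cong:
  assumes "Ck_on k S f" "open S" "\<And>x. x \<in> S \<Longrightarrow> f x = g x"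
  shows "Ck_on k S g"
  using assms(1,3)
proof (induction k arbitrary: f g)
  case 0
  then show ?case
    using continuous_on_cong[of S S f g] by simp
next
  case (Suc k)
  have "g differentiable (at x)" if "x \<in> S" for x
  proof -
    have "f differentiable (at x)"
      using Suc.prems(1) that by simp
    then have D: "(f has_derivative frechet_derivative f (at x)) (at x)"
      by (simp add: frechet_derivative_works)
    then have "(g has_derivative frechet_derivative f (at x)) (at x)"
      using has_derivative_transform_within_open[OF D assms(2) that] Suc.prems(2) by simp
    then show ?thesis
      by (rule differentiableI)
  qed
  moreover have "Ck_on k S (\<lambda>x. frechet_derivative g (at x) v)" for v
  proof (rule Suc.IH)
    show "Ck_on k S (\<lambda>x. frechet_derivative f (at x) v)"
      using Suc.prems(1) by simp
    show "frechet_derivative f (at x) v = frechet_derivative g (at x) v" if "x \<in> S" for x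
      by (rule fun_cong[OF frechet_derivative_cong_open[OF assms(2) that Suc.prems(2)]])
  qed
  ultimately show ?case
    by simp
qed

lemma Ck_on_subset: "Ck_on k T f \<Longrightarrow> S \<subseteq> T \<Longrightarrow> Ck_on k S f"
proof (induction k arbitrary: f)
  case 0
  then show ?case
    using continuous_on_subset[of T f S] by simp
next
  case (Suc k)
  have "Ck_on k S (\<lambda>x. frechet_derivative f (at x) v)" for v
    using Suc.prems by (intro Suc.IH) simp_all
  then show ?case
    using Suc.prems by (simp add: subset_iff)
qed

lemma Ck_on_local:
  assumes "\<And>x. x \<in> S \<Longrightarrow> \<exists>T. open T \<and> x \<in> T \<and> Ck_on k T f"
  shows "Ck_on k S f"
  using assms
proof (induction k arbitrary: f)
  case 0
  show ?case
    unfolding Ck_on.simps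
  proof (rule continuous_at_imp_continuous_on, intro ballI)
    fix x assume "x \<in> S"
    then obtain T where "open T" "x \<in> T" "continuous_on T f"
      using 0[of x] unfolding Ck_on.simps by blast
    then show "isCont f x"
      by (simp add: continuous_on_eq_continuous_at)
  qed
next
  case (Suc k)
  have "Ck_on k S (\<lambda>x. frechet_derivative f (at x) v)" for v
  proof (rule Suc.IH)
    fix x assume "x \<in> S"
    then show "\<exists>T. open T \<and> x \<in> T \<and> Ck_on k T (\<lambda>x. frechet_derivative f (at x) v)"
      using Suc.prems[of x] unfolding Ck_on.simps by blast
  qed
  moreover have "\<forall>x\<in>S. f differentiable (at x)"
    using Suc.prems unfolding Ck_on.simps by blast
  ultimately show ?case
    by simp
qed

lemma Ck_on_Suc_imp: "Ck_on (Suc k) S f \<Longrightarrow> Ck_on k S f"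
proof (induction k arbitrary: f)
  case 0
  then show ?case
    by (intro Ck_on.simps(1)[THEN iffD2] continuous_at_imp_continuous_on) (simp add: differentiable_imp_continuous_within)
next
  case (Suc k)
  then show ?case
    by simp
qed

text \<open>Lets the closure proofs below name a derivative D explicitly and run the induction on D
  rather than on the opaque \<open>frechet_derivative\<close>.\<close>

lemma Ck_on_SucI:
  assumes "open S" "\<And>x. x \<in> S \<Longrightarrow> (f has_derivative D x) (at x)" "\<And>v. Ck_on k S (\<lambda>x. D x v)"
  shows "Ck_on (Suc k) S f"
proof -
  have "D x v = frechet_derivative f (at x) v" if "x \<in> S" for x v
    using frechet_derivative_at[OF assms(2)[OF that]] by simp
  then have "Ck_on k S (\<lambda>x. frechet_derivative f (at x) v)" for v
    by (rule Ck_on_cong[OF assms(3) assms(1)])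
  then show ?thesis
    using differentiableI[OF assms(2)] by simp
qed

lemma Ck_on_SucD:
  assumes "Ck_on (Suc k) S f" "x \<in> S"
  shows "(f has_derivative frechet_derivative f (at x)) (at x)"
  using assms by (simp add: frechet_derivative_works)

lemma Ck_on_const: "open S \<Longrightarrow> Ck_on k S (\<lambda>x. c)"
proof (induction k arbitrary: c)
  case (Suc k)
  then show ?case
    by (intro Ck_on_SucI[OF Suc.prems has_derivative_const])
qed simp

lemma Ck_on_bounded_linear_compose:
  assumes "bounded_linear L" "open S" "Ck_on k S f"
  shows "Ck_on k S (\<lambda>x. L (f x))"
  using assms(3)
proof (induction k arbitrary: f)
  case 0
  then show ?case
    by (simp add: bounded_linear.continuous_on[OF assms(1)])
next
  case (Suc k)
  show ?case
    by (rule Ck_on_SucI[OF assms(2) bounded_linear.has_derivative[OF assms(1) Ck_on_SucD[OF Suc.prems]]])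
      (use Suc in simp_all)
qed

lemma Ck_on_add:
  assumes "open S" "Ck_on k S f" "Ck_on k S g"
  shows "Ck_on k S (\<lambda>x. f x + g x)"
  using assms(2,3)
proof (induction k arbitrary: f g)
  case 0
  then show ?case
    by (simp add: continuous_on_add)
next
  case (Suc k)
  show ?case
    by (rule Ck_on_SucI[OF assms(1) has_derivative_add[OF Ck_on_SucD[OF Suc.prems(1)] Ck_on_SucD[OF Suc.prems(2)]]])
      (use Suc in simp_all)
qed

lemma Ck_on_sum:
  assumes "open S" "finite I" "\<And>i. i \<in> I \<Longrightarrow> Ck_on k S (f i)"
  shows "Ck_on k S (\<lambda>x. \<Sum>i\<in>I. f i x)"
  using assms(2,3) by (induction I) (simp_all add: Ck_on_const Ck_on_add assms(1))

text \<open>Product rule. The derivative contains f and g undifferentiated, so these are lowered by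
  one order with \<open>Ck_on_Suc_imp\<close> before the induction hypothesis applies.\<close>

lemma Ck_on_bilinear:
  assumes "bounded_bilinear B" "open S" "Ck_on k S f" "Ck_on k S g"
  shows "Ck_on k S (\<lambda>x. B (f x) (g x))"
  using assms(3,4)
proof (induction k arbitrary: f g)
  case 0
  then show ?case
    by (simp add: bounded_bilinear.continuous_on[OF assms(1)])
next
  case (Suc k)
  show ?case
    by (rule Ck_on_SucI[OF assms(2)
          bounded_bilinear.FDERIV[OF assms(1) Ck_on_SucD[OF Suc.prems(1)] Ck_on_SucD[OF Suc.prems(2)]]])
      (use Suc.IH Ck_on_Suc_imp[OF Suc.prems(1)] Ck_on_Suc_imp[OF Suc.prems(2)] Suc.prems in
        \<open>simp_all add: Ck_on_add assms(2)\<close>)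
qed

lemma Ck_on_ident: "open S \<Longrightarrow> Ck_on k S (\<lambda>x. x)"
proof (cases k)
  case (Suc k')
  show "Ck_on k S (\<lambda>x. x)" if "open S"
    unfolding Suc by (intro Ck_on_SucI[OF that has_derivative_ident] Ck_on_const that)
qed simp

text \<open>The chain rule evaluates the derivative of f in the direction \<open>?Dg x v\<close>,
  which moves with x, while \<open>Ck_on\<close> controls it only in fixed directions. Expanding
  that direction in a basis of \<open>'b\<close> leaves finitely many fixed directions with regular
  coefficients; hence the finite-dimensional middle space.\<close>

lemma Ck_on_compose:
  fixes g :: "'a::real_normed_vector \<Rightarrow> 'b::euclidean_space" and f :: "'b \<Rightarrow> 'c::real_normed_vector"
  assumes "open S" "open T" "g ` S \<subseteq> T" "Ck_on k S g" "Ck_on k T f"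
  shows "Ck_on k S (\<lambda>x. f (g x))"
  using assms(4,5)
proof (induction k arbitrary: f)
  case 0
  then show ?case
    using continuous_on_compose2[OF _ _ assms(3)] by simp
next
  case (Suc k)
  let ?Df = "\<lambda>y. frechet_derivative f (at y)" and ?Dg = "\<lambda>x. frechet_derivative g (at x)"
  have D: "((\<lambda>x. f (g x)) has_derivative (\<lambda>v. ?Df (g x) (?Dg x v))) (at x)" if "x \<in> S" for x
    using diff_chain_at[OF Ck_on_SucD[OF Suc.prems(1) that], of f "?Df (g x)"]
      Ck_on_SucD[OF Suc.prems(2), of "g x"] assms(3) that by (simp add: o_def image_subset_iff)
  have Ck: "Ck_on k S (\<lambda>x. ?Df (g x) (?Dg x v))" for v
  proof (rule Ck_on_cong)
    show "Ck_on k S (\<lambda>x. \<Sum>b\<in>Basis. (?Dg x v \<bullet> b) *\<^sub>R ?Df (g x) b)"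
    proof (intro Ck_on_sum Ck_on_bilinear[OF bounded_bilinear_scaleR] assms(1))
      fix b :: 'b
      show "Ck_on k S (\<lambda>x. ?Dg x v \<bullet> b)"
        using Suc.prems by (intro Ck_on_bounded_linear_compose[OF bounded_linear_inner_left]) (simp_all add: assms(1))
      show "Ck_on k S (\<lambda>x. ?Df (g x) b)"
        using Suc.prems Ck_on_Suc_imp[OF Suc.prems(1)] by (intro Suc.IH) simp_all
    qed simp
    fix x assume "x \<in> S"
    then have "linear (?Df (g x))"
      using Ck_on_SucD[OF Suc.prems(2)] assms(3) by (meson has_derivative_linear image_subset_iff)
    then have "?Df (g x) (\<Sum>b\<in>Basis. (?Dg x v \<bullet> b) *\<^sub>R b) = (\<Sum>b\<in>Basis. (?Dg x v \<bullet> b) *\<^sub>R ?Df (g x) b)"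
      by (simp add: linear_sum linear_scale)
    then show "(\<Sum>b\<in>Basis. (?Dg x v \<bullet> b) *\<^sub>R ?Df (g x) b) = ?Df (g x) (?Dg x v)"
      by (simp add: euclidean_representation)
  qed (rule assms(1))
  show ?case
    by (rule Ck_on_SucI[OF assms(1) D]) (simp_all add: Ck)
qed

section \<open>Smooth functions: transfer of the finite-order results, products, exponential and
  logarithm\<close>

lemma smooth_on_cong:
  "smooth_on S f \<Longrightarrow> open S \<Longrightarrow> (\<And>x. x \<in> S \<Longrightarrow> f x = g x) \<Longrightarrow> smooth_on S g"
  unfolding smooth_on_def by (blast intro: Ck_on_cong)

lemma smooth_on_subset: "smooth_on T f \<Longrightarrow> S \<subseteq> T \<Longrightarrow> smooth_on S f"
  unfolding smooth_on_def by (blast intro: Ck_on_subset)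

lemma smooth_on_local:
  assumes "\<And>x. x \<in> S \<Longrightarrow> \<exists>T g. open T \<and> x \<in> T \<and> smooth_on T g \<and> (\<forall>y\<in>T. f y = g y)"
  shows "smooth_on S f"
  unfolding smooth_on_def
proof (intro allI Ck_on_local)
  fix k x assume "x \<in> S"
  then obtain T g where *: "open T" "x \<in> T" "smooth_on T g" "\<forall>y\<in>T. f y = g y"
    using assms by blast
  then have "Ck_on k T f"
    unfolding smooth_on_def by (intro Ck_on_cong[of k T g f]) simp_all
  then show "\<exists>T. open T \<and> x \<in> T \<and> Ck_on k T f"
    using * by blast
qed

lemma smooth_on_const: "open S \<Longrightarrow> smooth_on S (\<lambda>x. c)"
  by (simp add: smooth_on_def Ck_on_const)

lemma smooth_on_ident: "open S \<Longrightarrow> smooth_on S (\<lambda>x. x)"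
  by (simp add: smooth_on_def Ck_on_ident)

lemma smooth_on_bounded_linear_compose:
  "bounded_linear L \<Longrightarrow> open S \<Longrightarrow> smooth_on S f \<Longrightarrow> smooth_on S (\<lambda>x. L (f x))"
  by (simp add: smooth_on_def Ck_on_bounded_linear_compose)

lemma smooth_on_bounded_linear: "bounded_linear L \<Longrightarrow> open S \<Longrightarrow> smooth_on S L"
  using smooth_on_bounded_linear_compose smooth_on_ident by blast

lemma smooth_on_add:
  "open S \<Longrightarrow> smooth_on S f \<Longrightarrow> smooth_on S g \<Longrightarrow> smooth_on S (\<lambda>x. f x + g x)"
  by (simp add: smooth_on_def Ck_on_add)

lemma smooth_on_sum:
  "open S \<Longrightarrow> finite I \<Longrightarrow> (\<And>i. i \<in> I \<Longrightarrow> smooth_on S (f i)) \<Longrightarrow> smooth_on S (\<lambda>x. \<Sum>i\<in>I. f i x)"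
  by (simp add: smooth_on_def Ck_on_sum)

lemma smooth_on_scaleR:
  "open S \<Longrightarrow> smooth_on S f \<Longrightarrow> smooth_on S g \<Longrightarrow> smooth_on S (\<lambda>x. f x *\<^sub>R g x)"
  by (simp add: smooth_on_def Ck_on_bilinear[OF bounded_bilinear_scaleR])

lemma smooth_on_mult:
  fixes f g :: "_ \<Rightarrow> real"
  shows "open S \<Longrightarrow> smooth_on S f \<Longrightarrow> smooth_on S g \<Longrightarrow> smooth_on S (\<lambda>x. f x * g x)"
  by (simp add: smooth_on_def Ck_on_bilinear[OF bounded_bilinear_mult])

lemma smooth_on_compose:
  fixes g :: "'a::real_normed_vector \<Rightarrow> 'b::euclidean_space"
  shows "open S \<Longrightarrow> open T \<Longrightarrow> g ` S \<subseteq> T \<Longrightarrow> smooth_on S g \<Longrightarrow> smooth_on T f \<Longrightarrow>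
    smooth_on S (\<lambda>x. f (g x))"
  unfolding smooth_on_def by (blast intro: Ck_on_compose)

lemma smooth_on_Pair:
  assumes "open S" "smooth_on S f" "smooth_on S g"
  shows "smooth_on S (\<lambda>x. (f x, g x))"
proof -
  have "smooth_on S (\<lambda>x. (f x, 0) + (0, g x))"
    by (intro smooth_on_add assms
        smooth_on_bounded_linear_compose[OF bounded_linear_Pair[OF bounded_linear_ident bounded_linear_zero]]
        smooth_on_bounded_linear_compose[OF bounded_linear_Pair[OF bounded_linear_zero bounded_linear_ident]])
  then show ?thesis
    by simp
qed

lemma smooth_on_fst: "open S \<Longrightarrow> smooth_on S f \<Longrightarrow> smooth_on S (\<lambda>x. fst (f x))"
  by (rule smooth_on_bounded_linear_compose[OF bounded_linear_fst])

lemma smooth_on_snd: "open S \<Longrightarrow> smooth_on S f \<Longrightarrow> smooth_on S (\<lambda>x. snd (f x))"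
  by (rule smooth_on_bounded_linear_compose[OF bounded_linear_snd])

lemma smooth_on_map_prod:
  fixes f :: "'a::euclidean_space \<Rightarrow> 'b::real_normed_vector"
    and g :: "'c::euclidean_space \<Rightarrow> 'd::real_normed_vector"
  assumes "open S" "open T" "smooth_on S f" "smooth_on T g"
  shows "smooth_on (S \<times> T) (map_prod f g)"
proof -
  have "open (S \<times> T)"
    using assms by (simp add: open_Times)
  moreover have "smooth_on (S \<times> T) (\<lambda>z. f (fst z))" "smooth_on (S \<times> T) (\<lambda>z. g (snd z))"
    using assms calculation
    by (intro smooth_on_compose[where g=fst and T=S and f=f] smooth_on_compose[where g=snd and T=T and f=g]
        smooth_on_fst smooth_on_snd smooth_on_ident; auto)+
  ultimately have "smooth_on (S \<times> T) (\<lambda>z. (f (fst z), g (snd z)))"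
    by (intro smooth_on_Pair)
  then show ?thesis
    by (simp add: map_prod_def case_prod_unfold)
qed

lemma smooth_on_exp: "open S \<Longrightarrow> smooth_on S (exp :: real \<Rightarrow> real)"
proof -
  assume S: "open S"
  have "Ck_on k S (exp :: real \<Rightarrow> real)" for k
  proof (induction k)
    case 0
    then show ?case
      by (simp add: continuous_on_exp)
  next
    case (Suc k)
    show ?case
    proof (rule Ck_on_SucI[OF S])
      show "(exp has_derivative (\<lambda>v. exp x * v)) (at x)" for x :: real
        using DERIV_exp unfolding has_field_derivative_def by blast
      show "Ck_on k S (\<lambda>x. exp x * v)" for v :: real
        using Ck_on_bounded_linear_compose[OF bounded_linear_mult_left S Suc] by simp
    qed
  qed
  then show ?thesis
    by (simp add: smooth_on_def)
qed

lemma smooth_on_ln: "smooth_on {0<..} (ln :: real \<Rightarrow> real)"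
proof -
  have inv: "Ck_on k {0<..} (inverse :: real \<Rightarrow> real)" for k
  proof (induction k)
    case 0
    then show ?case
      by (auto intro!: continuous_on_inverse continuous_on_id)
  next
    case (Suc k)
    show ?case
    proof (rule Ck_on_SucI)
      show "(inverse has_derivative (\<lambda>v. - (inverse x * v * inverse x))) (at x)" if "x \<in> {0<..}" for x :: real
        using has_derivative_inverse'[of x UNIV] that by simp
      show "Ck_on k {0<..} (\<lambda>x. - (inverse x * v * inverse x))" for v :: real
        by (intro Ck_on_bounded_linear_compose[OF bounded_linear_minus[OF bounded_linear_ident]]
            Ck_on_bilinear[OF bounded_bilinear_mult] Ck_on_const Suc) auto
    qed simp
  qed
  have "Ck_on k {0<..} (ln :: real \<Rightarrow> real)" for k
  proof (cases k)
    case 0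
    then show ?thesis
      by (auto intro!: continuous_on_ln)
  next
    case (Suc k')
    have "Ck_on (Suc k') {0<..} (ln :: real \<Rightarrow> real)"
    proof (rule Ck_on_SucI)
      show "(ln has_derivative (\<lambda>v. inverse x * v)) (at x)" if "x \<in> {0<..}" for x :: real
        using DERIV_ln[of x] that by (simp add: has_field_derivative_def)
      show "Ck_on k' {0<..} (\<lambda>x. inverse x * v)" for v :: real
        by (intro Ck_on_bilinear[OF bounded_bilinear_mult] Ck_on_const inv) auto
    qed simp
    then show ?thesis
      using Suc by simp
  qed
  then show ?thesis
    by (simp add: smooth_on_def)
qed

lemma smooth_on_has_derivative:
  assumes "smooth_on S f" "x \<in> S"
  shows "(f has_derivative frechet_derivative f (at x)) (at x)"
  using assms by (intro Ck_on_SucD[of 0 S]) (simp_all add: smooth_on_def del: Ck_on.simps)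

lemma smooth_on_continuous_on: "smooth_on S f \<Longrightarrow> continuous_on S f"
  unfolding smooth_on_def using Ck_on.simps(1)[of S f] by blast

section \<open>Charts and smooth maps\<close>

abbreviation chart_deriv ::
  "('p, 'e::euclidean_space) chart \<Rightarrow> ('q, 'f::euclidean_space) chart \<Rightarrow> ('p \<Rightarrow> 'q) \<Rightarrow> 'p \<Rightarrow> 'e \<Rightarrow> 'f"
  where "chart_deriv c d F p \<equiv> frechet_derivative (local_rep c d F) (at (snd c p))"

lemma chart:
  assumes "smooth_manifold M" "c \<in> atlas M"
  shows openin_chart: "openin (mtop M) (fst c)"
    and open_chart_image: "open (snd c ` fst c)"
    and homeomorphic_map_chart:
      "homeomorphic_map (subtopology (mtop M) (fst c)) (top_of_set (snd c ` fst c)) (snd c)"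
  using assms unfolding smooth_manifold_def by blast+

lemma chart_subset: "smooth_manifold M \<Longrightarrow> c \<in> atlas M \<Longrightarrow> fst c \<subseteq> topspace (mtop M)"
  using openin_chart openin_subset by blast

lemma chart_at:
  assumes "smooth_manifold M" "p \<in> topspace (mtop M)"
  obtains c where "c \<in> atlas M" "p \<in> fst c"
  using assms unfolding smooth_manifold_def by blast

lemma inj_on_chart: "smooth_manifold M \<Longrightarrow> c \<in> atlas M \<Longrightarrow> inj_on (snd c) (fst c)"
  using homeomorphic_imp_injective_map[OF homeomorphic_map_chart] chart_subset
  by (metis topspace_subtopology_subset)

lemma chart_inverse [simp]:
  "smooth_manifold M \<Longrightarrow> c \<in> atlas M \<Longrightarrow> p \<in> fst c \<Longrightarrow> inv_into (fst c) (snd c) (snd c p) = p"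
  using inj_on_chart inv_into_f_f by metis

lemma open_chart_image_subset:
  assumes "smooth_manifold M" "c \<in> atlas M" "openin (mtop M) U" "U \<subseteq> fst c"
  shows "open (snd c ` U)"
proof -
  have "openin (subtopology (mtop M) (fst c)) U"
    using assms by (simp add: openin_open_subtopology openin_chart)
  then have "openin (top_of_set (snd c ` fst c)) (snd c ` U)"
    using homeomorphic_imp_open_map[OF homeomorphic_map_chart[OF assms(1,2)]]
    unfolding open_map_def by blast
  then show ?thesis
    using open_chart_image[OF assms(1,2)] openin_open_trans by blast
qed

lemma local_rep_at [simp]:
  "smooth_manifold M \<Longrightarrow> c \<in> atlas M \<Longrightarrow> p \<in> fst c \<Longrightarrow> local_rep c d F (snd c p) = snd d (F p)"
  by (simp add: local_rep_def)

lemma mem_local_dom [simp]: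
  "smooth_manifold M \<Longrightarrow> c \<in> atlas M \<Longrightarrow> p \<in> fst c \<Longrightarrow> snd c p \<in> local_dom c d F \<longleftrightarrow> F p \<in> fst d"
  using inj_onD[OF inj_on_chart] unfolding local_dom_def by (fastforce simp: image_iff)

lemma open_local_dom:
  assumes "smooth_manifold M" "smooth_manifold N" "continuous_map (mtop M) (mtop N) F"
    "c \<in> atlas M" "d \<in> atlas N"
  shows "open (local_dom c d F)"
proof -
  have "{p \<in> fst c. F p \<in> fst d} = fst c \<inter> {p \<in> topspace (mtop M). F p \<in> fst d}"
    using chart_subset[OF assms(1,4)] by blast
  then have "openin (mtop M) {p \<in> fst c. F p \<in> fst d}"
    using openin_continuous_map_preimage[OF assms(3) openin_chart[OF assms(2,5)]]
      openin_chart[OF assms(1,4)] by auto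
  then show ?thesis
    unfolding local_dom_def by (intro open_chart_image_subset[OF assms(1,4)]) auto
qed

lemma smooth_mapD:
  assumes "smooth_map M N F"
  shows "continuous_map (mtop M) (mtop N) F"
    and "c \<in> atlas M \<Longrightarrow> d \<in> atlas N \<Longrightarrow> smooth_on (local_dom c d F) (local_rep c d F)"
  using assms unfolding smooth_map_def by blast+

lemma smooth_map_has_derivative:
  assumes "smooth_map M N F" "smooth_manifold M" "c \<in> atlas M" "d \<in> atlas N" "p \<in> fst c" "F p \<in> fst d"
  shows "(local_rep c d F has_derivative chart_deriv c d F p) (at (snd c p))"
  using assms by (intro smooth_on_has_derivative[OF smooth_mapD(2)]) auto

lemma smooth_map_id: "smooth_manifold M \<Longrightarrow> smooth_map M M id"
  unfolding smooth_map_def smooth_manifold_def by simp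

lemma smooth_map_in_topspace:
  "smooth_map M N F \<Longrightarrow> p \<in> topspace (mtop M) \<Longrightarrow> F p \<in> topspace (mtop N)"
  using smooth_mapD(1) continuous_map_image_subset_topspace by blast

lemma local_rep_compose:
  assumes "smooth_manifold M" "smooth_manifold N" "c \<in> atlas M" "d \<in> atlas N" "y \<in> local_dom c d F"
  shows "local_rep c e (G \<circ> F) y = local_rep d e G (local_rep c d F y)"
  using assms by (auto simp: local_dom_def)

text \<open>A chart domain of M need not be mapped into one chart of N. Hence smoothness is checked
  near each point, on the set \<open>?W\<close> where a chart of N at the image of that point is
  available in between.\<close>

lemma smooth_map_compose:
  assumes "smooth_manifold M" "smooth_manifold N" "smooth_manifold P" "smooth_map M N F" "smooth_map N P G"
  shows "smooth_map M P (G \<circ> F)"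
  unfolding smooth_map_def
proof (intro conjI ballI)
  show cont: "continuous_map (mtop M) (mtop P) (G \<circ> F)"
    by (rule continuous_map_compose[OF smooth_mapD(1)[OF assms(4)] smooth_mapD(1)[OF assms(5)]])
  fix c e assume c: "c \<in> atlas M" and e: "e \<in> atlas P"
  show "smooth_on (local_dom c e (G \<circ> F)) (local_rep c e (G \<circ> F))"
  proof (rule smooth_on_local)
    fix y assume "y \<in> local_dom c e (G \<circ> F)"
    then obtain p where p: "p \<in> fst c" "G (F p) \<in> fst e" "y = snd c p"
      by (auto simp: local_dom_def)
    have "F p \<in> topspace (mtop N)"
      using smooth_map_in_topspace[OF assms(4)] chart_subset[OF assms(1) c] p(1) by blast
    then obtain d where d: "d \<in> atlas N" "F p \<in> fst d"
      using chart_at[OF assms(2)] by blast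
    let ?W = "local_dom c d F \<inter> local_dom c e (G \<circ> F)"
    have W: "open ?W"
      by (intro open_Int open_local_dom[OF assms(1,2) smooth_mapD(1)[OF assms(4)] c d(1)]
          open_local_dom[OF assms(1,3) cont c e])
    have "local_rep c d F ` ?W \<subseteq> local_dom d e G"
    proof
      fix z assume "z \<in> local_rep c d F ` ?W"
      then obtain p' where "p' \<in> fst c" "F p' \<in> fst d" "snd c p' \<in> local_dom c e (G \<circ> F)"
        "z = local_rep c d F (snd c p')"
        by (auto simp: local_dom_def)
      then show "z \<in> local_dom d e G"
        using assms c d by simp
    qed
    then have "smooth_on ?W (\<lambda>y. local_rep d e G (local_rep c d F y))"
      by (rule smooth_on_compose[OF W open_local_dom[OF assms(2,3) smooth_mapD(1)[OF assms(5)] d(1) e] _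
            smooth_on_subset[OF smooth_mapD(2)[OF assms(4) c d(1)] Int_lower1] smooth_mapD(2)[OF assms(5) d(1) e]])
    moreover have "y \<in> ?W"
      using p d assms c by simp
    ultimately show "\<exists>T g. open T \<and> y \<in> T \<and> smooth_on T g \<and> (\<forall>y\<in>T. local_rep c e (G \<circ> F) y = g y)"
      using W by (intro exI[of _ ?W] exI[of _ "\<lambda>y. local_rep d e G (local_rep c d F y)"] conjI ballI
          local_rep_compose[OF assms(1,2) c d(1)]) simp_all
  qed
qed

lemma chart_deriv_compose:
  assumes "smooth_manifold M" "smooth_manifold N" "smooth_manifold P" "smooth_map M N F" "smooth_map N P G"
    and "c \<in> atlas M" "d \<in> atlas N" "e \<in> atlas P" "p \<in> fst c" "F p \<in> fst d" "G (F p) \<in> fst e"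
  shows "chart_deriv c e (G \<circ> F) p v = chart_deriv d e G (F p) (chart_deriv c d F p v)"
proof -
  have "(local_rep d e G has_derivative chart_deriv d e G (F p)) (at (local_rep c d F (snd c p)))"
    using smooth_map_has_derivative[of N P G d e "F p"] assms by simp
  then have "(local_rep d e G \<circ> local_rep c d F has_derivative
      chart_deriv d e G (F p) \<circ> chart_deriv c d F p) (at (snd c p))"
    by (rule diff_chain_at[OF smooth_map_has_derivative[OF assms(4,1,6,7,9,10)]])
  then have "(local_rep c e (G \<circ> F) has_derivative chart_deriv d e G (F p) \<circ> chart_deriv c d F p) (at (snd c p))"
  proof (rule has_derivative_transform_within_open)
    show "open (local_dom c d F)"
      by (rule open_local_dom[OF assms(1,2) smooth_mapD(1)[OF assms(4)] assms(6,7)])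
    show "snd c p \<in> local_dom c d F"
      using assms by simp
    show "(local_rep d e G \<circ> local_rep c d F) y = local_rep c e (G \<circ> F) y" if "y \<in> local_dom c d F" for y
      using local_rep_compose[OF assms(1,2,6,7) that, of e G] by simp
  qed
  from frechet_derivative_at[OF this] show ?thesis
    by (metis comp_apply)
qed

text \<open>Maps matter only on the carrier, and chart domains lie inside it. This allows
  \<open>F' \<circ> F\<close> to be treated as \<open>id\<close> although the two may differ off the
  carrier.\<close>

lemma chart_deriv_cong:
  assumes "smooth_manifold M" "smooth_manifold N" "smooth_map M N F" "c \<in> atlas M" "d \<in> atlas N"
    "p \<in> fst c" "F p \<in> fst d" "\<And>x. x \<in> topspace (mtop M) \<Longrightarrow> F x = G x"
  shows "chart_deriv c d F p = chart_deriv c d G p"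
proof (rule frechet_derivative_cong_open)
  show "open (local_dom c d F)"
    by (rule open_local_dom[OF assms(1,2) smooth_mapD(1)[OF assms(3)] assms(4,5)])
  show "snd c p \<in> local_dom c d F"
    using assms by simp
  fix y assume "y \<in> local_dom c d F"
  then show "local_rep c d F y = local_rep c d G y"
    using assms chart_subset[OF assms(1,4)] by (auto simp: local_dom_def)
qed

lemma smooth_map_cong:
  assumes "smooth_manifold M" "smooth_manifold N" "smooth_map M N F"
    and eq: "\<And>x. x \<in> topspace (mtop M) \<Longrightarrow> F x = G x"
  shows "smooth_map M N G"
  unfolding smooth_map_def
proof (intro conjI ballI)
  show "continuous_map (mtop M) (mtop N) G"
    using continuous_map_eq[OF smooth_mapD(1)[OF assms(3)] eq] by blast
  fix c d assume cd: "c \<in> atlas M" "d \<in> atlas N"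
  then have eq': "p \<in> fst c \<Longrightarrow> F p = G p" for p
    using chart_subset[OF assms(1)] eq by blast
  then have "local_dom c d G = local_dom c d F"
    by (auto simp: local_dom_def)
  moreover have "smooth_on (local_dom c d F) (local_rep c d G)"
  proof (rule smooth_on_cong[OF smooth_mapD(2)[OF assms(3) cd]
        open_local_dom[OF assms(1,2) smooth_mapD(1)[OF assms(3)] cd]])
    fix y assume "y \<in> local_dom c d F"
    then obtain p where "p \<in> fst c" "y = snd c p"
      by (auto simp: local_dom_def)
    then show "local_rep c d F y = local_rep c d G y"
      using eq' assms(1) cd by simp
  qed
  ultimately show "smooth_on (local_dom c d G) (local_rep c d G)"
    by simp
qed

lemma smooth_map_funpow:
  "smooth_manifold M \<Longrightarrow> smooth_map M M F \<Longrightarrow> smooth_map M M (F ^^ n)"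
  by (induction n) (simp_all add: smooth_map_id smooth_map_compose[of M M M])

lemma chart_deriv_id:
  assumes "smooth_manifold M" "c \<in> atlas M" "p \<in> fst c"
  shows "chart_deriv c c id p v = v"
proof -
  have "chart_deriv c c id p = frechet_derivative id (at (snd c p))"
    by (rule frechet_derivative_cong_open[where S="snd c ` fst c"])
      (use assms open_chart_image[OF assms(1,2)] in \<open>auto simp del: split_paired_All split_paired_Ex\<close>)
  then show ?thesis
    by simp
qed

lemma chart_deriv_inverse:
  assumes "smooth_manifold M" "smooth_map M M F" "smooth_map M M F'"
    and inv: "\<And>x. x \<in> topspace (mtop M) \<Longrightarrow> F' (F x) = x"
    and "c \<in> atlas M" "d \<in> atlas M" "p \<in> fst c" "F p \<in> fst d"
  shows "chart_deriv d c F' (F p) (chart_deriv c d F p v) = v"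
proof -
  have p: "p \<in> topspace (mtop M)"
    using assms chart_subset by blast
  have "chart_deriv d c F' (F p) (chart_deriv c d F p v) = chart_deriv c c (F' \<circ> F) p v"
    using chart_deriv_compose[OF assms(1,1,1,2,3)] assms(5-) inv[OF p] by simp
  also have "chart_deriv c c (F' \<circ> F) p = chart_deriv c c id p"
    using assms p by (intro chart_deriv_cong[of M M] smooth_map_compose[of M M M]) simp_all
  finally show ?thesis
    using chart_deriv_id assms by simp
qed

section \<open>Composition, inversion and iteration of invariance properties\<close>

lemma is_pullback_compose:
  assumes "smooth_manifold M" "smooth_manifold N" "smooth_manifold P" "smooth_map M N F" "smooth_map N P G"
    and "is_pullback r M N F \<alpha> \<beta>" "is_pullback r N P G \<gamma> \<alpha>"
  shows "is_pullback r M P (G \<circ> F) \<gamma> \<beta>"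
  unfolding is_pullback_def
proof (intro ballI impI allI)
  fix c e p and vs :: "'b list"
  assume c: "c \<in> atlas M" and e: "e \<in> atlas P" and p: "p \<in> fst c" "(G \<circ> F) p \<in> fst e" and vs: "length vs = r"
  have "F p \<in> topspace (mtop N)"
    using smooth_map_in_topspace[OF assms(4)] chart_subset[OF assms(1) c] p(1) by blast
  then obtain d where d: "d \<in> atlas N" "F p \<in> fst d"
    using chart_at[OF assms(2)] by blast
  have "\<beta> c (snd c p) vs = \<alpha> d (snd d (F p)) (map (chart_deriv c d F p) vs)"
    using assms(6) c d p vs unfolding is_pullback_def by blast
  also have "\<dots> = \<gamma> e (snd e (G (F p))) (map (chart_deriv d e G (F p)) (map (chart_deriv c d F p) vs))"
    using assms(7) d e p vs unfolding is_pullback_def by simp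
  also have "map (chart_deriv d e G (F p)) (map (chart_deriv c d F p) vs) = map (chart_deriv c e (G \<circ> F) p) vs"
    using chart_deriv_compose[OF assms(1-5) c d(1) e p(1) d(2)] p(2) by simp
  finally show "\<beta> c (snd c p) vs = \<gamma> e (snd e ((G \<circ> F) p)) (map (chart_deriv c e (G \<circ> F) p) vs)"
    by simp
qed

lemma intertwines_compose:
  assumes "smooth_manifold M" "smooth_manifold N" "smooth_manifold P" "smooth_map M N F" "smooth_map N P G"
    and "intertwines M N F J K" "intertwines N P G K L"
  shows "intertwines M P (G \<circ> F) J L"
  unfolding intertwines_def
proof (intro ballI impI allI)
  fix c e p v
  assume c: "c \<in> atlas M" and e: "e \<in> atlas P" and p: "p \<in> fst c" "(G \<circ> F) p \<in> fst e"
  have "F p \<in> topspace (mtop N)"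
    using smooth_map_in_topspace[OF assms(4)] chart_subset[OF assms(1) c] p(1) by blast
  then obtain d where d: "d \<in> atlas N" "F p \<in> fst d"
    using chart_at[OF assms(2)] by blast
  have "chart_deriv c d F p (J c (snd c p) v) = K d (snd d (F p)) (chart_deriv c d F p v)" for v
    using assms(6) c d p unfolding intertwines_def by blast
  moreover have "chart_deriv d e G (F p) (K d (snd d (F p)) v) = L e (snd e (G (F p))) (chart_deriv d e G (F p) v)" for v
    using assms(7) d e p unfolding intertwines_def by simp
  ultimately show "chart_deriv c e (G \<circ> F) p (J c (snd c p) v) = L e (snd e ((G \<circ> F) p)) (chart_deriv c e (G \<circ> F) p v)"
    using chart_deriv_compose[OF assms(1-5) c d(1) e p(1) d(2)] p(2) by simp
qed

lemma is_pullback_inverse: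
  assumes "smooth_manifold M" "smooth_map M M F" "smooth_map M M F'"
    and "\<And>x. x \<in> topspace (mtop M) \<Longrightarrow> F (F' x) = x"
    and "is_pullback r M M F \<alpha> \<alpha>"
  shows "is_pullback r M M F' \<alpha> \<alpha>"
  unfolding is_pullback_def
proof (intro ballI impI allI)
  fix c d p and vs :: "'b list"
  assume c: "c \<in> atlas M" and d: "d \<in> atlas M" and p: "p \<in> fst c" "F' p \<in> fst d" and vs: "length vs = r"
  have Fp: "F (F' p) = p"
    using assms(4) c p chart_subset[OF assms(1)] by blast
  then have "\<alpha> d (snd d (F' p)) ws = \<alpha> c (snd c p) (map (chart_deriv d c F (F' p)) ws)" if "length ws = r" for ws
    using assms(5) c d p that unfolding is_pullback_def by metis
  then have "\<alpha> d (snd d (F' p)) (map (chart_deriv c d F' p) vs) =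
      \<alpha> c (snd c p) (map (chart_deriv d c F (F' p) \<circ> chart_deriv c d F' p) vs)"
    using vs by simp
  then show "\<alpha> c (snd c p) vs = \<alpha> d (snd d (F' p)) (map (chart_deriv c d F' p) vs)"
    using chart_deriv_inverse[OF assms(1,3,2,4) c d p] by (simp add: o_def)
qed

lemma intertwines_inverse:
  assumes "smooth_manifold M" "smooth_map M M F" "smooth_map M M F'"
    and "\<And>x. x \<in> topspace (mtop M) \<Longrightarrow> F (F' x) = x" "\<And>x. x \<in> topspace (mtop M) \<Longrightarrow> F' (F x) = x"
    and "intertwines M M F J J"
  shows "intertwines M M F' J J"
  unfolding intertwines_def
proof (intro ballI impI allI)
  fix c d p v
  assume c: "c \<in> atlas M" and d: "d \<in> atlas M" and p: "p \<in> fst c" "F' p \<in> fst d"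
  have Fp: "F (F' p) = p"
    using assms(4) c p chart_subset[OF assms(1)] by blast
  let ?D = "chart_deriv d c F (F' p)" and ?E = "chart_deriv c d F' p"
  have "?D (J d (snd d (F' p)) w) = J c (snd c p) (?D w)" for w
    using assms(6) c d p Fp unfolding intertwines_def by metis
  \<comment> \<open>Intertwining of F at the point \<open>F' p\<close>, applied to the vector
    \<open>?E v\<close>: since \<open>?D\<close> undoes \<open>?E\<close>, it remains to apply
    \<open>?E\<close> to both sides.\<close>
  from this[of "?E v"] have "?D (J d (snd d (F' p)) (?E v)) = J c (snd c p) v"
    using chart_deriv_inverse[OF assms(1,3,2,4) c d p] by simp
  then show "?E (J c (snd c p) v) = J d (snd d (F' p)) (?E v)"
    using chart_deriv_inverse[OF assms(1,2,3,5) d c p(2)] Fp p(1) by metis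
qed

lemma is_pullback_funpow:
  assumes "smooth_manifold M" "smooth_map M M F" "is_pullback r M M F \<alpha> \<alpha>" "is_pullback r M M id \<alpha> \<alpha>"
  shows "is_pullback r M M (F ^^ n) \<alpha> \<alpha>"
proof (induction n)
  case (Suc n)
  show ?case
    unfolding funpow.simps
    by (rule is_pullback_compose[OF assms(1,1,1) smooth_map_funpow[OF assms(1,2)] assms(2) Suc assms(3)])
qed (use assms(4) in \<open>simp add: id_def\<close>)

lemma intertwines_funpow:
  assumes "smooth_manifold M" "smooth_map M M F" "intertwines M M F J J" "intertwines M M id J J"
  shows "intertwines M M (F ^^ n) J J"
proof (induction n)
  case (Suc n)
  show ?case
    unfolding funpow.simps
    by (rule intertwines_compose[OF assms(1,1,1) smooth_map_funpow[OF assms(1,2)] assms(2) Suc assms(3)])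
qed (use assms(4) in \<open>simp add: id_def\<close>)

section \<open>Quotients by properly discontinuous actions\<close>

text \<open>A free, properly discontinuous action, stated through what the quotient needs:
  \<open>separated\<close> yields the Hausdorff property, \<open>locally_injective\<close> yields
  charts, and the group laws enter through R being an equivalence relation.\<close>

locale deck_quotient =
  fixes X :: "('p, 'e::euclidean_space) manifold" and G :: "('p \<Rightarrow> 'p) set" and R :: "('p \<times> 'p) set"
  assumes manifold: "smooth_manifold X"
    and R_eq: "R = {(x, \<phi> x) | x \<phi>. \<phi> \<in> G \<and> x \<in> topspace (mtop X)}"
    and equiv: "equiv (topspace (mtop X)) R"
    and smooth: "\<And>\<phi>. \<phi> \<in> G \<Longrightarrow> smooth_map X X \<phi>"
    and separated: "\<And>x y. x \<in> topspace (mtop X) \<Longrightarrow> y \<in> topspace (mtop X) \<Longrightarrow> (x, y) \<notin> R \<Longrightarrow>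
      \<exists>U V. openin (mtop X) U \<and> openin (mtop X) V \<and> x \<in> U \<and> y \<in> V \<and> R \<inter> (U \<times> V) = {}"
    and locally_injective: "\<And>x. x \<in> topspace (mtop X) \<Longrightarrow>
      \<exists>U. openin (mtop X) U \<and> x \<in> U \<and> inj_on (\<lambda>x. R `` {x}) U"
begin

abbreviation proj :: "'p \<Rightarrow> 'p set"
  where "proj x \<equiv> R `` {x}"

abbreviation Q :: "('p set, 'e) manifold"
  where "Q \<equiv> quotient_manifold X R"

definition represents :: "('p set, 'e) chart \<Rightarrow> ('p, 'e) chart \<Rightarrow> 'p set \<Rightarrow> bool"
  where "represents d c U \<longleftrightarrow> c \<in> atlas X \<and> U \<subseteq> fst c \<and> openin (mtop X) U \<and> inj_on proj U \<and>
    d = (proj ` U, snd c \<circ> inv_into U proj)"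

text \<open>A chart of the quotient may arise from several charts upstairs. The choice is harmless
  for the fields below, whose invariance under G makes the chosen components transform
  correctly.\<close>

definition rep :: "('p set, 'e) chart \<Rightarrow> ('p, 'e) chart"
  where "rep d = (SOME c. \<exists>U. represents d c U)"

lemma atlas_Q: "d \<in> atlas Q \<longleftrightarrow> (\<exists>c U. represents d c U)"
  unfolding quotient_manifold_def represents_def by auto

lemma rep: "d \<in> atlas Q \<Longrightarrow> \<exists>U. represents d (rep d) U"
  unfolding rep_def atlas_Q by (rule someI_ex)

lemma representsD:
  assumes "represents d c U"
  shows "c \<in> atlas X" "U \<subseteq> fst c" "openin (mtop X) U" "inj_on proj U" "fst d = proj ` U"
    and "x \<in> U \<Longrightarrow> snd d (proj x) = snd c x" "snd d ` fst d = snd c ` U" "U \<subseteq> topspace (mtop X)"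
  using assms inv_into_f_f[of proj U] openin_subset unfolding represents_def by (auto simp: image_image)

lemma represents_inverse:
  assumes "represents d c U" "x \<in> U"
  shows "inv_into (fst d) (snd d) (snd c x) = proj x"
proof -
  have "inj_on (snd d) (fst d)"
  proof (rule inj_onI)
    fix a b assume ab: "a \<in> fst d" "b \<in> fst d" "snd d a = snd d b"
    then obtain u v where uv: "u \<in> U" "v \<in> U" "a = proj u" "b = proj v"
      using representsD(5)[OF assms(1)] by auto
    then have "snd c u = snd c v"
      using ab representsD(6)[OF assms(1)] by metis
    then show "a = b"
      using inj_onD[OF inj_on_chart[OF manifold representsD(1)[OF assms(1)]]] uv representsD(2)[OF assms(1)] by blast
  qed
  then have "inv_into (fst d) (snd d) (snd d (proj x)) = proj x"
    using assms representsD(5) by (intro inv_into_f_f) auto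
  then show ?thesis
    using representsD(6)[OF assms] by simp
qed

lemma proj_eq_iff:
  "x \<in> topspace (mtop X) \<Longrightarrow> y \<in> topspace (mtop X) \<Longrightarrow> proj x = proj y \<longleftrightarrow> (x, y) \<in> R"
  using eq_equiv_class_iff[OF equiv] by blast

lemma quotient_map_proj: "quotient_map (mtop X) (mtop Q) proj"
  unfolding quotient_manifold_def manifold.simps by (rule quotient_map_quotient_topology)

lemma topspace_Q: "topspace (mtop Q) = proj ` topspace (mtop X)"
  using quotient_imp_surjective_map[OF quotient_map_proj] by simp

text \<open>The saturation of an open set is the union of its preimages under the members of G, and
  these are continuous.\<close>

lemma open_map_proj: "open_map (mtop X) (mtop Q) proj"
  unfolding open_map_def
proof (intro allI impI)
  fix U assume U: "openin (mtop X) U"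
  then have UX: "U \<subseteq> topspace (mtop X)"
    by (rule openin_subset)
  have "{x \<in> topspace (mtop X). proj x \<in> proj ` U} = (\<Union>\<phi>\<in>G. {x \<in> topspace (mtop X). \<phi> x \<in> U})"
  proof (intro set_eqI iffI)
    fix x assume "x \<in> {x \<in> topspace (mtop X). proj x \<in> proj ` U}"
    then obtain u where x: "x \<in> topspace (mtop X)" and u: "u \<in> U" "proj x = proj u"
      by blast
    then have "(x, u) \<in> R"
      using proj_eq_iff UX by blast
    then show "x \<in> (\<Union>\<phi>\<in>G. {x \<in> topspace (mtop X). \<phi> x \<in> U})"
      unfolding R_eq using u x by blast
  next
    fix x assume "x \<in> (\<Union>\<phi>\<in>G. {x \<in> topspace (mtop X). \<phi> x \<in> U})"
    then obtain \<phi> where \<phi>: "\<phi> \<in> G" "x \<in> topspace (mtop X)" "\<phi> x \<in> U"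
      by blast
    then have "(x, \<phi> x) \<in> R"
      unfolding R_eq by blast
    then have "proj x = proj (\<phi> x)"
      using proj_eq_iff \<phi> UX by blast
    then show "x \<in> {x \<in> topspace (mtop X). proj x \<in> proj ` U}"
      using \<phi> by blast
  qed
  moreover have "openin (mtop X) {x \<in> topspace (mtop X). \<phi> x \<in> U}" if "\<phi> \<in> G" for \<phi>
    using openin_continuous_map_preimage[OF smooth_mapD(1)[OF smooth[OF that]] U] .
  ultimately have "openin (mtop X) {x \<in> topspace (mtop X). proj x \<in> proj ` U}"
    by (auto intro!: openin_Union)
  then show "openin (mtop Q) (proj ` U)"
    using UX unfolding quotient_manifold_def manifold.simps openin_quotient_topology by blast
qed

text \<open>The equivalence of x with a point of U' supplies one deck map \<phi>. It sends all of
  the open set \<open>?V\<close> into U', and as the projection is injective on U',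
  \<open>\<phi> z\<close> is the representative that the second chart reads off; so near x the
  transition map is the local form of this single \<phi>.\<close>

lemma transition:
  assumes d: "represents d c U" and d': "represents d' c' U'" and x: "x \<in> U" "proj x \<in> proj ` U'"
  obtains \<phi> W where "\<phi> \<in> G" "\<phi> x \<in> U'" "proj (\<phi> x) = proj x" "open W" "snd c x \<in> W"
    "\<forall>y\<in>W. y \<in> local_dom c c' \<phi> \<and> local_rep d d' id y = local_rep c c' \<phi> y"
proof -
  have UX: "U \<subseteq> topspace (mtop X)" "U' \<subseteq> topspace (mtop X)"
    using representsD(8) d d' by blast+
  obtain x' where x': "x' \<in> U'" "proj x = proj x'"
    using x by blast
  then have "(x, x') \<in> R"
    using proj_eq_iff UX x by blast
  then obtain \<phi> where \<phi>: "\<phi> \<in> G" "\<phi> x = x'"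
    unfolding R_eq by blast
  let ?V = "U \<inter> {z \<in> topspace (mtop X). \<phi> z \<in> U'}"
  have "openin (mtop X) ?V"
    using openin_continuous_map_preimage[OF smooth_mapD(1)[OF smooth[OF \<phi>(1)]]] representsD(3) d d' by blast
  then have W: "open (snd c ` ?V)"
    using open_chart_image_subset[OF manifold representsD(1)[OF d]] representsD(2)[OF d] by blast
  show thesis
  proof (rule that[OF \<phi>(1) _ _ W])
    show "\<phi> x \<in> U'" "proj (\<phi> x) = proj x"
      using \<phi> x' by auto
    show "snd c x \<in> snd c ` ?V"
      using x x' \<phi> UX by blast
    show "\<forall>y\<in>snd c ` ?V. y \<in> local_dom c c' \<phi> \<and> local_rep d d' id y = local_rep c c' \<phi> y"
    proof
      fix y assume "y \<in> snd c ` ?V"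
      then obtain z where z: "z \<in> U" "\<phi> z \<in> U'" "y = snd c z"
        by blast
      then have "(z, \<phi> z) \<in> R"
        using UX \<phi> unfolding R_eq by blast
      then have "proj z = proj (\<phi> z)"
        using proj_eq_iff z UX by blast
      then have "local_rep d d' id y = snd c' (\<phi> z)"
        using represents_inverse[OF d z(1)] representsD(6)[OF d' z(2)] z by (simp add: local_rep_def)
      moreover have zc: "z \<in> fst c" "\<phi> z \<in> fst c'"
        using z representsD(2) d d' by blast+
      ultimately show "y \<in> local_dom c c' \<phi> \<and> local_rep d d' id y = local_rep c c' \<phi> y"
        using z(3) zc manifold representsD(1)[OF d] by simp
    qed
  qed
qed

lemma chart_at_Q:
  assumes "x \<in> topspace (mtop X)"
  obtains d c U where "represents d c U" "x \<in> U"
proof -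
  obtain U where U: "openin (mtop X) U" "x \<in> U" "inj_on proj U"
    using locally_injective[OF assms] by blast
  obtain c where c: "c \<in> atlas X" "x \<in> fst c"
    using chart_at[OF manifold assms] .
  have "represents (proj ` (U \<inter> fst c), snd c \<circ> inv_into (U \<inter> fst c) proj) c (U \<inter> fst c)"
    unfolding represents_def using U c openin_chart[OF manifold c(1)] by (auto intro: inj_on_subset)
  then show thesis
    using that U c by blast
qed

lemma homeomorphic_map_proj:
  assumes "openin (mtop X) U" "inj_on proj U"
  shows "homeomorphic_map (subtopology (mtop X) U) (subtopology (mtop Q) (proj ` U)) proj"
proof (rule bijective_open_imp_homeomorphic_map)
  have "openin (mtop Q) (proj ` U)"
    using open_map_proj assms(1) unfolding open_map_def by blast
  then show "proj ` topspace (subtopology (mtop X) U) = topspace (subtopology (mtop Q) (proj ` U))"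
    using openin_subset[of "mtop Q" "proj ` U"] openin_subset[OF assms(1)] by (simp add: inf.absorb2)
  show "inj_on proj (topspace (subtopology (mtop X) U))"
    using assms(2) by (rule inj_on_subset) simp
  show "continuous_map (subtopology (mtop X) U) (subtopology (mtop Q) (proj ` U)) proj"
    using quotient_imp_continuous_map[OF quotient_map_proj]
    by (intro continuous_map_into_subtopology continuous_map_from_subtopology) auto
  show "open_map (subtopology (mtop X) U) (subtopology (mtop Q) (proj ` U)) proj"
    using open_map_proj assms(1) by (intro open_map_into_subtopology open_map_from_subtopology) auto
qed

text \<open>Each axiom passes through the projection: the Hausdorff property from
  \<open>separated\<close>, countability from openness, charts because the projection is a
  homeomorphism of U onto its image, and smooth transitions because they are local forms of deck
  maps.\<close>

lemma smooth_manifold_Q: "smooth_manifold Q"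
  unfolding smooth_manifold_def
proof (intro conjI ballI)
  show "Hausdorff_space (mtop Q)"
    unfolding Hausdorff_space_def topspace_Q
  proof (intro allI impI)
    fix a b assume ab: "a \<in> proj ` topspace (mtop X) \<and> b \<in> proj ` topspace (mtop X) \<and> a \<noteq> b"
    then obtain x y where xy: "x \<in> topspace (mtop X)" "y \<in> topspace (mtop X)" "a = proj x" "b = proj y"
      by blast
    then have "(x, y) \<notin> R"
      using ab proj_eq_iff by blast
    then obtain U V where UV: "openin (mtop X) U" "openin (mtop X) V" "x \<in> U" "y \<in> V" "R \<inter> (U \<times> V) = {}"
      using separated[OF xy(1,2)] by blast
    then have "proj u \<noteq> proj v" if "u \<in> U" "v \<in> V" for u v
      using that proj_eq_iff[of u v] openin_subset[OF UV(1)] openin_subset[OF UV(2)] by blast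
    then have "disjnt (proj ` U) (proj ` V)"
      unfolding disjnt_def by blast
    moreover have "openin (mtop Q) (proj ` U)" "openin (mtop Q) (proj ` V)"
      using open_map_proj UV unfolding open_map_def by blast+
    ultimately show "\<exists>U V. openin (mtop Q) U \<and> openin (mtop Q) V \<and> a \<in> U \<and> b \<in> V \<and> disjnt U V"
      using UV xy by blast
  qed
  show "second_countable (mtop Q)"
    using second_countable_open_map_image[OF quotient_imp_continuous_map[OF quotient_map_proj] open_map_proj]
      topspace_Q manifold unfolding smooth_manifold_def by simp
  show "(\<Union>d\<in>atlas Q. fst d) = topspace (mtop Q)"
  proof (intro set_eqI iffI)
    fix a assume "a \<in> (\<Union>d\<in>atlas Q. fst d)"
    then obtain d c U where d: "represents d c U" "a \<in> fst d"
      using atlas_Q by blast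
    then show "a \<in> topspace (mtop Q)"
      using representsD(5,8)[OF d(1)] unfolding topspace_Q by blast
  next
    fix a assume "a \<in> topspace (mtop Q)"
    then obtain x where x: "x \<in> topspace (mtop X)" "a = proj x"
      unfolding topspace_Q by blast
    obtain d c U where d: "represents d c U" "x \<in> U"
      using chart_at_Q[OF x(1)] .
    then show "a \<in> (\<Union>d\<in>atlas Q. fst d)"
      using atlas_Q representsD(5)[OF d(1)] x by blast
  qed
  fix d assume "d \<in> atlas Q"
  then obtain c U where d: "represents d c U"
    unfolding atlas_Q by blast
  note D = representsD[OF d]
  show "openin (mtop Q) (fst d)"
    using open_map_proj D(3,5) unfolding open_map_def by simp
  show "open (snd d ` fst d)"
    using open_chart_image_subset[OF manifold D(1,3,2)] D(7) by simp
  have "homeomorphic_map (subtopology (mtop X) U) (top_of_set (snd c ` U)) (snd c)"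
    using homeomorphic_map_subtopologies[OF homeomorphic_map_chart[OF manifold D(1)], of U "snd c ` U"]
      D(2) chart_subset[OF manifold D(1)] by (simp add: subtopology_subtopology inf.absorb2 image_mono)
  moreover have "homeomorphic_map (subtopology (mtop Q) (fst d)) (subtopology (mtop X) U) (inv_into U proj)"
  proof -
    obtain g where g: "homeomorphic_maps (subtopology (mtop X) U) (subtopology (mtop Q) (proj ` U)) proj g"
      using homeomorphic_map_proj[OF D(3,4)] homeomorphic_map_maps by blast
    then have g': "homeomorphic_map (subtopology (mtop Q) (proj ` U)) (subtopology (mtop X) U) g"
      and gp: "\<And>x. x \<in> U \<Longrightarrow> g (proj x) = x"
      using D(8) unfolding homeomorphic_maps_map by auto
    have "g a = inv_into U proj a" if "a \<in> proj ` U" for a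
      using that gp inv_into_f_f[OF D(4)] by auto
    then show ?thesis
      using homeomorphic_map_eq[OF g'] D(5) by simp
  qed
  ultimately have "homeomorphic_map (subtopology (mtop Q) (fst d)) (top_of_set (snd c ` U)) (snd c \<circ> inv_into U proj)"
    using homeomorphic_map_compose by blast
  then show "homeomorphic_map (subtopology (mtop Q) (fst d)) (top_of_set (snd d ` fst d)) (snd d)"
    using d D(7) unfolding represents_def by simp
  fix d' assume "d' \<in> atlas Q"
  then obtain c' U' where d': "represents d' c' U'"
    unfolding atlas_Q by blast
  show "smooth_on (local_dom d d' id) (local_rep d d' id)"
  proof (rule smooth_on_local)
    fix y assume "y \<in> local_dom d d' id"
    then obtain x where x: "x \<in> U" "proj x \<in> proj ` U'" "y = snd c x"
      using D(5,6) representsD(5)[OF d'] unfolding local_dom_def by auto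
    obtain \<phi> W where W: "\<phi> \<in> G" "\<phi> x \<in> U'" "proj (\<phi> x) = proj x" "open W" "snd c x \<in> W"
      "\<forall>y\<in>W. y \<in> local_dom c c' \<phi> \<and> local_rep d d' id y = local_rep c c' \<phi> y"
      using transition[OF d d' x(1,2)] .
    have "smooth_on W (local_rep c c' \<phi>)"
      using W(6) smooth_on_subset[OF smooth_mapD(2)[OF smooth[OF W(1)] D(1) representsD(1)[OF d']], of W] by blast
    then show "\<exists>T g. open T \<and> y \<in> T \<and> smooth_on T g \<and> (\<forall>y\<in>T. local_rep d d' id y = g y)"
      using W(4-6) x(3) by blast
  qed
qed

text \<open>Changing charts downstairs amounts to differentiating a deck map upstairs; hence the
  transformation law of a descended field is the invariance of the original one.\<close>

lemma chart_deriv_Q: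
  assumes d: "represents d c U" and d': "represents d' c' U'" and p: "p \<in> fst d" "p \<in> fst d'"
  obtains x \<phi> where "\<phi> \<in> G" "x \<in> fst c" "\<phi> x \<in> fst c'" "snd d p = snd c x" "snd d' p = snd c' (\<phi> x)"
    "chart_deriv d d' id p = chart_deriv c c' \<phi> x"
proof -
  have "p \<in> proj ` U"
    using p(1) unfolding representsD(5)[OF d] .
  then obtain x where x: "x \<in> U" "p = proj x"
    by (elim imageE)
  have x': "proj x \<in> proj ` U'"
    using p(2) unfolding representsD(5)[OF d'] x(2) .
  obtain \<phi> W where W: "\<phi> \<in> G" "\<phi> x \<in> U'" "proj (\<phi> x) = proj x" "open W" "snd c x \<in> W"
    "\<forall>y\<in>W. y \<in> local_dom c c' \<phi> \<and> local_rep d d' id y = local_rep c c' \<phi> y"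
    using transition[OF d d' x(1) x'] .
  have p': "snd d p = snd c x" "snd d' p = snd c' (\<phi> x)"
    unfolding x(2) representsD(6)[OF d x(1)] by (rule refl) (simp only: W(3)[symmetric] representsD(6)[OF d' W(2)])
  have deriv: "chart_deriv d d' id p = chart_deriv c c' \<phi> x"
    unfolding p' by (rule frechet_derivative_cong_open[OF W(4,5)]) (use W(6) in blast)
  show thesis
    by (rule that[OF W(1) subsetD[OF representsD(2)[OF d] x(1)] subsetD[OF representsD(2)[OF d'] W(2)] p' deriv])
qed

section \<open>Descent of fields and structures to the quotient\<close>

definition descend :: "(('p, 'e) chart \<Rightarrow> 'a) \<Rightarrow> ('p set, 'e) chart \<Rightarrow> 'a"
  where "descend \<alpha> d = \<alpha> (rep d)"

lemma rep_atlas: "d \<in> atlas Q \<Longrightarrow> rep d \<in> atlas X"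
  using rep representsD(1) by blast

lemma rep_image:
  assumes "d \<in> atlas Q"
  shows "snd d ` fst d \<subseteq> snd (rep d) ` fst (rep d)"
proof -
  obtain U where U: "represents d (rep d) U"
    using rep[OF assms] by (elim exE)
  show ?thesis
    unfolding representsD(7)[OF U] by (rule image_mono[OF representsD(2)[OF U]])
qed

lemma rep_point: "d \<in> atlas Q \<Longrightarrow> y \<in> snd d ` fst d \<Longrightarrow> y \<in> snd (rep d) ` fst (rep d)"
  using rep_image by blast

lemma covariant_tensor_descend:
  assumes "covariant_tensor r X \<alpha>" "\<And>\<phi>. \<phi> \<in> G \<Longrightarrow> is_pullback r X X \<phi> \<alpha> \<alpha>"
  shows "covariant_tensor r Q (descend \<alpha>)"
  unfolding covariant_tensor_def
proof (intro conjI ballI allI impI)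
  fix d and vs :: "'e list" assume d: "d \<in> atlas Q" and vs: "length vs = r"
  note rep = rep_atlas[OF d] rep_image[OF d] rep_point[OF d]
  show "smooth_on (snd d ` fst d) (\<lambda>x. descend \<alpha> d x vs)"
    using assms(1) rep(1) vs smooth_on_subset[OF _ rep(2)] unfolding covariant_tensor_def descend_def by blast
  fix x i assume "x \<in> snd d ` fst d" "i < r"
  then show "linear (\<lambda>v. descend \<alpha> d x (vs[i := v]))"
    using assms(1) rep(1,3) vs unfolding covariant_tensor_def descend_def by blast
next
  show "is_pullback r Q Q id (descend \<alpha>) (descend \<alpha>)"
    unfolding is_pullback_def
  proof (intro ballI impI allI)
    fix d d' p and vs :: "'e list"
    assume d: "d \<in> atlas Q" and d': "d' \<in> atlas Q" and p: "p \<in> fst d" "id p \<in> fst d'" and vs: "length vs = r"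
    obtain U U' where U: "represents d (rep d) U" "represents d' (rep d') U'"
      using rep[OF d] rep[OF d'] by (elim exE)
    obtain x \<phi> where x: "\<phi> \<in> G" "x \<in> fst (rep d)" "\<phi> x \<in> fst (rep d')" "snd d p = snd (rep d) x"
      "snd d' p = snd (rep d') (\<phi> x)" "chart_deriv d d' id p = chart_deriv (rep d) (rep d') \<phi> x"
      using chart_deriv_Q[OF U p(1) p(2)[unfolded id_apply]] .
    have "\<alpha> (rep d) (snd (rep d) x) vs =
        \<alpha> (rep d') (snd (rep d') (\<phi> x)) (map (chart_deriv (rep d) (rep d') \<phi> x) vs)"
      using assms(2)[OF x(1)] rep_atlas[OF d] rep_atlas[OF d'] x(2,3) vs unfolding is_pullback_def by blast
    then show "descend \<alpha> d (snd d p) vs = descend \<alpha> d' (snd d' (id p)) (map (chart_deriv d d' id p) vs)"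
      unfolding descend_def x(6) id_apply using x(4,5) by simp
  qed
qed

lemma endomorphism_field_descend:
  assumes "endomorphism_field X J" "\<And>\<phi>. \<phi> \<in> G \<Longrightarrow> intertwines X X \<phi> J J"
  shows "endomorphism_field Q (descend J)"
  unfolding endomorphism_field_def
proof (intro conjI ballI allI)
  fix d v assume d: "d \<in> atlas Q"
  note rep = rep_atlas[OF d] rep_image[OF d] rep_point[OF d]
  show "smooth_on (snd d ` fst d) (\<lambda>x. descend J d x v)"
    using assms(1) rep(1) smooth_on_subset[OF _ rep(2)] unfolding endomorphism_field_def descend_def by blast
  fix x assume "x \<in> snd d ` fst d"
  then show "linear (descend J d x)"
    using assms(1) rep(1,3) unfolding endomorphism_field_def descend_def by blast
next
  show "intertwines Q Q id (descend J) (descend J)"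
    unfolding intertwines_def
  proof (intro ballI impI allI)
    fix d d' p v
    assume d: "d \<in> atlas Q" and d': "d' \<in> atlas Q" and p: "p \<in> fst d" "id p \<in> fst d'"
    obtain U U' where U: "represents d (rep d) U" "represents d' (rep d') U'"
      using rep[OF d] rep[OF d'] by (elim exE)
    obtain x \<phi> where x: "\<phi> \<in> G" "x \<in> fst (rep d)" "\<phi> x \<in> fst (rep d')" "snd d p = snd (rep d) x"
      "snd d' p = snd (rep d') (\<phi> x)" "chart_deriv d d' id p = chart_deriv (rep d) (rep d') \<phi> x"
      using chart_deriv_Q[OF U p(1) p(2)[unfolded id_apply]] .
    have "chart_deriv (rep d) (rep d') \<phi> x (J (rep d) (snd (rep d) x) v) =
        J (rep d') (snd (rep d') (\<phi> x)) (chart_deriv (rep d) (rep d') \<phi> x v)"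
      using assms(2)[OF x(1)] rep_atlas[OF d] rep_atlas[OF d'] x(2,3) unfolding intertwines_def by blast
    then show "chart_deriv d d' id p (descend J d (snd d p) v) =
        descend J d' (snd d' (id p)) (chart_deriv d d' id p v)"
      unfolding descend_def x(6) id_apply using x(4,5) by simp
  qed
qed

text \<open>The chart d covers only part of the chart \<open>rep d\<close>, so the holomorphic
  coordinates h found upstairs are restricted to \<open>?V\<close>; the work lies in the open image
  and the smooth inverse of the restriction.\<close>

lemma complex_structure_descend:
  assumes "complex_structure X J" "\<And>\<phi>. \<phi> \<in> G \<Longrightarrow> intertwines X X \<phi> J J"
  shows "complex_structure Q (descend J)"
  unfolding complex_structure_def almost_complex_structure_def
proof (intro conjI ballI allI)
  show "endomorphism_field Q (descend J)"
    using assms endomorphism_field_descend unfolding complex_structure_def almost_complex_structure_def by blast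
  fix d x assume d: "d \<in> atlas Q" and x: "x \<in> snd d ` fst d"
  note x' = rep_point[OF d x]
  show "descend J d x (descend J d x v) = - v" for v
    using assms(1) rep_atlas[OF d] x' unfolding complex_structure_def almost_complex_structure_def descend_def by blast
  note holomorphic_chart = bspec[OF bspec[OF conjunct2[OF assms(1)[unfolded complex_structure_def]] rep_atlas[OF d]] x']
  obtain W and h J\<^sub>0 :: "'e \<Rightarrow> 'e" where W: "open W" "x \<in> W" "W \<subseteq> snd (rep d) ` fst (rep d)" "inj_on h W" "open (h ` W)"
      "smooth_on W h" "smooth_on (h ` W) (inv_into W h)" "linear J\<^sub>0" "\<forall>v. J\<^sub>0 (J\<^sub>0 v) = - v"
      "\<forall>y\<in>W. \<forall>v. frechet_derivative h (at y) (J (rep d) y v) = J\<^sub>0 (frechet_derivative h (at y) v)"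
    using holomorphic_chart by (elim exE conjE) (rule that)
  let ?V = "W \<inter> snd d ` fst d"
  have V: "open ?V" "x \<in> ?V" "?V \<subseteq> snd d ` fst d"
    using W x open_chart_image[OF smooth_manifold_Q d] by auto
  have inj: "inj_on h ?V"
    using W(4) by (rule inj_on_subset) simp
  \<comment> \<open>The image is rewritten as a preimage under the continuous map
    \<open>inv_into W h\<close>, from which its openness follows.\<close>
  have hV: "h ` ?V = {z \<in> h ` W. inv_into W h z \<in> snd d ` fst d}"
    using W(4) by (auto simp: inv_into_f_f)
  have "continuous_on (h ` W) (inv_into W h)"
    using W(7) by (rule smooth_on_continuous_on)
  then have openhV: "open (h ` ?V)"
    unfolding hV using continuous_open_preimage[OF _ W(5) open_chart_image[OF smooth_manifold_Q d], of "inv_into W h"]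
    by (simp add: vimage_def Int_def)
  have "smooth_on (h ` ?V) (inv_into W h)"
    using W(7) by (rule smooth_on_subset) auto
  then have "smooth_on (h ` ?V) (inv_into ?V h)"
  proof (rule smooth_on_cong[OF _ openhV])
    fix z assume "z \<in> h ` ?V"
    then obtain y where "y \<in> ?V" "z = h y"
      by blast
    then show "inv_into W h z = inv_into ?V h z"
      using inv_into_f_f[OF inj] inv_into_f_f[OF W(4)] by simp
  qed
  moreover have "\<forall>y\<in>?V. \<forall>v. frechet_derivative h (at y) (descend J d y v) = J\<^sub>0 (frechet_derivative h (at y) v)"
    using W(10) unfolding descend_def by blast
  ultimately show "\<exists>W (h :: 'e \<Rightarrow> 'e) J\<^sub>0. open W \<and> x \<in> W \<and> W \<subseteq> snd d ` fst d \<and> inj_on h W \<and> open (h ` W) \<and>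
      smooth_on W h \<and> smooth_on (h ` W) (inv_into W h) \<and> linear J\<^sub>0 \<and> (\<forall>v. J\<^sub>0 (J\<^sub>0 v) = - v) \<and>
      (\<forall>y\<in>W. \<forall>v. frechet_derivative h (at y) (descend J d y v) = J\<^sub>0 (frechet_derivative h (at y) v))"
    using V inj openhV smooth_on_subset[OF W(6) Int_lower1] W(8,9)
    by - (rule exI[of _ ?V], rule exI[of _ h], rule exI[of _ J\<^sub>0], intro conjI; assumption)
qed

lemma field_eq_descend: "field_eq r X \<alpha> \<beta> \<Longrightarrow> field_eq r Q (descend \<alpha>) (descend \<beta>)"
  unfolding field_eq_def descend_def using rep_atlas rep_point by blast

text \<open>The operators \<open>ext_d\<close>, \<open>d_c\<close> and
  \<open>fundamental_form\<close> work inside one chart, and \<open>descend\<close> merely reads the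
  components in \<open>rep d\<close>; so this identity and the next two hold for arbitrary
  fields.\<close>

lemma ext_d_descend: "ext_d (descend \<alpha>) = descend (ext_d \<alpha>)"
  unfolding ext_d_def descend_def by (intro ext) simp

lemma d_c_descend: "d_c (descend J) (descend \<alpha>) = descend (d_c J \<alpha>)"
  unfolding d_c_def form_act_def ext_d_def descend_def by (intro ext) simp

lemma fundamental_form_descend: "fundamental_form (descend g) (descend J) = descend (fundamental_form g J)"
  unfolding fundamental_form_def descend_def by (intro ext) simp

lemma closed_form_descend: "closed_form r X \<alpha> \<Longrightarrow> closed_form r Q (descend \<alpha>)"
  unfolding closed_form_def ext_d_descend
  by (drule field_eq_descend) (simp add: descend_def[abs_def])

lemma differential_form_descend:
  assumes "differential_form r X \<alpha>" "\<And>\<phi>. \<phi> \<in> G \<Longrightarrow> is_pullback r X X \<phi> \<alpha> \<alpha>"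
  shows "differential_form r Q (descend \<alpha>)"
proof -
  have "covariant_tensor r Q (descend \<alpha>)"
    using assms covariant_tensor_descend unfolding differential_form_def by blast
  moreover have "\<forall>d\<in>atlas Q. \<forall>x\<in>snd d ` fst d. \<forall>vs. length vs = r \<longrightarrow>
      (\<forall>i j. i < j \<and> j < r \<and> vs ! i = vs ! j \<longrightarrow> descend \<alpha> d x vs = 0)"
    unfolding descend_def using assms(1) rep_atlas rep_point unfolding differential_form_def by blast
  ultimately show ?thesis
    unfolding differential_form_def by blast
qed

lemma riemannian_metric_descend:
  assumes "riemannian_metric X g" "\<And>\<phi>. \<phi> \<in> G \<Longrightarrow> is_pullback 2 X X \<phi> g g"
  shows "riemannian_metric Q (descend g)"
proof -
  have "covariant_tensor 2 Q (descend g)"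
    using assms covariant_tensor_descend unfolding riemannian_metric_def by blast
  moreover have "\<forall>d\<in>atlas Q. \<forall>x\<in>snd d ` fst d.
      (\<forall>u v. descend g d x [u, v] = descend g d x [v, u]) \<and> (\<forall>v. v \<noteq> 0 \<longrightarrow> descend g d x [v, v] > 0)"
    unfolding descend_def using assms(1) rep_atlas rep_point unfolding riemannian_metric_def by blast
  ultimately show ?thesis
    unfolding riemannian_metric_def by blast
qed

lemma compatible_descend: "compatible X g J \<Longrightarrow> compatible Q (descend g) (descend J)"
  unfolding compatible_def descend_def using rep_atlas rep_point by blast

lemma generalized_kaehler_descend:
  assumes "even DIM('e)" "riemannian_metric X g"
    "complex_structure X I\<^sub>p" "complex_structure X I\<^sub>m" "compatible X g I\<^sub>p" "compatible X g I\<^sub>m"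
    "differential_form 3 X H" "closed_form 3 X H"
    "field_eq 3 X (d_c I\<^sub>p (fundamental_form g I\<^sub>p)) H"
    "field_eq 3 X (\<lambda>c x vs. - d_c I\<^sub>m (fundamental_form g I\<^sub>m) c x vs) H"
    "\<And>\<phi>. \<phi> \<in> G \<Longrightarrow> is_pullback 2 X X \<phi> g g" "\<And>\<phi>. \<phi> \<in> G \<Longrightarrow> is_pullback 3 X X \<phi> H H"
    "\<And>\<phi>. \<phi> \<in> G \<Longrightarrow> intertwines X X \<phi> I\<^sub>p I\<^sub>p" "\<And>\<phi>. \<phi> \<in> G \<Longrightarrow> intertwines X X \<phi> I\<^sub>m I\<^sub>m"
  shows "generalized_kaehler Q (descend g) (descend I\<^sub>p) (descend I\<^sub>m)"
  unfolding generalized_kaehler_def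
proof (intro conjI exI)
  show "DIM('e) = 2 * (DIM('e) div 2)"
    using assms(1) by simp
  show "field_eq 3 Q (d_c (descend I\<^sub>p) (fundamental_form (descend g) (descend I\<^sub>p))) (descend H)"
    unfolding fundamental_form_descend d_c_descend by (rule field_eq_descend) fact
  show "field_eq 3 Q (\<lambda>c x vs. - d_c (descend I\<^sub>m) (fundamental_form (descend g) (descend I\<^sub>m)) c x vs) (descend H)"
    using field_eq_descend[OF assms(10)] unfolding fundamental_form_descend d_c_descend
    by (simp add: descend_def[abs_def])
qed (intro smooth_manifold_Q riemannian_metric_descend complex_structure_descend compatible_descend
    differential_form_descend closed_form_descend assms; assumption)+

text \<open>Commutation is refuted at every point of every chart upstairs because the quotient sees
  only the charts selected by \<open>rep\<close>; a single point of the nonempty cover then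
  suffices.\<close>

lemma not_split_descend:
  assumes "\<And>c x. c \<in> atlas X \<Longrightarrow> x \<in> snd c ` fst c \<Longrightarrow> \<exists>v. I c x (J c x v) \<noteq> J c x (I c x v)"
    and "topspace (mtop X) \<noteq> {}"
  shows "\<not> split_structure Q (descend I) (descend J)"
proof -
  obtain x where x: "x \<in> topspace (mtop X)"
    using assms(2) by blast
  obtain d c U where d: "represents d c U" "x \<in> U"
    using chart_at_Q[OF x] .
  then have dQ: "d \<in> atlas Q" and xQ: "snd c x \<in> snd d ` fst d"
    using atlas_Q representsD(7)[OF d(1)] by blast+
  show ?thesis
  proof
    assume "split_structure Q (descend I) (descend J)"
    then have "\<forall>v. I (rep d) (snd c x) (J (rep d) (snd c x) v) = J (rep d) (snd c x) (I (rep d) (snd c x) v)"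
      unfolding split_structure_def descend_def using dQ xQ by blast
    then show False
      using assms(1)[OF rep_atlas[OF dQ] rep_point[OF dQ xQ]] by simp
  qed
qed

end

section \<open>Products\<close>

lemma smooth_manifold_euclidean: "smooth_manifold (euclidean_manifold :: ('e::euclidean_space, 'e) manifold)"
proof -
  have "second_countable (euclidean :: 'e topology)"
  proof -
    obtain B :: "'e set set" where "countable B" "topological_basis B"
      using ex_countable_basis by blast
    then show ?thesis
      unfolding second_countable_def open_openin[symmetric]
      by (intro exI[of _ B]) (metis topological_basis_open topological_basisE)
  qed
  moreover have "smooth_on UNIV (\<lambda>x :: 'e. x)"
    by (rule smooth_on_ident) simp
  ultimately show ?thesis
    by (simp add: smooth_manifold_def euclidean_manifold_def homeomorphic_map_id local_dom_def local_rep_def o_def)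
qed

lemma topspace_euclidean_manifold [simp]: "topspace (mtop euclidean_manifold) = UNIV"
  by (simp add: euclidean_manifold_def)

lemma atlas_euclidean_manifold [simp]: "atlas euclidean_manifold = {(UNIV, id)}"
  by (simp add: euclidean_manifold_def)

lemma local_dom_euclidean [simp]: "local_dom (UNIV, id) (UNIV, id) F = UNIV"
  by (simp add: local_dom_def)

lemma local_rep_euclidean [simp]: "local_rep (UNIV, id) (UNIV, id) F = F"
  by (simp add: local_rep_def)

lemma smooth_map_euclidean:
  assumes "smooth_on UNIV F"
  shows "smooth_map euclidean_manifold euclidean_manifold F"
  using assms smooth_on_continuous_on[OF assms] unfolding smooth_map_def by (simp add: euclidean_manifold_def)

definition prod_chart :: "('p, 'e) chart \<Rightarrow> ('q, 'f) chart \<Rightarrow> ('p \<times> 'q, 'e \<times> 'f) chart"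
  where "prod_chart c d = (fst c \<times> fst d, map_prod (snd c) (snd d))"

lemma fst_prod_chart [simp]: "fst (prod_chart c d) = fst c \<times> fst d"
  and snd_prod_chart [simp]: "snd (prod_chart c d) = map_prod (snd c) (snd d)"
  by (simp_all add: prod_chart_def)

lemma atlas_product: "atlas (product_manifold M N) = {prod_chart c d | c d. c \<in> atlas M \<and> d \<in> atlas N}"
  by (simp add: product_manifold_def prod_chart_def)

lemma mtop_product: "mtop (product_manifold M N) = prod_topology (mtop M) (mtop N)"
  by (simp add: product_manifold_def)

lemma topspace_product: "topspace (mtop (product_manifold M N)) = topspace (mtop M) \<times> topspace (mtop N)"
  by (simp add: mtop_product)

lemma image_map_prod_Times: "map_prod f g ` (A \<times> B) = f ` A \<times> g ` B"
  by auto

lemma local_dom_prod: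
  "local_dom (prod_chart c d) (prod_chart c' d') (map_prod F G) = local_dom c c' F \<times> local_dom d d' G"
  unfolding local_dom_def by (auto simp: image_iff)

lemma local_rep_prod:
  assumes "inj_on (snd c) (fst c)" "inj_on (snd d) (fst d)" "z \<in> snd c ` fst c \<times> snd d ` fst d"
  shows "local_rep (prod_chart c d) (prod_chart c' d') (map_prod F G) z = map_prod (local_rep c c' F) (local_rep d d' G) z"
proof -
  obtain p q where pq: "p \<in> fst c" "q \<in> fst d" "z = (snd c p, snd d q)"
    using assms(3) by auto
  have "inj_on (map_prod (snd c) (snd d)) (fst c \<times> fst d)"
    by (rule map_prod_inj_on[OF assms(1,2)])
  then have "inv_into (fst c \<times> fst d) (map_prod (snd c) (snd d)) (map_prod (snd c) (snd d) (p, q)) = (p, q)"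
    using pq by (intro inv_into_f_f) auto
  then show ?thesis
    using pq inv_into_f_f[OF assms(1) pq(1)] inv_into_f_f[OF assms(2) pq(2)] by (simp add: local_rep_def)
qed

lemma local_dom_subset: "local_dom c d F \<subseteq> snd c ` fst c"
  by (auto simp: local_dom_def)

lemma smooth_on_local_rep_prod:
  assumes M: "smooth_manifold M" "smooth_manifold M'" "smooth_map M M' F"
    and N: "smooth_manifold N" "smooth_manifold N'" "smooth_map N N' G"
    and cd: "c \<in> atlas M" "c' \<in> atlas M'" "d \<in> atlas N" "d' \<in> atlas N'"
  shows "smooth_on (local_dom (prod_chart c d) (prod_chart c' d') (map_prod F G))
    (local_rep (prod_chart c d) (prod_chart c' d') (map_prod F G))"
proof -
  have op: "open (local_dom c c' F)" "open (local_dom d d' G)"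
    using open_local_dom[OF M(1,2) smooth_mapD(1)[OF M(3)] cd(1,2)]
      open_local_dom[OF N(1,2) smooth_mapD(1)[OF N(3)] cd(3,4)] by simp_all
  show ?thesis
    unfolding local_dom_prod
  proof (rule smooth_on_cong)
    show "smooth_on (local_dom c c' F \<times> local_dom d d' G) (map_prod (local_rep c c' F) (local_rep d d' G))"
      by (rule smooth_on_map_prod[OF op smooth_mapD(2)[OF M(3) cd(1,2)] smooth_mapD(2)[OF N(3) cd(3,4)]])
    fix z assume "z \<in> local_dom c c' F \<times> local_dom d d' G"
    then have "z \<in> snd c ` fst c \<times> snd d ` fst d"
      using local_dom_subset[of c c' F] local_dom_subset[of d d' G] by blast
    then show "map_prod (local_rep c c' F) (local_rep d d' G) z =
        local_rep (prod_chart c d) (prod_chart c' d') (map_prod F G) z"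
      by (rule local_rep_prod[OF inj_on_chart[OF M(1) cd(1)] inj_on_chart[OF N(1) cd(3)], symmetric])
  qed (use op in \<open>simp add: open_Times\<close>)
qed

lemma smooth_manifold_product:
  assumes "smooth_manifold M" "smooth_manifold N"
  shows "smooth_manifold (product_manifold M N)"
  unfolding smooth_manifold_def
proof (intro conjI ballI)
  show "Hausdorff_space (mtop (product_manifold M N))"
    using assms unfolding smooth_manifold_def mtop_product Hausdorff_space_prod_topology by blast
  show "second_countable (mtop (product_manifold M N))"
  proof -
    obtain A where A: "countable A" "\<forall>V\<in>A. openin (mtop M) V"
        "\<And>U x. openin (mtop M) U \<Longrightarrow> x \<in> U \<Longrightarrow> \<exists>V\<in>A. x \<in> V \<and> V \<subseteq> U"
      using assms(1) unfolding smooth_manifold_def second_countable_def by metis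
    obtain B where B: "countable B" "\<forall>V\<in>B. openin (mtop N) V"
        "\<And>U x. openin (mtop N) U \<Longrightarrow> x \<in> U \<Longrightarrow> \<exists>V\<in>B. x \<in> V \<and> V \<subseteq> U"
      using assms(2) unfolding smooth_manifold_def second_countable_def by metis
    let ?C = "(\<lambda>(a, b). a \<times> b) ` (A \<times> B)"
    have "\<exists>V\<in>?C. x \<in> V \<and> V \<subseteq> U" if U: "openin (prod_topology (mtop M) (mtop N)) U" "x \<in> U" for U x
    proof -
      obtain p q where x: "x = (p, q)"
        by (cases x)
      obtain S T where ST: "openin (mtop M) S" "openin (mtop N) T" "p \<in> S" "q \<in> T" "S \<times> T \<subseteq> U"
        using U(1)[unfolded openin_prod_topology_alt, rule_format, OF U(2)[unfolded x]]
        by (elim exE conjE) (rule that)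
      obtain a where a: "a \<in> A" "p \<in> a" "a \<subseteq> S"
        using A(3)[OF ST(1,3)] by blast
      obtain b where b: "b \<in> B" "q \<in> b" "b \<subseteq> T"
        using B(3)[OF ST(2,4)] by blast
      have "a \<times> b \<in> ?C" "x \<in> a \<times> b" "a \<times> b \<subseteq> U"
        using a b ST x by auto
      then show ?thesis
        by blast
    qed
    moreover have "countable ?C"
      using A(1) B(1) by simp
    moreover have "\<forall>V\<in>?C. openin (prod_topology (mtop M) (mtop N)) V"
      using A(2) B(2) by (auto simp: openin_prod_Times_iff)
    ultimately show ?thesis
      unfolding second_countable_def mtop_product by (intro exI[of _ ?C]) simp
  qed
  show "(\<Union>e\<in>atlas (product_manifold M N). fst e) = topspace (mtop (product_manifold M N))"
  proof (intro set_eqI iffI)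
    fix x assume "x \<in> (\<Union>e\<in>atlas (product_manifold M N). fst e)"
    then obtain e where e: "e \<in> atlas (product_manifold M N)" "x \<in> fst e"
      by blast
    then obtain c d where cd: "c \<in> atlas M" "d \<in> atlas N" "e = prod_chart c d"
      unfolding atlas_product by blast
    then have "x \<in> fst c \<times> fst d"
      using e by simp
    then show "x \<in> topspace (mtop (product_manifold M N))"
      using chart_subset[OF assms(1) cd(1)] chart_subset[OF assms(2) cd(2)] unfolding topspace_product by blast
  next
    fix x assume x: "x \<in> topspace (mtop (product_manifold M N))"
    then have x': "fst x \<in> topspace (mtop M)" "snd x \<in> topspace (mtop N)"
      unfolding topspace_product by (simp_all add: mem_Times_iff)
    obtain c where c: "c \<in> atlas M" "fst x \<in> fst c"
      using chart_at[OF assms(1) x'(1)] .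
    obtain d where d: "d \<in> atlas N" "snd x \<in> fst d"
      using chart_at[OF assms(2) x'(2)] .
    have "prod_chart c d \<in> atlas (product_manifold M N)" "x \<in> fst (prod_chart c d)"
      using c d unfolding atlas_product by (blast, simp add: mem_Times_iff)
    then show "x \<in> (\<Union>e\<in>atlas (product_manifold M N). fst e)"
      by blast
  qed
  fix e assume "e \<in> atlas (product_manifold M N)"
  then obtain c d where e: "e = prod_chart c d" and c: "c \<in> atlas M" and d: "d \<in> atlas N"
    unfolding atlas_product by blast
  note C = chart[OF assms(1) c] and D = chart[OF assms(2) d]
  show "openin (mtop (product_manifold M N)) (fst e)"
    using C(1) D(1) by (simp add: e mtop_product openin_prod_Times_iff)
  show "open (snd e ` fst e)"
    using C(2) D(2) by (simp add: e image_map_prod_Times open_Times)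
  obtain f where f: "homeomorphic_maps (subtopology (mtop M) (fst c)) (top_of_set (snd c ` fst c)) (snd c) f"
    using C(3) homeomorphic_map_maps by blast
  obtain g where g: "homeomorphic_maps (subtopology (mtop N) (fst d)) (top_of_set (snd d ` fst d)) (snd d) g"
    using D(3) homeomorphic_map_maps by blast
  have "homeomorphic_maps (prod_topology (subtopology (mtop M) (fst c)) (subtopology (mtop N) (fst d)))
      (prod_topology (top_of_set (snd c ` fst c)) (top_of_set (snd d ` fst d)))
      (\<lambda>(x, y). (snd c x, snd d y)) (\<lambda>(x, y). (f x, g y))"
    unfolding homeomorphic_maps_prod using f g by blast
  then show "homeomorphic_map (subtopology (mtop (product_manifold M N)) (fst e)) (top_of_set (snd e ` fst e)) (snd e)"
    unfolding e fst_prod_chart snd_prod_chart image_map_prod_Times mtop_product subtopology_Times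
      prod_topology_subtopology_eu homeomorphic_map_maps
    unfolding map_prod_def by - (rule exI, assumption)
  fix e' assume "e' \<in> atlas (product_manifold M N)"
  then obtain c' d' where e': "e' = prod_chart c' d'" "c' \<in> atlas M" "d' \<in> atlas N"
    unfolding atlas_product by blast
  show "smooth_on (local_dom e e' id) (local_rep e e' id)"
    using smooth_on_local_rep_prod[OF assms(1,1) smooth_map_id[OF assms(1)] assms(2,2) smooth_map_id[OF assms(2)]
        c e'(2) d e'(3)]
    unfolding e e' by (simp add: map_prod.id)
qed

lemma smooth_map_product:
  assumes "smooth_manifold M" "smooth_manifold M'" "smooth_map M M' F"
    and "smooth_manifold N" "smooth_manifold N'" "smooth_map N N' G"
  shows "smooth_map (product_manifold M N) (product_manifold M' N') (map_prod F G)"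
  unfolding smooth_map_def
proof (intro conjI ballI)
  show "continuous_map (mtop (product_manifold M N)) (mtop (product_manifold M' N')) (map_prod F G)"
    unfolding mtop_product map_prod_def
    using smooth_mapD(1)[OF assms(3)] smooth_mapD(1)[OF assms(6)] by (simp add: continuous_map_prod_top)
  fix e e' assume "e \<in> atlas (product_manifold M N)" "e' \<in> atlas (product_manifold M' N')"
  then obtain c d c' d' where "e = prod_chart c d" "e' = prod_chart c' d'"
      and "c \<in> atlas M" "c' \<in> atlas M'" "d \<in> atlas N" "d' \<in> atlas N'"
    unfolding atlas_product by blast
  then show "smooth_on (local_dom e e' (map_prod F G)) (local_rep e e' (map_prod F G))"
    using smooth_on_local_rep_prod[OF assms] by simp
qed

lemma chart_deriv_product:
  assumes "smooth_manifold M" "smooth_manifold M'" "smooth_map M M' F"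
    and "smooth_manifold N" "smooth_manifold N'" "smooth_map N N' G"
    and "c \<in> atlas M" "c' \<in> atlas M'" "d \<in> atlas N" "d' \<in> atlas N'"
    and "p \<in> fst c" "F p \<in> fst c'" "q \<in> fst d" "G q \<in> fst d'"
  shows "chart_deriv (prod_chart c d) (prod_chart c' d') (map_prod F G) (p, q) =
    map_prod (chart_deriv c c' F p) (chart_deriv d d' G q)"
proof -
  have 1: "((\<lambda>z. local_rep c c' F (fst z)) has_derivative (\<lambda>v. chart_deriv c c' F p (fst v))) (at (snd c p, snd d q))"
    using has_derivative_compose[OF has_derivative_fst[OF has_derivative_ident], of "local_rep c c' F" _ "(snd c p, snd d q)" UNIV]
      smooth_map_has_derivative[OF assms(3,1,7,8,11,12)] by simp
  have 2: "((\<lambda>z. local_rep d d' G (snd z)) has_derivative (\<lambda>v. chart_deriv d d' G q (snd v))) (at (snd c p, snd d q))"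
    using has_derivative_compose[OF has_derivative_snd[OF has_derivative_ident], of "local_rep d d' G" _ "(snd c p, snd d q)" UNIV]
      smooth_map_has_derivative[OF assms(6,4,9,10,13,14)] by simp
  have "(map_prod (local_rep c c' F) (local_rep d d' G) has_derivative
      map_prod (chart_deriv c c' F p) (chart_deriv d d' G q)) (at (snd c p, snd d q))"
    using has_derivative_Pair[OF 1 2] by (simp add: map_prod_def case_prod_unfold)
  then have "(local_rep (prod_chart c d) (prod_chart c' d') (map_prod F G) has_derivative
      map_prod (chart_deriv c c' F p) (chart_deriv d d' G q)) (at (snd c p, snd d q))"
  proof (rule has_derivative_transform_within_open)
    show "open (snd c ` fst c \<times> snd d ` fst d)"
      using open_chart_image[OF assms(1,7)] open_chart_image[OF assms(4,9)] by (rule open_Times)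
    show "(snd c p, snd d q) \<in> snd c ` fst c \<times> snd d ` fst d"
      using assms(11,13) by blast
    show "map_prod (local_rep c c' F) (local_rep d d' G) z =
        local_rep (prod_chart c d) (prod_chart c' d') (map_prod F G) z" if "z \<in> snd c ` fst c \<times> snd d ` fst d" for z
      by (rule local_rep_prod[OF inj_on_chart[OF assms(1,7)] inj_on_chart[OF assms(4,9)] that, symmetric])
  qed
  from frechet_derivative_at[OF this] show ?thesis
    by simp
qed

section \<open>Lattices and tori\<close>

lemma lattice3_zero: "lattice3 \<Gamma> \<Longrightarrow> 0 \<in> \<Gamma>"
  unfolding lattice3_def by (force intro: exI[of _ "\<lambda>_. 0"])

lemma lattice3_diff:
  assumes "lattice3 \<Gamma>" "x \<in> \<Gamma>" "y \<in> \<Gamma>"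
  shows "x - y \<in> \<Gamma>"
proof -
  obtain B where \<Gamma>: "\<Gamma> = {\<Sum>b\<in>B. of_int (m b) *\<^sub>R b | m :: real^3 \<Rightarrow> int. True}"
    using assms(1) unfolding lattice3_def by blast
  obtain m m' :: "real^3 \<Rightarrow> int" where "x = (\<Sum>b\<in>B. of_int (m b) *\<^sub>R b)" "y = (\<Sum>b\<in>B. of_int (m' b) *\<^sub>R b)"
    using assms(2,3) unfolding \<Gamma> by blast
  then have "x - y = (\<Sum>b\<in>B. of_int (m b - m' b) *\<^sub>R b)"
    by (simp add: sum_subtractf scaleR_left_diff_distrib)
  then show ?thesis
    unfolding \<Gamma> by (intro CollectI exI[of _ "\<lambda>b. m b - m' b"]) simp
qed

lemma lattice3_minus: "lattice3 \<Gamma> \<Longrightarrow> x \<in> \<Gamma> \<Longrightarrow> - x \<in> \<Gamma>"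
  using lattice3_diff[of \<Gamma> 0 x] lattice3_zero by simp

lemma lattice3_add: "lattice3 \<Gamma> \<Longrightarrow> x \<in> \<Gamma> \<Longrightarrow> y \<in> \<Gamma> \<Longrightarrow> x + y \<in> \<Gamma>"
  using lattice3_diff[of \<Gamma> x "- y"] lattice3_minus by simp

text \<open>Coordinates relative to B are bounded linear functionals with integer values on
  \<Gamma>, so on a lattice vector shorter than the reciprocal of a common bound they are integers
  of absolute value below 1.\<close>

lemma lattice3_discrete:
  assumes "lattice3 \<Gamma>"
  obtains \<epsilon> where "\<epsilon> > 0" "\<forall>\<gamma>\<in>\<Gamma>. norm \<gamma> < \<epsilon> \<longrightarrow> \<gamma> = 0"
proof -
  obtain B :: "(real^3) set" where B: "independent B" "span B = UNIV"
      and \<Gamma>: "\<Gamma> = {\<Sum>b\<in>B. of_int (m b) *\<^sub>R b | m :: real^3 \<Rightarrow> int. True}"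
    using assms unfolding lattice3_def by blast
  have finB: "finite B"
    using B(1) independent_imp_finite by blast
  have "\<exists>K>0. \<forall>x. norm (representation B x b) \<le> K * norm x" for b
  proof -
    have "linear (\<lambda>x. representation B x b)"
      using B by (intro linearI) (simp_all add: representation_add representation_scale)
    then show ?thesis
      using linear_bounded_pos by metis
  qed
  then obtain K where K: "\<And>b. K b > 0" "\<And>b x. norm (representation B x b) \<le> K b * norm x"
    by metis
  \<comment> \<open>Dominates every \<open>K b\<close>; the summand 1 makes positivity
    immediate.\<close>
  define L where "L = 1 + (\<Sum>b\<in>B. K b)"
  have KL: "K b \<le> L" if "b \<in> B" for b
    using member_le_sum[OF that _ finB, of K] K(1) unfolding L_def by (simp add: less_imp_le)
  have L: "L > 0"
    unfolding L_def using sum_nonneg[of B K] K(1) by (simp add: less_imp_le add_pos_nonneg)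
  show thesis
  proof (rule that[of "1 / L"])
    show "1 / L > 0"
      using L by simp
    show "\<forall>\<gamma>\<in>\<Gamma>. norm \<gamma> < 1 / L \<longrightarrow> \<gamma> = 0"
    proof (intro ballI impI)
      fix \<gamma> assume \<gamma>: "\<gamma> \<in> \<Gamma>" "norm \<gamma> < 1 / L"
      then obtain m :: "real^3 \<Rightarrow> int" where m: "\<gamma> = (\<Sum>b\<in>B. of_int (m b) *\<^sub>R b)"
        unfolding \<Gamma> by blast
      have "m b = 0" if b: "b \<in> B" for b
      proof -
        have "representation B \<gamma> b = (\<Sum>b'\<in>B. of_int (m b') * representation B b' b)"
          unfolding m using B by (simp add: representation_sum representation_scale span_base)
        also have "\<dots> = (\<Sum>b'\<in>B. if b' = b then of_int (m b') else 0)"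
          using B(1) by (intro sum.cong) (auto simp: representation_basis)
        also have "\<dots> = of_int (m b)"
          using b finB by simp
        finally have "\<bar>of_int (m b) :: real\<bar> \<le> K b * norm \<gamma>"
          using K(2)[of \<gamma> b] by simp
        also have "\<dots> \<le> L * norm \<gamma>"
          using KL[OF b] by (intro mult_right_mono) auto
        also have "\<dots> < 1"
          using \<gamma>(2) L by (simp add: field_simps)
        finally show ?thesis
          by linarith
      qed
      then show "\<gamma> = 0"
        unfolding m by simp
    qed
  qed
qed

text \<open>Distinct lattice points are at least \<epsilon> apart, their difference being again a
  lattice vector.\<close>

lemma lattice3_closed:
  assumes "lattice3 \<Gamma>"
  shows "closed \<Gamma>"
proof -
  obtain \<epsilon> where \<epsilon>: "\<epsilon> > 0" "\<forall>\<gamma>\<in>\<Gamma>. norm \<gamma> < \<epsilon> \<longrightarrow> \<gamma> = 0"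
    using lattice3_discrete[OF assms] .
  have "y = x" if "x \<in> \<Gamma>" "y \<in> \<Gamma>" "dist y x < \<epsilon>" for x y
    using bspec[OF \<epsilon>(2) lattice3_diff[OF assms that(2,1)]] that(3) by (simp add: dist_norm)
  then show ?thesis
    using discrete_imp_closed[OF \<epsilon>(1)] by blast
qed

section \<open>The torus as a quotient by lattice translations\<close>

abbreviation lattice_translations :: "(real^3) set \<Rightarrow> ((real^3) \<Rightarrow> (real^3)) set"
  where "lattice_translations \<Gamma> \<equiv> (\<lambda>\<gamma> x. x + \<gamma>) ` \<Gamma>"

abbreviation lattice_rel :: "(real^3) set \<Rightarrow> ((real^3) \<times> (real^3)) set"
  where "lattice_rel \<Gamma> \<equiv> {(x, x + \<gamma>) | x \<gamma>. \<gamma> \<in> \<Gamma>}"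

lemma lattice_rel_iff: "(x, y) \<in> lattice_rel \<Gamma> \<longleftrightarrow> y - x \<in> \<Gamma>"
  by (auto intro: exI[of _ "y - x"])

lemma equiv_lattice_rel:
  assumes "lattice3 \<Gamma>"
  shows "equiv UNIV (lattice_rel \<Gamma>)"
proof (rule equivI)
  show "refl_on UNIV (lattice_rel \<Gamma>)"
    unfolding refl_on_def lattice_rel_iff using lattice3_zero[OF assms] by simp
  show "sym (lattice_rel \<Gamma>)"
    unfolding sym_def lattice_rel_iff using lattice3_minus[OF assms] by (metis minus_diff_eq)
  show "trans (lattice_rel \<Gamma>)"
    unfolding trans_def lattice_rel_iff using lattice3_add[OF assms] by (metis diff_add_cancel add_diff_eq)
qed simp

lemma deck_quotient_torus:
  assumes \<Gamma>: "lattice3 \<Gamma>"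
  shows "deck_quotient euclidean_manifold (lattice_translations \<Gamma>) (lattice_rel \<Gamma>)"
proof
  show "smooth_manifold (euclidean_manifold :: (real^3, real^3) manifold)"
    by (rule smooth_manifold_euclidean)
  show "lattice_rel \<Gamma> = {(x, \<phi> x) |x \<phi>. \<phi> \<in> lattice_translations \<Gamma> \<and> x \<in> topspace (mtop euclidean_manifold)}"
    proof (intro set_eqI iffI)
    fix z assume "z \<in> lattice_rel \<Gamma>"
    then obtain x \<gamma> where "z = (x, x + \<gamma>)" "\<gamma> \<in> \<Gamma>"
      by blast
    then show "z \<in> {(x, \<phi> x) |x \<phi>. \<phi> \<in> lattice_translations \<Gamma> \<and> x \<in> topspace (mtop euclidean_manifold)}"
      by (intro CollectI exI[of _ x] exI[of _ "\<lambda>x. x + \<gamma>"]) simp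
  qed auto
  show "equiv (topspace (mtop euclidean_manifold)) (lattice_rel \<Gamma>)"
    using equiv_lattice_rel[OF \<Gamma>] by simp
  fix \<phi> :: "real^3 \<Rightarrow> real^3" assume "\<phi> \<in> lattice_translations \<Gamma>"
  then obtain \<gamma> where "\<phi> = (\<lambda>x. x + \<gamma>)"
    by blast
  then show "smooth_map euclidean_manifold euclidean_manifold \<phi>"
    by (simp add: smooth_map_euclidean smooth_on_add smooth_on_ident smooth_on_const)
next
  fix x y :: "real^3" assume "(x, y) \<notin> lattice_rel \<Gamma>"
  then have "y - x \<in> - \<Gamma>"
    by (simp add: lattice_rel_iff)
  \<comment> \<open>Since \<Gamma> is closed, a ball about \<open>y - x\<close> avoids it. Radius
    \<open>\<delta> / 2\<close> at each of x and y keeps \<open>v - u\<close> in that ball.\<close>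
  then obtain \<delta> where \<delta>: "\<delta> > 0" "ball (y - x) \<delta> \<subseteq> - \<Gamma>"
    using lattice3_closed[OF \<Gamma>] open_contains_ball unfolding closed_def by metis
  have "(u, v) \<notin> lattice_rel \<Gamma>" if uv: "u \<in> ball x (\<delta> / 2)" "v \<in> ball y (\<delta> / 2)" for u v
  proof -
    have "dist (y - x) (v - u) \<le> dist y v + dist x u"
      unfolding dist_norm using norm_triangle_ineq4[of "y - v" "x - u"] by (simp add: algebra_simps)
    then have "v - u \<in> ball (y - x) \<delta>"
      using uv by simp
    then show ?thesis
      using \<delta>(2) unfolding lattice_rel_iff by blast
  qed
  then show "\<exists>U V. openin (mtop euclidean_manifold) U \<and> openin (mtop euclidean_manifold) V \<and> x \<in> U \<and> y \<in> V \<and>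
      lattice_rel \<Gamma> \<inter> U \<times> V = {}"
    using \<delta>(1) by (intro exI[of _ "ball x (\<delta> / 2)"] exI[of _ "ball y (\<delta> / 2)"])
      (auto simp: euclidean_manifold_def open_openin[symmetric])
next
  fix x :: "real^3"
  obtain \<epsilon> where \<epsilon>: "\<epsilon> > 0" "\<forall>\<gamma>\<in>\<Gamma>. norm \<gamma> < \<epsilon> \<longrightarrow> \<gamma> = 0"
    using lattice3_discrete[OF \<Gamma>] .
  \<comment> \<open>Two points of a ball of radius \<open>\<epsilon> / 2\<close> are less than
    \<epsilon> apart, so they cannot differ by a nonzero lattice vector.\<close>
  have "inj_on (\<lambda>x. lattice_rel \<Gamma> `` {x}) (ball x (\<epsilon> / 2))"
  proof (rule inj_onI)
    fix u v assume uv: "u \<in> ball x (\<epsilon> / 2)" "v \<in> ball x (\<epsilon> / 2)" "lattice_rel \<Gamma> `` {u} = lattice_rel \<Gamma> `` {v}"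
    then have "v - u \<in> \<Gamma>"
      using eq_equiv_class_iff[OF equiv_lattice_rel[OF \<Gamma>], of u v] lattice_rel_iff by simp
    moreover have "dist v u < \<epsilon>"
      using uv(1,2) dist_triangle_half_r[of x v \<epsilon> u] by simp
    ultimately have "v - u = 0"
      using bspec[OF \<epsilon>(2), of "v - u"] by (simp add: dist_norm)
    then show "u = v"
      by simp
  qed
  then show "\<exists>U. openin (mtop euclidean_manifold) U \<and> x \<in> U \<and> inj_on (\<lambda>x. lattice_rel \<Gamma> `` {x}) U"
    using \<epsilon>(1) by (intro exI[of _ "ball x (\<epsilon> / 2)"]) (auto simp: euclidean_manifold_def open_openin[symmetric])
qed

context
  fixes \<Gamma> :: "(real^3) set"
  assumes \<Gamma>: "lattice3 \<Gamma>"
begin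

interpretation torus: deck_quotient euclidean_manifold "lattice_translations \<Gamma>" "lattice_rel \<Gamma>"
  by (rule deck_quotient_torus[OF \<Gamma>])

lemma smooth_manifold_torus3: "smooth_manifold (torus3 \<Gamma>)"
  using torus.smooth_manifold_Q unfolding torus3_def .

lemma topspace_torus3: "topspace (mtop (torus3 \<Gamma>)) = range (\<lambda>x. lattice_rel \<Gamma> `` {x})"
  using torus.topspace_Q unfolding torus3_def by simp

lemma torus3_class_eq_iff: "lattice_rel \<Gamma> `` {x} = lattice_rel \<Gamma> `` {y} \<longleftrightarrow> y - x \<in> \<Gamma>"
  using torus.proj_eq_iff[of x y] lattice_rel_iff by simp

text \<open>Torus charts are local inverses of the projection, so they differ by translations. This
  is what makes tensors with constant coefficients in the standard coordinates well defined on the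
  torus.\<close>

lemma chart_deriv_torus3_id:
  assumes "c \<in> atlas (torus3 \<Gamma>)" "d \<in> atlas (torus3 \<Gamma>)" "p \<in> fst c" "p \<in> fst d"
  shows "chart_deriv c d id p v = v"
proof -
  obtain c0 U d0 U' where c0: "torus.represents c c0 U" and d0: "torus.represents d d0 U'"
    using assms(1,2) torus.atlas_Q unfolding torus3_def by blast
  then have [simp]: "c0 = (UNIV, id)" "d0 = (UNIV, id)"
    using torus.representsD(1) by fastforce+
  obtain x \<phi> where \<phi>: "\<phi> \<in> lattice_translations \<Gamma>" "chart_deriv c d id p = chart_deriv c0 d0 \<phi> x"
    using torus.chart_deriv_Q[OF c0 d0 assms(3,4)] by metis
  then obtain \<gamma> where "\<phi> = (\<lambda>x. x + \<gamma>)"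
    by blast
  moreover have "((\<lambda>x. x + \<gamma>) has_derivative (\<lambda>v. v)) (at x)"
    by (auto intro!: derivative_eq_intros)
  from frechet_derivative_at[OF this] have "frechet_derivative (\<lambda>x. x + \<gamma>) (at x) = (\<lambda>v. v)"
    by simp
  ultimately show ?thesis
    using \<phi>(2) by simp
qed

text \<open>A torus map with constant derivative \<open>A\<close> is covered by an affine map: the set where it agrees
  with a given affine lift is open and closed.\<close>

lemma torus3_affine_lift:
  assumes \<rho>: "smooth_map (torus3 \<Gamma>) (torus3 \<Gamma>) \<rho>" and A: "linear A"
    and deriv: "\<And>c d p v. c \<in> atlas (torus3 \<Gamma>) \<Longrightarrow> d \<in> atlas (torus3 \<Gamma>) \<Longrightarrow> p \<in> fst c \<Longrightarrow> \<rho> p \<in> fst d \<Longrightarrow>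
      chart_deriv c d \<rho> p v = A v"
  obtains b where "\<forall>x. \<rho> (lattice_rel \<Gamma> `` {x}) = lattice_rel \<Gamma> `` {A x + b}"
proof -
  let ?q = "torus.proj"
  have local_lift: "\<exists>r a. r > 0 \<and> (\<forall>x\<in>ball x\<^sub>0 r. \<rho> (?q x) = ?q (A x + a))" for x\<^sub>0
  proof -
    have "\<rho> (?q x\<^sub>0) \<in> range ?q"
      using smooth_map_in_topspace[OF \<rho>, of "?q x\<^sub>0"] unfolding topspace_torus3 by blast
    then obtain y\<^sub>0 where y\<^sub>0: "\<rho> (?q x\<^sub>0) = ?q y\<^sub>0"
      by blast
    obtain c c0 U where c: "torus.represents c c0 U" "x\<^sub>0 \<in> U"
      by (rule torus.chart_at_Q[of x\<^sub>0]) simp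
    obtain d d0 U' where d: "torus.represents d d0 U'" "y\<^sub>0 \<in> U'"
      by (rule torus.chart_at_Q[of y\<^sub>0]) simp
    note C = torus.representsD[OF c(1)] and D = torus.representsD[OF d(1)]
    have cd: "c \<in> atlas (torus3 \<Gamma>)" "d \<in> atlas (torus3 \<Gamma>)"
      using c d torus.atlas_Q unfolding torus3_def by blast+
    have c0: "c0 = (UNIV, id)" "d0 = (UNIV, id)"
      using C(1) D(1) by simp_all
    have V: "open (local_dom c d \<rho>)"
      by (rule open_local_dom[OF smooth_manifold_torus3 smooth_manifold_torus3 smooth_mapD(1)[OF \<rho>] cd])
    have snd_c: "snd c (?q x) = x" if "x \<in> U" for x
      using C(6)[OF that] c0 by simp
    have fst_c: "?q x \<in> fst c" if "x \<in> U" for x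
      using C(5) that by blast
    have "\<rho> (?q x\<^sub>0) \<in> fst d"
      unfolding y\<^sub>0 D(5) using d(2) by (rule imageI)
    then have "snd c (?q x\<^sub>0) \<in> local_dom c d \<rho>"
      by (rule mem_local_dom[THEN iffD2, OF smooth_manifold_torus3 cd(1) fst_c[OF c(2)]])
    then have "x\<^sub>0 \<in> local_dom c d \<rho>"
      using snd_c[OF c(2)] by simp
    then obtain r where r: "r > 0" "ball x\<^sub>0 r \<subseteq> local_dom c d \<rho>"
      using V open_contains_ball by metis
    let ?F = "local_rep c d \<rho>"
    have in_ball: "x \<in> U \<and> \<rho> (?q x) \<in> fst d \<and> ?F x = snd d (\<rho> (?q x)) \<and> (?F has_derivative A) (at x)"
      if "x \<in> ball x\<^sub>0 r" for x
    proof -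
      have "x \<in> snd c ` {p \<in> fst c. \<rho> p \<in> fst d}"
        using r(2) that unfolding local_dom_def by blast
      then obtain p where p: "p \<in> fst c" "\<rho> p \<in> fst d" "x = snd c p"
        by blast
      then obtain u where u: "u \<in> U" "p = ?q u"
        using C(5) by blast
      then have x: "x = u" "x \<in> U" "p = ?q x"
        using snd_c p(3) by simp_all
      have "chart_deriv c d \<rho> p = A"
        using deriv[OF cd p(1,2)] by (rule ext)
      then have "(?F has_derivative A) (at x)"
        using smooth_map_has_derivative[OF \<rho> smooth_manifold_torus3 cd p(1,2)] p(3) by simp
      moreover have "?F x = snd d (\<rho> p)"
        using local_rep_at[OF smooth_manifold_torus3 cd(1) p(1)] p(3) by simp
      ultimately show ?thesis
        using x(2) p(2) unfolding x(3)[symmetric] by - (intro conjI; assumption)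
    qed
    \<comment> \<open>The local form of \<rho> and A have the same derivative on a convex ball, so
      they differ by a constant a; the lift is affine there.\<close>
    have zero: "((\<lambda>x. ?F x - A x) has_derivative (\<lambda>v. 0)) (at x within ball x\<^sub>0 r)" if "x \<in> ball x\<^sub>0 r" for x
    proof -
      have "(?F has_derivative A) (at x)"
        using in_ball[OF that] by (elim conjE)
      from has_derivative_diff[OF this linear_imp_has_derivative[OF A]]
      have "((\<lambda>x. ?F x - A x) has_derivative (\<lambda>v. 0)) (at x)"
        unfolding diff_self .
      then show ?thesis
        by (rule has_derivative_at_withinI)
    qed
    obtain a where a: "\<forall>x\<in>ball x\<^sub>0 r. ?F x - A x = a"
      using has_derivative_zero_constant[OF convex_ball zero] by blast
    have qa: "\<rho> (?q x) = ?q (A x + a)" if x: "x \<in> ball x\<^sub>0 r" for x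
    proof -
      obtain u where u: "u \<in> U'" "\<rho> (?q x) = ?q u"
        using in_ball[OF x] unfolding D(5) by blast
      have "?F x = snd d (\<rho> (?q x))"
        using in_ball[OF x] by (elim conjE)
      then have "?F x = u"
        unfolding u(2) D(6)[OF u(1)] c0 by simp
      then show ?thesis
        using bspec[OF a x] u(2) by (simp add: diff_eq_eq add.commute)
    qed
    show ?thesis
      by (intro exI[of _ r] exI[of _ a] conjI ballI r(1) qa)
  qed
  have "\<rho> (?q 0) \<in> range ?q"
    using smooth_map_in_topspace[OF \<rho>, of "?q 0"] unfolding topspace_torus3 by blast
  then obtain b where b: "\<rho> (?q 0) = ?q b"
    by blast
  define S where "S = {x. \<rho> (?q x) = ?q (A x + b)}"
  \<comment> \<open>On a ball where \<open>A x + a\<close> lifts \<rho>, membership in S means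
    \<open>b - a \<in> \<Gamma>\<close>, a condition free of x. So a small ball lies entirely in S
    or entirely in its complement.\<close>
  have loc: "\<exists>r>0. ball x\<^sub>0 r \<subseteq> S \<or> ball x\<^sub>0 r \<subseteq> - S" for x\<^sub>0
  proof -
    obtain r a where r: "r > 0" "\<forall>x\<in>ball x\<^sub>0 r. \<rho> (?q x) = ?q (A x + a)"
      using local_lift[of x\<^sub>0] by (elim exE conjE) (rule that)
    have "x \<in> S \<longleftrightarrow> b - a \<in> \<Gamma>" if "x \<in> ball x\<^sub>0 r" for x
      unfolding S_def mem_Collect_eq bspec[OF r(2) that] torus3_class_eq_iff by simp
    then have "ball x\<^sub>0 r \<subseteq> S \<or> ball x\<^sub>0 r \<subseteq> - S"
      by blast
    then show ?thesis
      using r(1) by blast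
  qed
  have "open S"
    unfolding open_contains_ball
  proof
    fix x assume "x \<in> S"
    moreover obtain r where r: "r > 0" "ball x r \<subseteq> S \<or> ball x r \<subseteq> - S"
      using loc by blast
    ultimately show "\<exists>r>0. ball x r \<subseteq> S"
      using centre_in_ball[of x r] by blast
  qed
  moreover have "open (- S)"
    unfolding open_contains_ball
  proof
    fix x assume "x \<in> - S"
    moreover obtain r where r: "r > 0" "ball x r \<subseteq> S \<or> ball x r \<subseteq> - S"
      using loc by blast
    ultimately show "\<exists>r>0. ball x r \<subseteq> - S"
      using centre_in_ball[of x r] by blast
  qed
  ultimately have "S = {} \<or> S = UNIV"
    using clopen[of S] unfolding closed_def by blast
  moreover have "0 \<in> S"
    unfolding S_def mem_Collect_eq b linear_0[OF A] by simp
  ultimately have "S = UNIV"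
    by blast
  then have "\<forall>x. \<rho> (?q x) = ?q (A x + b)"
    unfolding S_def by (simp only: set_eq_iff mem_Collect_eq UNIV_I simp_thms)
  then show thesis
    by (rule that)
qed

text \<open>By the affine lift, \<open>A x\<close> is a lattice vector exactly when \<rho>
  identifies the classes of 0 and x. Injectivity of \<rho> supplies the direction from
  \<open>A x\<close> back to x, which later shows that the inverse matrix preserves the lattice
  too.\<close>

lemma torus3_derivative_preserves_lattice:
  assumes \<rho>: "smooth_map (torus3 \<Gamma>) (torus3 \<Gamma>) \<rho>" and A: "linear A"
    and deriv: "\<And>c d p v. c \<in> atlas (torus3 \<Gamma>) \<Longrightarrow> d \<in> atlas (torus3 \<Gamma>) \<Longrightarrow> p \<in> fst c \<Longrightarrow> \<rho> p \<in> fst d \<Longrightarrow>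
      chart_deriv c d \<rho> p v = A v"
    and inj: "inj_on \<rho> (topspace (mtop (torus3 \<Gamma>)))"
  shows "A x \<in> \<Gamma> \<longleftrightarrow> x \<in> \<Gamma>"
proof -
  obtain b where b: "\<forall>x. \<rho> (torus.proj x) = torus.proj (A x + b)"
    by (rule torus3_affine_lift[OF \<rho> A deriv])
  have "A x \<in> \<Gamma> \<longleftrightarrow> torus.proj (A 0 + b) = torus.proj (A x + b)"
    using torus3_class_eq_iff[of "A 0 + b" "A x + b"] linear_0[OF A] by simp
  also have "\<dots> \<longleftrightarrow> \<rho> (torus.proj 0) = \<rho> (torus.proj x)"
    using b by simp
  also have "\<dots> \<longleftrightarrow> torus.proj 0 = torus.proj x"
    using inj_on_eq_iff[OF inj] unfolding topspace_torus3 by blast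
  finally show ?thesis
    using torus3_class_eq_iff[of 0 x] by simp
qed

end

text \<open>In a basis of the lattice both matrices become integral, so their determinants are
  integers, and the product of these is 1.\<close>

lemma lattice3_automorphism_det:
  fixes A A' :: "real^3^3"
  assumes "lattice3 \<Gamma>" and inv: "A ** A' = mat 1"
    and A: "\<And>x. x \<in> \<Gamma> \<Longrightarrow> A *v x \<in> \<Gamma>" and A': "\<And>x. x \<in> \<Gamma> \<Longrightarrow> A' *v x \<in> \<Gamma>"
  shows "\<bar>det A\<bar> = 1"
proof -
  obtain B :: "(real^3) set" where B: "independent B" "span B = UNIV"
      and \<Gamma>: "\<Gamma> = {\<Sum>b\<in>B. of_int (m b) *\<^sub>R b | m :: real^3 \<Rightarrow> int. True}"
    using assms unfolding lattice3_def by blast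
  have finB: "finite B"
    using B(1) independent_imp_finite by blast
  have "card B = CARD(3)"
    using dim_span_eq_card_independent[OF B(1)] B(2) by (simp add: dim_UNIV)
  \<comment> \<open>An enumeration of the lattice basis by the index type 3, so that its vectors can
    be the columns of a square matrix P.\<close>
  then obtain f :: "3 \<Rightarrow> real^3" where f: "bij_betw f UNIV B"
    using bij_betw_iff_card[of "UNIV :: 3 set" B] finB by auto
  define P :: "real^3^3" where "P = (\<chi> i j. f j $ i)"
  have "columns P = B"
    using f unfolding columns_def column_def P_def bij_betw_def by auto
  then have detP: "det P \<noteq> 0"
    unfolding invertible_det_nz[symmetric] invertible_right_inverse matrix_right_invertible_span_columns
    using B(2) by (simp add: span_vec_eq)
  have int: "det C \<in> \<int>" if C: "\<And>x. x \<in> \<Gamma> \<Longrightarrow> C *v x \<in> \<Gamma>" for C :: "real^3^3"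
  proof -
    have "\<exists>m :: 3 \<Rightarrow> int. C *v f j = (\<Sum>i\<in>UNIV. of_int (m i) *\<^sub>R f i)" for j
    proof -
      have fj: "f j \<in> B"
        using f by (auto simp: bij_betw_def)
      have "(\<Sum>b\<in>B. of_int (if b = f j then 1 else 0) *\<^sub>R b) = (\<Sum>b\<in>B. if b = f j then f j else 0)"
        by (rule sum.cong) auto
      also have "\<dots> = f j"
        using finB fj by simp
      finally have "f j = (\<Sum>b\<in>B. of_int (if b = f j then 1 else 0) *\<^sub>R b)"
        by (rule sym)
      then have "f j \<in> \<Gamma>"
        unfolding \<Gamma> by (intro CollectI exI[of _ "\<lambda>b. if b = f j then 1 else 0"]) simp
      then obtain m :: "real^3 \<Rightarrow> int" where "C *v f j = (\<Sum>b\<in>B. of_int (m b) *\<^sub>R b)"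
        using C unfolding \<Gamma> by blast
      also have "\<dots> = (\<Sum>i\<in>UNIV. of_int (m (f i)) *\<^sub>R f i)"
        by (rule sum.reindex_bij_betw[OF f, symmetric])
      finally show ?thesis
        by (intro exI[of _ "\<lambda>i. m (f i)"])
    qed
    then obtain m :: "3 \<Rightarrow> 3 \<Rightarrow> int" where m: "\<And>j. C *v f j = (\<Sum>i\<in>UNIV. of_int (m j i) *\<^sub>R f i)"
      by metis
    \<comment> \<open>Column j holds the integer coordinates of \<open>C *v f j\<close>, hence the
      exchanged indices.\<close>
    define M :: "real^3^3" where "M = (\<chi> i j. of_int (m j i))"
    have "C ** P = P ** M"
    proof (simp add: vec_eq_iff, intro allI)
      fix i j :: 3
      have "(C ** P) $ i $ j = (C *v f j) $ i"
        by (simp add: matrix_matrix_mult_def matrix_vector_mult_def P_def)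
      also have "\<dots> = (P ** M) $ i $ j"
        unfolding m by (simp add: matrix_matrix_mult_def P_def M_def mult.commute)
      finally show "(C ** P) $ i $ j = (P ** M) $ i $ j" .
    qed
    then have "det C * det P = det P * det M"
      unfolding det_mul[symmetric] by simp
    then have "det C = det M"
      using detP by simp
    also have "det M \<in> \<int>"
      unfolding det_3 M_def by (auto intro!: Ints_add Ints_diff Ints_mult)
    finally show ?thesis .
  qed
  obtain m n :: int where mn: "det A = of_int m" "det A' = of_int n"
    using int[of A] int[of A'] A A' by (metis Ints_cases)
  have "det A * det A' = 1"
    using inv det_mul[of A A'] by simp
  then have "of_int (m * n) = (1 :: real)"
    unfolding mn by simp
  then have "m * n = 1"
    by (simp only: of_int_eq_1_iff)
  then have "\<bar>m\<bar> = 1"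
    using abs_zmult_eq_1[of m n] by simp
  then show ?thesis
    unfolding mn by (metis of_int_abs of_int_1)
qed

section \<open>Mapping tori\<close>

lemma int_iterate_0 [simp]: "int_iterate S f 0 x = x"
  by (simp add: int_iterate_def)

context
  fixes S :: "'a set" and f :: "'a \<Rightarrow> 'a"
  assumes bij: "bij_betw f S S"
begin

lemma int_iterate_in: "x \<in> S \<Longrightarrow> int_iterate S f n x \<in> S"
proof -
  have "(f ^^ m) x \<in> S" if "x \<in> S" for m
    using that bij by (induction m) (auto simp: bij_betw_def)
  moreover have "(inv_into S f ^^ m) x \<in> S" if "x \<in> S" for m
    using that bij_betw_inv_into[OF bij] by (induction m) (auto simp: bij_betw_def)
  ultimately show "x \<in> S \<Longrightarrow> int_iterate S f n x \<in> S"
    unfolding int_iterate_def by simp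
qed

lemma int_iterate_Suc:
  assumes "x \<in> S"
  shows "int_iterate S f (n + 1) x = f (int_iterate S f n x)"
proof (cases "0 \<le> n")
  case True
  then show ?thesis
    by (simp add: int_iterate_def nat_add_distrib)
next
  case False
  then have n: "nat (- n) = Suc (nat (- (n + 1)))"
    by simp
  have "(inv_into S f ^^ m) x \<in> S" for m
    using assms bij_betw_inv_into[OF bij] by (induction m) (auto simp: bij_betw_def)
  then have "f (inv_into S f ((inv_into S f ^^ nat (- (n + 1))) x)) = (inv_into S f ^^ nat (- (n + 1))) x"
    by (rule bij_betw_inv_into_right[OF bij])
  then have "f (int_iterate S f n x) = (inv_into S f ^^ nat (- (n + 1))) x"
    using False unfolding int_iterate_def n by simp
  \<comment> \<open>For n = -1 the definition switches branch at \<open>n + 1 = 0\<close>; both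
    branches are then the identity.\<close>
  moreover have "int_iterate S f (n + 1) x = (inv_into S f ^^ nat (- (n + 1))) x"
    using False by (cases "n + 1 = 0") (simp_all add: int_iterate_def)
  ultimately show ?thesis
    by simp
qed

lemma int_iterate_pred:
  assumes "x \<in> S"
  shows "int_iterate S f (n - 1) x = inv_into S f (int_iterate S f n x)"
  using int_iterate_Suc[OF assms, of "n - 1"] bij_betw_inv_into_left[OF bij int_iterate_in[OF assms, of "n - 1"]]
  by simp

lemma int_iterate_add:
  assumes "x \<in> S"
  shows "int_iterate S f (m + n) x = int_iterate S f m (int_iterate S f n x)"
proof (induction m rule: int_induct[where k=0])
  case base
  then show ?case
    by simp
next
  case (step1 m)
  then show ?case
    using int_iterate_Suc[OF assms, of "m + n"] int_iterate_Suc[OF int_iterate_in[OF assms], of m n]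
    by (simp add: algebra_simps)
next
  case (step2 m)
  then show ?case
    using int_iterate_pred[OF assms, of "m + n"] int_iterate_pred[OF int_iterate_in[OF assms], of m n]
    by (simp add: algebra_simps)
qed

end

section \<open>The deck group of a mapping torus\<close>

abbreviation deck_maps :: "'a set \<Rightarrow> ('a \<Rightarrow> 'a) \<Rightarrow> ('a \<times> real \<Rightarrow> 'a \<times> real) set"
  where "deck_maps S f \<equiv> range (\<lambda>n. map_prod (int_iterate S f n) (\<lambda>t. t + of_int n))"

abbreviation orbit_rel :: "'a set \<Rightarrow> ('a \<Rightarrow> 'a) \<Rightarrow> (('a \<times> real) \<times> ('a \<times> real)) set"
  where "orbit_rel S f \<equiv> {((x, t), (int_iterate S f n x, t + of_int n)) | x t n. x \<in> S}"

lemma orbit_rel_iff: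
  "((x, t), (y, s)) \<in> orbit_rel S f \<longleftrightarrow> x \<in> S \<and> (\<exists>n. y = int_iterate S f n x \<and> s = t + of_int n)"
  by auto

lemma equiv_orbit_rel:
  assumes "bij_betw f S S"
  shows "equiv (S \<times> UNIV) (orbit_rel S f)"
proof (rule equivI)
  note in_S = int_iterate_in[OF assms] and add = int_iterate_add[OF assms]
  show "orbit_rel S f \<subseteq> (S \<times> UNIV) \<times> (S \<times> UNIV)"
    using in_S by auto
  show "refl_on (S \<times> UNIV) (orbit_rel S f)"
  proof (rule refl_onI)
    fix z :: "'a \<times> real" assume "z \<in> S \<times> UNIV"
    then obtain x t where "z = (x, t)" "x \<in> S"
      by blast
    then show "(z, z) \<in> orbit_rel S f"
      using orbit_rel_iff[of x t x t S f] int_iterate_0[of S f x] by (metis add.right_neutral of_int_0)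
  qed
  show "sym (orbit_rel S f)"
  proof (rule symI)
    fix z w assume "(z, w) \<in> orbit_rel S f"
    then obtain x t n where x: "z = (x, t)" "w = (int_iterate S f n x, t + of_int n)" "x \<in> S"
      by blast
    have "x = int_iterate S f (- n) (int_iterate S f n x)"
      using add[OF x(3), of "- n" n] by simp
    then show "(w, z) \<in> orbit_rel S f"
      unfolding x(1,2) orbit_rel_iff using in_S[OF x(3)] by (intro conjI exI[of _ "- n"]) auto
  qed
  show "trans (orbit_rel S f)"
  proof (rule transI)
    fix z w u assume "(z, w) \<in> orbit_rel S f" "(w, u) \<in> orbit_rel S f"
    then obtain x t n m where x: "z = (x, t)" "w = (int_iterate S f n x, t + of_int n)" "x \<in> S"
        "u = (int_iterate S f m (int_iterate S f n x), t + of_int n + of_int m)"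
      by auto
    show "(z, u) \<in> orbit_rel S f"
      unfolding x(1,4) orbit_rel_iff using x(3) add[OF x(3), of m n] by (intro conjI exI[of _ "m + n"]) auto
  qed
qed

lemma smooth_map_int_iterate:
  assumes "smooth_manifold M" "diffeomorphism M f"
  shows "smooth_map M M (int_iterate (topspace (mtop M)) f n)"
  using assms smooth_map_funpow[OF assms(1)] unfolding diffeomorphism_def int_iterate_def by simp

lemma smooth_map_translation: "smooth_map euclidean_manifold euclidean_manifold (\<lambda>t. t + a)"
  by (simp add: smooth_map_euclidean smooth_on_add smooth_on_ident smooth_on_const)

text \<open>Points whose heights do not differ by an integer are separated in the real factor. If
  the heights differ by n, strips of half-width 1/2 leave n as the only possible exponent, so it
  suffices to separate \<open>int_iterate ?S f n x\<close> from y in M and pull the first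
  neighbourhood back. Within one such strip only n = 0 can occur, whence local injectivity.\<close>

lemma deck_quotient_mapping_torus:
  assumes M: "smooth_manifold M" and f: "diffeomorphism M f"
  shows "deck_quotient (product_manifold M euclidean_manifold) (deck_maps (topspace (mtop M)) f)
    (orbit_rel (topspace (mtop M)) f)"
proof
  let ?S = "topspace (mtop M)" and ?X = "product_manifold M (euclidean_manifold :: (real, real) manifold)"
  have bij: "bij_betw f ?S ?S"
    using f unfolding diffeomorphism_def by blast
  have topX: "topspace (mtop ?X) = ?S \<times> UNIV"
    by (simp add: topspace_product)
  have openX: "openin (mtop ?X) (U \<times> V)" if "openin (mtop M) U" "open V" for U V
    using that unfolding mtop_product euclidean_manifold_def
    by (simp add: openin_prod_Times_iff open_openin[symmetric])
  show "smooth_manifold ?X"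
    by (rule smooth_manifold_product[OF M smooth_manifold_euclidean])
  show "orbit_rel ?S f = {(x, \<phi> x) |x \<phi>. \<phi> \<in> deck_maps ?S f \<and> x \<in> topspace (mtop ?X)}"
    unfolding topX
  proof (intro set_eqI iffI)
    fix z assume "z \<in> orbit_rel ?S f"
    then obtain x t n where "z = ((x, t), (int_iterate ?S f n x, t + of_int n))" "x \<in> ?S"
      by blast
    then show "z \<in> {(x, \<phi> x) |x \<phi>. \<phi> \<in> deck_maps ?S f \<and> x \<in> ?S \<times> UNIV}"
      by (intro CollectI exI[of _ "(x, t)"] exI[of _ "map_prod (int_iterate ?S f n) (\<lambda>t. t + of_int n)"]) simp
  qed auto
  show "equiv (topspace (mtop ?X)) (orbit_rel ?S f)"
    unfolding topX by (rule equiv_orbit_rel[OF bij])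
  show "smooth_map ?X ?X \<phi>" if "\<phi> \<in> deck_maps ?S f" for \<phi>
    using that smooth_map_product[OF M M smooth_map_int_iterate[OF M f] smooth_manifold_euclidean
        smooth_manifold_euclidean smooth_map_translation] by blast
  show "\<exists>U V. openin (mtop ?X) U \<and> openin (mtop ?X) V \<and> z \<in> U \<and> w \<in> V \<and> orbit_rel ?S f \<inter> U \<times> V = {}"
    if zw: "z \<in> topspace (mtop ?X)" "w \<in> topspace (mtop ?X)" "(z, w) \<notin> orbit_rel ?S f" for z w
  proof -
    obtain x t y s where xy: "z = (x, t)" "w = (y, s)" "x \<in> ?S" "y \<in> ?S"
      using zw(1,2) unfolding topX by blast
    show ?thesis
    proof (cases "s - t \<in> \<int>")
      case False
      then obtain \<delta> where \<delta>: "\<delta> > 0" "ball (s - t) \<delta> \<subseteq> - \<int>"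
        using closed_Ints open_contains_ball[of "- \<int> :: real set"] unfolding closed_def by blast
      have "orbit_rel ?S f \<inter> (?S \<times> ball t (\<delta> / 2)) \<times> (?S \<times> ball s (\<delta> / 2)) = {}"
      proof (rule ccontr)
        assume "orbit_rel ?S f \<inter> (?S \<times> ball t (\<delta> / 2)) \<times> (?S \<times> ball s (\<delta> / 2)) \<noteq> {}"
        then obtain t' n where t': "t' \<in> ball t (\<delta> / 2)" "t' + of_int n \<in> ball s (\<delta> / 2)"
          by auto
        then have "of_int n \<in> ball (s - t) \<delta>"
          unfolding mem_ball dist_real_def by linarith
        then show False
          using \<delta>(2) by auto
      qed
      then show ?thesis
        using \<delta>(1) xy openX[OF openin_topspace open_ball]
        by (intro exI[of _ "?S \<times> ball t (\<delta> / 2)"] exI[of _ "?S \<times> ball s (\<delta> / 2)"]) simp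
    next
      case True
      then obtain n where n: "s - t = of_int n"
        by (auto elim: Ints_cases)
      let ?g = "int_iterate ?S f n"
      have "?g x \<noteq> y"
        using zw(3) xy(3) n unfolding xy(1,2) orbit_rel_iff by (auto simp: algebra_simps)
      moreover have "?g x \<in> ?S"
        by (rule int_iterate_in[OF bij xy(3)])
      ultimately obtain U V where UV: "openin (mtop M) U" "openin (mtop M) V" "?g x \<in> U" "y \<in> V" "disjnt U V"
        using M xy(4) unfolding smooth_manifold_def Hausdorff_space_def by blast
      let ?U = "{p \<in> ?S. ?g p \<in> U}"
      have U: "openin (mtop M) ?U"
        by (rule openin_continuous_map_preimage[OF smooth_mapD(1)[OF smooth_map_int_iterate[OF M f]] UV(1)])
      have "orbit_rel ?S f \<inter> (?U \<times> ball t (1/2)) \<times> (V \<times> ball s (1/2)) = {}"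
      proof (rule ccontr)
        assume "orbit_rel ?S f \<inter> (?U \<times> ball t (1/2)) \<times> (V \<times> ball s (1/2)) \<noteq> {}"
        then obtain p t' m where p: "?g p \<in> U" "t' \<in> ball t (1/2)" "int_iterate ?S f m p \<in> V" "t' + of_int m \<in> ball s (1/2)"
          by auto
        then have "\<bar>of_int m - of_int n :: real\<bar> < 1"
          using n unfolding mem_ball dist_real_def by linarith
        then have "m = n"
          by linarith
        then show False
          using p UV(5) unfolding disjnt_def by blast
      qed
      then show ?thesis
        using xy UV openX[OF U open_ball] openX[OF UV(2) open_ball]
        by (intro exI[of _ "?U \<times> ball t (1/2)"] exI[of _ "V \<times> ball s (1/2)"]) simp
    qed
  qed
  show "\<exists>U. openin (mtop ?X) U \<and> z \<in> U \<and> inj_on (\<lambda>x. orbit_rel ?S f `` {x}) U" if z: "z \<in> topspace (mtop ?X)" for z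
  proof -
    obtain x t where x: "z = (x, t)" "x \<in> ?S"
      using z unfolding topX by blast
    have "inj_on (\<lambda>x. orbit_rel ?S f `` {x}) (?S \<times> ball t (1/2))"
    proof (rule inj_onI)
      fix a b assume ab: "a \<in> ?S \<times> ball t (1/2)" "b \<in> ?S \<times> ball t (1/2)"
          and eq: "orbit_rel ?S f `` {a} = orbit_rel ?S f `` {b}"
      have "a \<in> ?S \<times> UNIV" "b \<in> ?S \<times> UNIV"
        using ab by auto
      then have "(a, b) \<in> orbit_rel ?S f"
        using eq_equiv_class_iff[OF equiv_orbit_rel[OF bij]] eq by blast
      then obtain p r n where p: "a = (p, r)" "b = (int_iterate ?S f n p, r + of_int n)"
        by blast
      then have "\<bar>of_int n :: real\<bar> < 1"
        using ab unfolding p mem_Times_iff mem_ball dist_real_def fst_conv snd_conv by linarith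
      then have "n = 0"
        by linarith
      then show "a = b"
        using p by simp
    qed
    then show ?thesis
      using openX[OF openin_topspace open_ball] x by (intro exI[of _ "?S \<times> ball t (1/2)"]) simp
  qed
qed

lemma mapping_torus_eq:
  "mapping_torus M f = quotient_manifold (product_manifold M euclidean_manifold) (orbit_rel (topspace (mtop M)) f)"
  unfolding mapping_torus_def ..

lemma funpow_translation: "((\<lambda>t :: real. t + a) ^^ n) = (\<lambda>t. t + of_nat n * a)"
  by (induction n) (auto simp: algebra_simps)

lemma funpow_map_prod:
  fixes f :: "'a \<Rightarrow> 'a" and g :: "'b \<Rightarrow> 'b"
  shows "map_prod f g ^^ n = map_prod (f ^^ n) (g ^^ n)"
  by (induction n) (auto simp: fun_eq_iff)

lemma deck_map_funpow:
  assumes "\<phi> \<in> deck_maps S f"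
  obtains n where "\<phi> = map_prod f (\<lambda>t. t + 1) ^^ n" | n where "\<phi> = map_prod (inv_into S f) (\<lambda>t. t - 1) ^^ n"
proof -
  obtain n where n: "\<phi> = map_prod (int_iterate S f n) (\<lambda>t. t + of_int n)"
    using assms by blast
  show thesis
  proof (cases "0 \<le> n")
    case True
    then have "\<phi> = map_prod f (\<lambda>t. t + 1) ^^ nat n"
      unfolding n funpow_map_prod funpow_translation int_iterate_def by simp
    then show thesis
      by (rule that(1))
  next
    case False
    then have "\<phi> = map_prod (inv_into S f) (\<lambda>t. t + (-1)) ^^ nat (- n)"
      unfolding n funpow_map_prod funpow_translation int_iterate_def by simp
    then show thesis
      using that(2) by simp
  qed
qed

text \<open>The deck group is cyclic, so invariance is checked on one generator: positive exponents
  come from iteration, negative ones through the inverse, and the zeroth power is the transformation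
  law for \<open>id\<close>.\<close>

lemma deck_map_invariance:
  fixes M :: "('p, 'e::euclidean_space) manifold"
  defines "X \<equiv> product_manifold M (euclidean_manifold :: (real, real) manifold)"
  assumes M: "smooth_manifold M" and f: "diffeomorphism M f" and \<phi>: "\<phi> \<in> deck_maps (topspace (mtop M)) f"
  shows deck_map_is_pullback: "is_pullback r X X id \<alpha> \<alpha> \<Longrightarrow>
      is_pullback r X X (map_prod f (\<lambda>t. t + 1)) \<alpha> \<alpha> \<Longrightarrow> is_pullback r X X \<phi> \<alpha> \<alpha>"
    and deck_map_intertwines: "intertwines X X id J J \<Longrightarrow>
      intertwines X X (map_prod f (\<lambda>t. t + 1)) J J \<Longrightarrow> intertwines X X \<phi> J J"
proof -
  let ?S = "topspace (mtop M)"
  let ?F = "map_prod f (\<lambda>t :: real. t + 1)" and ?F' = "map_prod (inv_into ?S f) (\<lambda>t :: real. t - 1)"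
  have X: "smooth_manifold X"
    unfolding X_def by (rule smooth_manifold_product[OF M smooth_manifold_euclidean])
  have f': "bij_betw f ?S ?S" "smooth_map M M f" "smooth_map M M (inv_into ?S f)"
    using f unfolding diffeomorphism_def by blast+
  have F: "smooth_map X X ?F"
    unfolding X_def
    by (rule smooth_map_product[OF M M f'(2) smooth_manifold_euclidean smooth_manifold_euclidean smooth_map_translation])
  have F': "smooth_map X X ?F'"
    unfolding X_def using smooth_map_translation[of "-1"]
    by (intro smooth_map_product[OF M M f'(3) smooth_manifold_euclidean smooth_manifold_euclidean]) simp
  have FF': "?F (?F' z) = z" and F'F: "?F' (?F z) = z" if "z \<in> topspace (mtop X)" for z
  proof -
    obtain x t where "z = (x, t)" "x \<in> ?S"
      using \<open>z \<in> topspace (mtop X)\<close> unfolding X_def topspace_product by blast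
    then show "?F (?F' z) = z" "?F' (?F z) = z"
      using bij_betw_inv_into_right[OF f'(1)] bij_betw_inv_into_left[OF f'(1)] by simp_all
  qed
  show "is_pullback r X X \<phi> \<alpha> \<alpha>" if \<alpha>: "is_pullback r X X id \<alpha> \<alpha>" "is_pullback r X X ?F \<alpha> \<alpha>"
    using \<phi>
  proof (cases rule: deck_map_funpow)
    case (1 n)
    then show ?thesis
      using is_pullback_funpow[OF X F \<alpha>(2,1)] by simp
  next
    case (2 n)
    then show ?thesis
      using is_pullback_funpow[OF X F' is_pullback_inverse[OF X F F' FF' \<alpha>(2)] \<alpha>(1)] by simp
  qed
  show "intertwines X X \<phi> J J" if J: "intertwines X X id J J" "intertwines X X ?F J J"
    using \<phi>
  proof (cases rule: deck_map_funpow)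
    case (1 n)
    then show ?thesis
      using intertwines_funpow[OF X F J(2,1)] by simp
  next
    case (2 n)
    then show ?thesis
      using intertwines_funpow[OF X F' intertwines_inverse[OF X F F' FF' F'F J(2)] J(1)] by simp
  qed
qed

lemma diffeomorphism_product:
  assumes M: "smooth_manifold M" "diffeomorphism M f" and N: "smooth_manifold N" "diffeomorphism N g"
  shows "diffeomorphism (product_manifold M N) (map_prod f g)"
proof -
  let ?S = "topspace (mtop M)" and ?T = "topspace (mtop N)"
  have f: "bij_betw f ?S ?S" "smooth_map M M f" "smooth_map M M (inv_into ?S f)"
    and g: "bij_betw g ?T ?T" "smooth_map N N g" "smooth_map N N (inv_into ?T g)"
    using M(2) N(2) unfolding diffeomorphism_def by blast+
  have MN: "smooth_manifold (product_manifold M N)"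
    by (rule smooth_manifold_product[OF M(1) N(1)])
  have bij: "bij_betw (map_prod f g) (?S \<times> ?T) (?S \<times> ?T)"
    by (rule bij_betw_map_prod[OF f(1) g(1)])
  \<comment> \<open>The two inverses agree on the carrier but not necessarily off it, so smoothness
    is transferred with \<open>smooth_map_cong\<close>.\<close>
  have "map_prod (inv_into ?S f) (inv_into ?T g) z = inv_into (?S \<times> ?T) (map_prod f g) z"
    if z: "z \<in> topspace (mtop (product_manifold M N))" for z
  proof -
    have "z \<in> f ` ?S \<times> g ` ?T"
      using z f(1) g(1) unfolding topspace_product bij_betw_def by simp
    then obtain x y where xy: "z = (f x, g y)" "x \<in> ?S" "y \<in> ?T"
      by blast
    then have "inv_into (?S \<times> ?T) (map_prod f g) (map_prod f g (x, y)) = (x, y)"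
      using bij by (intro inv_into_f_f) (auto simp: bij_betw_def)
    then show ?thesis
      using xy inv_into_f_f f(1) g(1) by (simp add: bij_betw_def)
  qed
  from smooth_map_cong[OF MN MN smooth_map_product[OF M(1) M(1) f(3) N(1) N(1) g(3)] this]
  show ?thesis
    unfolding diffeomorphism_def using bij smooth_map_product[OF M(1) M(1) f(2) N(1) N(1) g(2)]
    by (simp add: topspace_product)
qed

section \<open>The generalized Kaehler structure on the cover\<close>

lemma length_eq_2E:
  assumes "length vs = 2"
  obtains u v where "vs = [u, v]"
  using assms by (metis One_nat_def Suc_1 length_0_conv length_Suc_conv)

lemma length_eq_3E:
  assumes "length vs = 3"
  obtains u v w where "vs = [u, v, w]"
  using assms by (metis numeral_3_eq_3 length_0_conv length_Suc_conv)

lemma smooth_on_covariant_2: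
  assumes "covariant_tensor 2 M \<alpha>" "c \<in> atlas M"
  shows "smooth_on (snd c ` fst c) (\<lambda>x. \<alpha> c x [u, v])"
    and "x \<in> snd c ` fst c \<Longrightarrow> linear (\<lambda>u. \<alpha> c x [u, v])"
    and "x \<in> snd c ` fst c \<Longrightarrow> linear (\<lambda>v. \<alpha> c x [u, v])"
proof -
  have *: "smooth_on (snd c ` fst c) (\<lambda>x. \<alpha> c x [u, v]) \<and>
      (\<forall>x\<in>snd c ` fst c. \<forall>i<2. linear (\<lambda>w. \<alpha> c x ([u, v][i := w])))"
    using assms unfolding covariant_tensor_def by (metis length_Cons list.size(3) One_nat_def Suc_1)
  then show "smooth_on (snd c ` fst c) (\<lambda>x. \<alpha> c x [u, v])"
    by blast
  assume x: "x \<in> snd c ` fst c"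
  have "linear (\<lambda>w. \<alpha> c x ([u, v][i := w]))" if "i < 2" for i
    using * x that by blast
  from this[of 0] this[of 1] show "linear (\<lambda>u. \<alpha> c x [u, v])" "linear (\<lambda>v. \<alpha> c x [u, v])"
    by simp_all
qed

lemma covariant_tensor_2I:
  assumes "\<And>c u v. c \<in> atlas M \<Longrightarrow> smooth_on (snd c ` fst c) (\<lambda>x. \<alpha> c x [u, v])"
    and "\<And>c x v. c \<in> atlas M \<Longrightarrow> x \<in> snd c ` fst c \<Longrightarrow> linear (\<lambda>u. \<alpha> c x [u, v])"
    and "\<And>c x u. c \<in> atlas M \<Longrightarrow> x \<in> snd c ` fst c \<Longrightarrow> linear (\<lambda>v. \<alpha> c x [u, v])"
    and "is_pullback 2 M M id \<alpha> \<alpha>"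
  shows "covariant_tensor 2 M \<alpha>"
  unfolding covariant_tensor_def
proof (intro conjI ballI allI impI)
  fix c and vs :: "'b list" assume c: "c \<in> atlas M" and "length vs = 2"
  then obtain u v where vs: "vs = [u, v]"
    by (elim length_eq_2E)
  show "smooth_on (snd c ` fst c) (\<lambda>x. \<alpha> c x vs)"
    unfolding vs by (rule assms(1)[OF c])
  fix x and i :: nat assume x: "x \<in> snd c ` fst c" and "i < 2"
  then have "i = 0 \<or> i = 1"
    by linarith
  then show "linear (\<lambda>v. \<alpha> c x (vs[i := v]))"
    unfolding vs using assms(2)[OF c x] assms(3)[OF c x] by auto
qed (rule assms(4))

text \<open>Of the torus only \<open>translation_atlas\<close> is retained: tensors with constant
  coefficients in x1, x2, x3 are then global. The real factor carries the height t with y =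
  exp(\<open>lam\<close> t), and \<open>lam\<close> will be ln \<mu>.\<close>

locale twisted_product =
  fixes T :: "('t, real^3) manifold" and N :: "('p, 'e::euclidean_space) manifold"
    and k :: "('p, 'e) cov_field" and lam :: real
  assumes T: "smooth_manifold T" and N: "smooth_manifold N"
    and metric: "riemannian_metric N k" and lam: "lam \<noteq> 0"
    and translation_atlas: "\<And>b b' p v. b \<in> atlas T \<Longrightarrow> b' \<in> atlas T \<Longrightarrow> p \<in> fst b \<Longrightarrow> p \<in> fst b' \<Longrightarrow>
      chart_deriv b b' id p v = v"
begin

abbreviation X :: "(('t \<times> 'p) \<times> real, ((real^3) \<times> 'e) \<times> real) manifold"
  where "X \<equiv> product_manifold (product_manifold T N) euclidean_manifold"

text \<open>A product chart is a mere pair of a set and a map, so its factor on N has to be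
  recovered by choice before k and J can be evaluated.\<close>

definition fibre_chart :: "(('t \<times> 'p) \<times> real, ((real^3) \<times> 'e) \<times> real) chart \<Rightarrow> ('p, 'e) chart"
  where "fibre_chart c = (SOME d. d \<in> atlas N \<and> (\<exists>b\<in>atlas T. c = prod_chart (prod_chart b d) (UNIV, id)))"

abbreviation tor :: "((real^3) \<times> 'e) \<times> real \<Rightarrow> real^3" where "tor u \<equiv> fst (fst u)"
abbreviation fib :: "((real^3) \<times> 'e) \<times> real \<Rightarrow> 'e" where "fib u \<equiv> snd (fst u)"
abbreviation ht :: "((real^3) \<times> 'e) \<times> real \<Rightarrow> real" where "ht u \<equiv> snd u"

text \<open>In the coordinate t the half-plane term dy^2 / y^2 becomes \<open>lam\<^sup>2\<close>
  dt^2, and 1 / y^2 is the product of two equal exponentials.\<close>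

definition g :: "(('t \<times> 'p) \<times> real, ((real^3) \<times> 'e) \<times> real) cov_field" where
  "g c z vs = (let u = vs ! 0; v = vs ! 1 in
     exp (- (lam * ht z)) * exp (- (lam * ht z)) * (tor u $ 1 * tor v $ 1) + lam\<^sup>2 * (ht u * ht v) +
     exp (lam * ht z) * (tor u $ 2 * tor v $ 2 + tor u $ 3 * tor v $ 3) +
     k (fibre_chart c) (fib z) [fib u, fib v])"

text \<open>Sends d/dx1 to d/dy, which is d/dt divided by \<open>lam\<close> exp(\<open>lam\<close>
  t); \<sigma> = 1 or -1 is the orientation of the plane of x2 and x3.\<close>

definition I :: "real \<Rightarrow> ('p, 'e) endo_field \<Rightarrow> (('t \<times> 'p) \<times> real, ((real^3) \<times> 'e) \<times> real) endo_field" where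
  "I \<sigma> J c z u =
     (((- (lam * exp (lam * ht z) * ht u)) *\<^sub>R axis 1 1 + \<sigma> *\<^sub>R vector [0, - (tor u $ 3), tor u $ 2],
       J (fibre_chart c) (fib z) (fib u)),
      tor u $ 1 * exp (- (lam * ht z)) / lam)"

text \<open>The form -dx1 \<and> dx2 \<and> dx3. Its components are constant in every chart, so
  closedness is immediate.\<close>

definition H :: "(('t \<times> 'p) \<times> real, ((real^3) \<times> 'e) \<times> real) cov_field" where
  "H c z vs = (let u = tor (vs ! 0); v = tor (vs ! 1); w = tor (vs ! 2) in
     - (u $ 1 * (v $ 2 * w $ 3 - v $ 3 * w $ 2) - v $ 1 * (u $ 2 * w $ 3 - u $ 3 * w $ 2)
        + w $ 1 * (u $ 2 * v $ 3 - u $ 3 * v $ 2)))"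

lemma I_components [simp]:
  "tor (I \<sigma> J c z u) $ 1 = - (lam * exp (lam * ht z) * ht u)"
  "tor (I \<sigma> J c z u) $ 2 = - (\<sigma> * tor u $ 3)"
  "tor (I \<sigma> J c z u) $ 3 = \<sigma> * tor u $ 2"
  "fib (I \<sigma> J c z u) = J (fibre_chart c) (fib z) (fib u)"
  "ht (I \<sigma> J c z u) = tor u $ 1 * exp (- (lam * ht z)) / lam"
  unfolding I_def by (simp_all add: axis_def)

lemma point_eqI:
  assumes "tor u $ 1 = tor v $ 1" "tor u $ 2 = tor v $ 2" "tor u $ 3 = tor v $ 3" "fib u = fib v" "ht u = ht v"
  shows "u = v"
  using assms by (intro prod_eqI) (simp_all add: vec_eq_iff forall_3)

lemma smooth_manifold_X: "smooth_manifold X"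
  by (intro smooth_manifold_product T N smooth_manifold_euclidean)

lemma atlas_X:
  assumes "c \<in> atlas X"
  obtains b where "b \<in> atlas T" "fibre_chart c \<in> atlas N" "c = prod_chart (prod_chart b (fibre_chart c)) (UNIV, id)"
proof -
  have "\<exists>d. d \<in> atlas N \<and> (\<exists>b\<in>atlas T. c = prod_chart (prod_chart b d) (UNIV, id))"
    using assms unfolding atlas_product atlas_euclidean_manifold by blast
  then have "fibre_chart c \<in> atlas N \<and> (\<exists>b\<in>atlas T. c = prod_chart (prod_chart b (fibre_chart c)) (UNIV, id))"
    unfolding fibre_chart_def by (rule someI_ex)
  then show thesis
    using that by blast
qed

lemma fibre_chart: "c \<in> atlas X \<Longrightarrow> fibre_chart c \<in> atlas N"
  by (elim atlas_X)

lemma fibre_point: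
  assumes "c \<in> atlas X" "z \<in> snd c ` fst c"
  shows "fib z \<in> snd (fibre_chart c) ` fst (fibre_chart c)"
proof -
  obtain b where "b \<in> atlas T" "fibre_chart c \<in> atlas N" and c: "c = prod_chart (prod_chart b (fibre_chart c)) (UNIV, id)"
    using atlas_X[OF assms(1)] .
  have "snd c ` fst c = (snd b ` fst b \<times> snd (fibre_chart c) ` fst (fibre_chart c)) \<times> UNIV"
    by (subst (1 2) c) (simp add: image_map_prod_Times)
  then show ?thesis
    using assms(2) by auto
qed

lemma open_X_chart: "c \<in> atlas X \<Longrightarrow> open (snd c ` fst c)"
  by (rule open_chart_image[OF smooth_manifold_X])

lemma k_covariant: "covariant_tensor 2 N k"
  using metric unfolding riemannian_metric_def by blast

lemma k_sym: "d \<in> atlas N \<Longrightarrow> x \<in> snd d ` fst d \<Longrightarrow> k d x [u, v] = k d x [v, u]"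
  using metric unfolding riemannian_metric_def by blast

lemma k_pos: "d \<in> atlas N \<Longrightarrow> x \<in> snd d ` fst d \<Longrightarrow> v \<noteq> 0 \<Longrightarrow> k d x [v, v] > 0"
  using metric unfolding riemannian_metric_def by blast

lemma smooth_on_fib:
  assumes "c \<in> atlas X" "smooth_on (snd (fibre_chart c) ` fst (fibre_chart c)) h"
  shows "smooth_on (snd c ` fst c) (\<lambda>z. h (fib z))"
proof (rule smooth_on_compose[OF open_X_chart[OF assms(1)] open_chart_image[OF N fibre_chart[OF assms(1)]] _ _ assms(2)])
  show "(\<lambda>z. fib z) ` (snd c ` fst c) \<subseteq> snd (fibre_chart c) ` fst (fibre_chart c)"
    using fibre_point[OF assms(1)] by blast
  show "smooth_on (snd c ` fst c) (\<lambda>z. fib z)"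
    by (intro smooth_on_snd smooth_on_fst smooth_on_ident open_X_chart assms(1))
qed

lemma smooth_on_exp_ht:
  assumes "open S"
  shows "smooth_on S (\<lambda>z :: ((real^3) \<times> 'e) \<times> real. exp (a * ht z))"
proof (rule smooth_on_compose[OF assms open_UNIV _ _ smooth_on_exp[OF open_UNIV]])
  show "smooth_on S (\<lambda>z :: ((real^3) \<times> 'e) \<times> real. a * ht z)"
    by (intro smooth_on_mult smooth_on_const smooth_on_snd smooth_on_ident assms)
qed simp

lemma smooth_on_exp_minus_ht:
  assumes "open S"
  shows "smooth_on S (\<lambda>z :: ((real^3) \<times> 'e) \<times> real. exp (- (a * ht z)))"
  using smooth_on_exp_ht[OF assms, of "- a"] by simp

lemma H_apply:
  "H c z [u, v, w] = - (tor u $ 1 * (tor v $ 2 * tor w $ 3 - tor v $ 3 * tor w $ 2) -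
     tor v $ 1 * (tor u $ 2 * tor w $ 3 - tor u $ 3 * tor w $ 2) +
     tor w $ 1 * (tor u $ 2 * tor v $ 3 - tor u $ 3 * tor v $ 2))"
  by (simp add: H_def Let_def numeral_2_eq_2)

lemma g_apply:
  "g c z [u, v] = exp (- (lam * ht z)) * exp (- (lam * ht z)) * (tor u $ 1 * tor v $ 1) + lam\<^sup>2 * (ht u * ht v) +
     exp (lam * ht z) * (tor u $ 2 * tor v $ 2 + tor u $ 3 * tor v $ 3) +
     k (fibre_chart c) (fib z) [fib u, fib v]"
  by (simp add: g_def Let_def)

lemma H_linear:
  shows "linear (\<lambda>u. H c z [u, v, w])" and "linear (\<lambda>v. H c z [u, v, w])" and "linear (\<lambda>w. H c z [u, v, w])"
proof -
  show "linear (\<lambda>u. H c z [u, v, w])"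
    unfolding H_apply by (rule linearI) (simp_all add: algebra_simps)
  show "linear (\<lambda>v. H c z [u, v, w])"
    unfolding H_apply by (rule linearI) (simp_all add: algebra_simps)
  show "linear (\<lambda>w. H c z [u, v, w])"
    unfolding H_apply by (rule linearI) (simp_all add: algebra_simps)
qed

text \<open>The change-of-chart law is left as a hypothesis here, and likewise for \<open>g\<close>
  and \<open>I\<close>; \<open>identity_transforms\<close> discharges it as a special case of
  invariance under deck transformations.\<close>

lemma differential_form_H:
  assumes "is_pullback 3 X X id H H"
  shows "differential_form 3 X H"
  unfolding differential_form_def covariant_tensor_def
proof (intro conjI ballI allI impI)
  fix c and vs :: "(((real^3) \<times> 'e) \<times> real) list" assume c: "c \<in> atlas X" and "length vs = 3"
  then obtain u v w where vs: "vs = [u, v, w]"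
    by (elim length_eq_3E)
  show "smooth_on (snd c ` fst c) (\<lambda>x. H c x vs)"
    unfolding H_def by (rule smooth_on_const[OF open_X_chart[OF c]])
  fix x and i :: nat assume x: "x \<in> snd c ` fst c" and "i < 3"
  then have "i = 0 \<or> i = 1 \<or> i = 2"
    by linarith
  then show "linear (\<lambda>v. H c x (vs[i := v]))"
    unfolding vs using H_linear by (elim disjE) (simp_all add: numeral_2_eq_2)
next
  fix c x i j and vs :: "(((real^3) \<times> 'e) \<times> real) list"
  assume "length vs = 3" and "i < j \<and> j < 3 \<and> vs ! i = vs ! j"
  moreover from this have "(i = 0 \<and> j = 1) \<or> (i = 0 \<and> j = 2) \<or> (i = 1 \<and> j = 2)"
    by linarith
  ultimately show "H c x vs = 0"
    by (elim length_eq_3E disjE) (simp_all add: H_apply numeral_2_eq_2 algebra_simps)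
qed (rule assms)

lemma closed_form_H: "closed_form 3 X H"
  unfolding closed_form_def field_eq_def ext_d_def H_def by simp

lemma riemannian_metric_g:
  assumes "is_pullback 2 X X id g g"
  shows "riemannian_metric X g"
  unfolding riemannian_metric_def
proof (intro conjI ballI allI impI)
  show "covariant_tensor 2 X g"
  proof (rule covariant_tensor_2I)
    fix c and u v :: "((real^3) \<times> 'e) \<times> real" assume c: "c \<in> atlas X"
    have "smooth_on (snd c ` fst c) (\<lambda>z. exp (- (lam * ht z)) * exp (- (lam * ht z)) * (tor u $ 1 * tor v $ 1) + lam\<^sup>2 * (ht u * ht v) +
        exp (lam * ht z) * (tor u $ 2 * tor v $ 2 + tor u $ 3 * tor v $ 3) + k (fibre_chart c) (fib z) [fib u, fib v])"
      by (intro smooth_on_add smooth_on_mult smooth_on_const smooth_on_exp_ht smooth_on_exp_minus_ht open_X_chart c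
          smooth_on_fib[OF c smooth_on_covariant_2(1)[OF k_covariant fibre_chart[OF c]]])
    then show "smooth_on (snd c ` fst c) (\<lambda>z. g c z [u, v])"
      unfolding g_apply .
    fix z assume z: "z \<in> snd c ` fst c"
    note lin = smooth_on_covariant_2(2,3)[OF k_covariant fibre_chart[OF c] fibre_point[OF c z]]
    show "linear (\<lambda>u. g c z [u, v])"
      using linear_add[OF lin(1)] linear_scale[OF lin(1)]
      by (intro linearI) (simp_all add: g_apply algebra_simps)
    show "linear (\<lambda>v. g c z [u, v])"
      using linear_add[OF lin(2)] linear_scale[OF lin(2)]
      by (intro linearI) (simp_all add: g_apply algebra_simps)
  qed (rule assms)
  fix c z assume c: "c \<in> atlas X" and z: "z \<in> snd c ` fst c"
  note d = fibre_chart[OF c] fibre_point[OF c z]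
  show "g c z [u, v] = g c z [v, u]" for u v
    using k_sym[OF d] by (simp add: g_apply algebra_simps)
  fix v :: "((real^3) \<times> 'e) \<times> real" assume v: "v \<noteq> 0"
  \<comment> \<open>One nonnegative summand for each orthogonal block; a nonzero vector makes at
    least one of them positive.\<close>
  define q where "q = exp (- (lam * ht z)) * exp (- (lam * ht z)) * (tor v $ 1 * tor v $ 1)"
  define r where "r = lam\<^sup>2 * (ht v * ht v)"
  define s where "s = exp (lam * ht z) * (tor v $ 2 * tor v $ 2 + tor v $ 3 * tor v $ 3)"
  define m where "m = k (fibre_chart c) (fib z) [fib v, fib v]"
  have gv: "g c z [v, v] = q + r + s + m"
    unfolding g_apply q_def r_def s_def m_def by simp
  have k0: "k (fibre_chart c) (fib z) [0, 0] = 0"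
    by (rule linear_0[OF smooth_on_covariant_2(2)[OF k_covariant d]])
  have m_pos: "m > 0" if "fib v \<noteq> 0"
    unfolding m_def by (rule k_pos[OF d that])
  have m: "m \<ge> 0"
  proof (cases "fib v = 0")
    case True
    then show ?thesis
      unfolding m_def using k0 by simp
  qed (use m_pos in simp)
  have nonneg: "q \<ge> 0" "r \<ge> 0" "s \<ge> 0"
    unfolding q_def r_def s_def by (simp_all add: mult_nonneg_nonneg add_nonneg_nonneg)
  have "tor v $ 1 \<noteq> 0 \<or> tor v $ 2 \<noteq> 0 \<or> tor v $ 3 \<noteq> 0 \<or> fib v \<noteq> 0 \<or> ht v \<noteq> 0"
  proof (rule ccontr)
    assume "\<not> ?thesis"
    then have "v = 0"
      by (intro point_eqI) simp_all
    then show False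
      using v by simp
  qed
  moreover have "tor v $ 1 \<noteq> 0 \<Longrightarrow> q > 0" "ht v \<noteq> 0 \<Longrightarrow> r > 0"
    unfolding q_def r_def using lam by (auto simp: zero_less_mult_iff linorder_neq_iff)
  moreover have "tor v $ 2 \<noteq> 0 \<Longrightarrow> s > 0" "tor v $ 3 \<noteq> 0 \<Longrightarrow> s > 0"
    unfolding s_def by (simp_all add: sum_squares_gt_zero_iff)
  ultimately show "g c z [v, v] > 0"
    unfolding gv using nonneg m m_pos by linarith
qed

lemma I_square:
  assumes "\<sigma> * \<sigma> = 1" "c \<in> atlas X" "z \<in> snd c ` fst c"
    and "\<And>d x v. d \<in> atlas N \<Longrightarrow> x \<in> snd d ` fst d \<Longrightarrow> J d x (J d x v) = - v"
  shows "I \<sigma> J c z (I \<sigma> J c z v) = - v"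
proof (rule point_eqI)
  show "tor (I \<sigma> J c z (I \<sigma> J c z v)) $ 1 = tor (- v) $ 1"
    using lam by (simp add: exp_minus field_simps)
  show "tor (I \<sigma> J c z (I \<sigma> J c z v)) $ 2 = tor (- v) $ 2" "tor (I \<sigma> J c z (I \<sigma> J c z v)) $ 3 = tor (- v) $ 3"
    using assms(1) by (simp_all add: mult.assoc[symmetric])
  show "ht (I \<sigma> J c z (I \<sigma> J c z v)) = ht (- v)"
    using lam by (simp add: exp_minus field_simps)
  show "fib (I \<sigma> J c z (I \<sigma> J c z v)) = fib (- v)"
    using assms(4)[OF fibre_chart[OF assms(2)] fibre_point[OF assms(2,3)]] by simp
qed

text \<open>The fundamental form dx1 \<and> dy / y^2 + \<sigma> y dx2 \<and> dx3 + k(J., .), with dy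
  = \<open>lam\<close> y dt substituted.\<close>

lemma g_I:
  "g c z [I \<sigma> J c z u, v] =
     lam * exp (- (lam * ht z)) * (tor u $ 1 * ht v - ht u * tor v $ 1) +
     \<sigma> * exp (lam * ht z) * (tor u $ 2 * tor v $ 3 - tor u $ 3 * tor v $ 2) +
     k (fibre_chart c) (fib z) [J (fibre_chart c) (fib z) (fib u), fib v]"
proof -
  have y: "exp (lam * ht z) * exp (- (lam * ht z)) = 1"
    by (simp add: exp_minus)
  have "exp (- (lam * ht z)) * exp (- (lam * ht z)) * (- (lam * exp (lam * ht z) * ht u) * tor v $ 1) =
      - (lam * exp (- (lam * ht z)) * (ht u * tor v $ 1))"
    by (simp add: exp_minus)
  moreover have "lam\<^sup>2 * (tor u $ 1 * exp (- (lam * ht z)) / lam * ht v) = lam * exp (- (lam * ht z)) * (tor u $ 1 * ht v)"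
    using lam by (simp add: power2_eq_square)
  ultimately show ?thesis
    unfolding g_apply I_components using y by (simp add: algebra_simps)
qed

lemma compatible_I:
  assumes "\<sigma> * \<sigma> = 1" "compatible N k J"
  shows "compatible X g (I \<sigma> J)"
  unfolding compatible_def
proof (intro ballI allI)
  fix c z u v assume c: "c \<in> atlas X" and z: "z \<in> snd c ` fst c"
  have y: "exp (lam * ht z) * exp (- (lam * ht z)) = 1"
    by (simp add: exp_minus)
  have kJ: "k (fibre_chart c) (fib z) [J (fibre_chart c) (fib z) (fib u), J (fibre_chart c) (fib z) (fib v)] =
      k (fibre_chart c) (fib z) [fib u, fib v]"
    using assms(2) fibre_chart[OF c] fibre_point[OF c z] unfolding compatible_def by blast
  have "lam * exp (- (lam * ht z)) * (tor u $ 1 * (tor v $ 1 * exp (- (lam * ht z)) / lam) + ht u * (lam * exp (lam * ht z) * ht v))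
      = exp (- (lam * ht z)) * exp (- (lam * ht z)) * (tor u $ 1 * tor v $ 1) + lam\<^sup>2 * (ht u * ht v)"
    using lam by (simp add: exp_minus field_simps power2_eq_square)
  moreover have "\<sigma> * exp (lam * ht z) * (tor u $ 2 * (\<sigma> * tor v $ 2) + tor u $ 3 * (\<sigma> * tor v $ 3)) =
      (\<sigma> * \<sigma>) * (exp (lam * ht z) * (tor u $ 2 * tor v $ 2 + tor u $ 3 * tor v $ 3))"
    by (simp add: algebra_simps)
  ultimately show "g c z [I \<sigma> J c z u, I \<sigma> J c z v] = g c z [u, v]"
    unfolding g_I I_components kJ assms(1) by (simp add: g_apply)
qed

lemma endomorphism_field_I:
  assumes "endomorphism_field N J" "intertwines X X id (I \<sigma> J) (I \<sigma> J)"
  shows "endomorphism_field X (I \<sigma> J)"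
  unfolding endomorphism_field_def
proof (intro conjI ballI allI)
  fix c assume c: "c \<in> atlas X"
  note J = assms(1)[unfolded endomorphism_field_def] and d = fibre_chart[OF c]
  show "smooth_on (snd c ` fst c) (\<lambda>z. I \<sigma> J c z v)" for v
  proof -
    have "smooth_on (snd c ` fst c) (\<lambda>z. (- (lam * ht v)) * exp (lam * ht z))"
      "smooth_on (snd c ` fst c) (\<lambda>z. (tor v $ 1 / lam) * exp (- (lam * ht z)))"
      by (intro smooth_on_mult smooth_on_const smooth_on_exp_ht smooth_on_exp_minus_ht open_X_chart c)+
    moreover have "smooth_on (snd c ` fst c) (\<lambda>z. J (fibre_chart c) (fib z) (fib v))"
      using J d by (intro smooth_on_fib[OF c]) blast
    ultimately have "smooth_on (snd c ` fst c) (\<lambda>z.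
        ((((- (lam * ht v)) * exp (lam * ht z)) *\<^sub>R axis 1 1 + \<sigma> *\<^sub>R vector [0, - (tor v $ 3), tor v $ 2],
          J (fibre_chart c) (fib z) (fib v)), (tor v $ 1 / lam) * exp (- (lam * ht z))))"
      by (intro smooth_on_Pair smooth_on_add smooth_on_scaleR smooth_on_const open_X_chart c)
    then show ?thesis
      unfolding I_def by (simp add: mult_ac)
  qed
  fix z assume z: "z \<in> snd c ` fst c"
  have "linear (J (fibre_chart c) (fib z))"
    using J d fibre_point[OF c z] by blast
  then show "linear (I \<sigma> J c z)"
    using linear_add linear_scale by (intro linearI; intro point_eqI) (simp_all add: algebra_simps add_divide_distrib)
qed (rule assms(2))

text \<open>Replacing t by y = exp(\<open>lam\<close> t) makes the structure constant on the
  half-plane; on the plane of x2 and x3 it is constant already, and N contributes its own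
  holomorphic coordinates h.\<close>

lemma complex_structure_I:
  assumes \<sigma>: "\<sigma> * \<sigma> = 1" and J: "complex_structure N J" and inv: "intertwines X X id (I \<sigma> J) (I \<sigma> J)"
  shows "complex_structure X (I \<sigma> J)"
proof -
  have J2: "J d x (J d x v) = - v" if "d \<in> atlas N" "x \<in> snd d ` fst d" for d x v
    using J that unfolding complex_structure_def almost_complex_structure_def by blast
  have I2: "I \<sigma> J c z (I \<sigma> J c z v) = - v" if "c \<in> atlas X" "z \<in> snd c ` fst c" for c z v
    by (rule I_square[OF \<sigma> that]) (rule J2)
  have "almost_complex_structure X (I \<sigma> J)"
    unfolding almost_complex_structure_def
    using endomorphism_field_I[OF _ inv] J I2
    unfolding complex_structure_def almost_complex_structure_def by blast
  moreover have "\<exists>W (h :: ((real^3) \<times> 'e) \<times> real \<Rightarrow> ((real^3) \<times> 'e) \<times> real) J\<^sub>0.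
      open W \<and> z \<in> W \<and> W \<subseteq> snd c ` fst c \<and>
      inj_on h W \<and> open (h ` W) \<and> smooth_on W h \<and> smooth_on (h ` W) (inv_into W h) \<and>
      linear J\<^sub>0 \<and> (\<forall>v. J\<^sub>0 (J\<^sub>0 v) = - v) \<and>
      (\<forall>y\<in>W. \<forall>v. frechet_derivative h (at y) (I \<sigma> J c y v) = J\<^sub>0 (frechet_derivative h (at y) v))"
    if c: "c \<in> atlas X" and z: "z \<in> snd c ` fst c" for c z
  proof -
    obtain b where b: "b \<in> atlas T" "fibre_chart c \<in> atlas N" and c': "c = prod_chart (prod_chart b (fibre_chart c)) (UNIV, id)"
      using atlas_X[OF c] .
    let ?B = "snd b ` fst b" and ?d = "fibre_chart c"
    have im: "snd c ` fst c = (?B \<times> snd ?d ` fst ?d) \<times> UNIV"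
      by (subst (1 2) c') (simp add: image_map_prod_Times)
    note holomorphic_chart = bspec[OF bspec[OF conjunct2[OF J[unfolded complex_structure_def]] b(2)] fibre_point[OF c z]]
    obtain W and h J\<^sub>0 :: "'e \<Rightarrow> 'e" where W: "open W" "fib z \<in> W" "W \<subseteq> snd ?d ` fst ?d" "inj_on h W" "open (h ` W)"
        "smooth_on W h" "smooth_on (h ` W) (inv_into W h)" "linear J\<^sub>0" "\<forall>v. J\<^sub>0 (J\<^sub>0 v) = - v"
        "\<forall>y\<in>W. \<forall>v. frechet_derivative h (at y) (J ?d y v) = J\<^sub>0 (frechet_derivative h (at y) v)"
      using holomorphic_chart by (elim exE conjE) (rule that)
    define V where "V = (?B \<times> W) \<times> (UNIV :: real set)"
    define hX where "hX = map_prod (map_prod (\<lambda>x :: real^3. x) h) (\<lambda>t. exp (lam * t))"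
    \<comment> \<open>An explicit inverse of \<open>hX\<close>, because smoothness cannot be read
      off \<open>inv_into\<close> directly. Its logarithm is defined on the positive half-line, the
      range of y.\<close>
    define kX where "kX = map_prod (map_prod (\<lambda>x :: real^3. x) (inv_into W h)) (\<lambda>y. ln y / lam)"
    \<comment> \<open>In the coordinates \<open>hX\<close> the last component is y, so the
      exponential factors of \<open>I\<close> have disappeared.\<close>
    define JX where "JX = (\<lambda>u :: ((real^3) \<times> 'e) \<times> real.
      (((- ht u) *\<^sub>R (axis 1 1 :: real^3) + \<sigma> *\<^sub>R vector [0, - (tor u $ 3), tor u $ 2], J\<^sub>0 (fib u)), tor u $ 1))"
    have JX [simp]: "tor (JX u) $ 1 = - ht u" "tor (JX u) $ 2 = - (\<sigma> * tor u $ 3)" "tor (JX u) $ 3 = \<sigma> * tor u $ 2"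
      "fib (JX u) = J\<^sub>0 (fib u)" "ht (JX u) = tor u $ 1" for u
      unfolding JX_def by (simp_all add: axis_def)
    have B: "open ?B"
      by (rule open_chart_image[OF T b(1)])
    have exp_range: "range (\<lambda>t :: real. exp (lam * t)) = {0<..}"
    proof (intro set_eqI iffI)
      fix y :: real assume "y \<in> {0<..}"
      then have "y = exp (lam * (ln y / lam))"
        using lam by simp
      then show "y \<in> range (\<lambda>t. exp (lam * t))"
        by (rule range_eqI)
    qed auto
    have V: "open V" "z \<in> V" "V \<subseteq> snd c ` fst c"
      unfolding V_def im using B W(1-3) z im by (auto intro!: open_Times)
    have hV: "hX ` V = (?B \<times> h ` W) \<times> {0<..}"
      unfolding V_def hX_def image_map_prod_Times exp_range by simp
    have inj: "inj_on hX V"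
      unfolding V_def hX_def using lam by (intro map_prod_inj_on W(4)) (auto intro: inj_onI)
    have openhV: "open (hX ` V)"
      unfolding hV by (intro open_Times B W(5) open_greaterThan)
    have smooth_h: "smooth_on V hX"
      unfolding V_def hX_def
    proof (intro smooth_on_map_prod open_Times B W(1,6) smooth_on_ident open_UNIV)
      show "smooth_on UNIV (\<lambda>t. exp (lam * t))"
        by (rule smooth_on_compose[OF open_UNIV open_UNIV subset_UNIV
              smooth_on_bounded_linear[OF bounded_linear_mult_right open_UNIV] smooth_on_exp[OF open_UNIV]])
    qed
    have "smooth_on (hX ` V) kX"
      unfolding hV kX_def
    proof (intro smooth_on_map_prod open_Times B W(5,7) smooth_on_ident open_greaterThan)
      have "smooth_on {0<..} (\<lambda>y :: real. (1 / lam) * ln y)"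
        by (intro smooth_on_mult smooth_on_const smooth_on_ln open_greaterThan)
      then show "smooth_on {0<..} (\<lambda>y. ln y / lam)"
        by simp
    qed
    then have "smooth_on (hX ` V) (inv_into V hX)"
    proof (rule smooth_on_cong[OF _ openhV])
      fix y assume "y \<in> hX ` V"
      then obtain v where v: "v \<in> V" "y = hX v"
        by blast
      then have "kX y = v"
        unfolding kX_def hX_def V_def using inv_into_f_f[OF W(4)] lam by auto
      then show "kX y = inv_into V hX y"
        using inv_into_f_f[OF inj v(1)] v(2) by simp
    qed
    moreover have "linear JX"
      using linear_add[OF W(8)] linear_scale[OF W(8)] by (intro linearI; intro point_eqI) (simp_all add: algebra_simps)
    moreover have "\<forall>v. JX (JX v) = - v"
      using W(9) \<sigma> by (intro allI point_eqI) (simp_all add: mult.assoc[symmetric])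
    moreover have "\<forall>y\<in>V. \<forall>v. frechet_derivative hX (at y) (I \<sigma> J c y v) = JX (frechet_derivative hX (at y) v)"
    proof (intro ballI allI)
      fix y v assume y: "y \<in> V"
      then have yW: "fib y \<in> W"
        unfolding V_def by auto
      let ?D = "frechet_derivative h (at (fib y))"
      have h: "((\<lambda>z. h (fib z)) has_derivative (\<lambda>v. ?D (fib v))) (at y)"
        using has_derivative_compose[OF has_derivative_snd[OF has_derivative_fst[OF has_derivative_ident]],
            of h ?D y UNIV] smooth_on_has_derivative[OF W(6) yW] by simp
      have "((\<lambda>z. ((tor z, h (fib z)), exp (lam * ht z))) has_derivative
          (\<lambda>v. ((tor v, ?D (fib v)), exp (lam * ht y) * (lam * ht v)))) (at y)"
        by (intro has_derivative_Pair h) (auto intro!: derivative_eq_intros)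
      moreover have hX: "hX = (\<lambda>z. ((tor z, h (fib z)), exp (lam * ht z)))"
        unfolding hX_def by auto
      ultimately have "(hX has_derivative (\<lambda>v. ((tor v, ?D (fib v)), exp (lam * ht y) * (lam * ht v)))) (at y)"
        unfolding hX by simp
      then have D: "frechet_derivative hX (at y) = (\<lambda>v. ((tor v, ?D (fib v)), exp (lam * ht y) * (lam * ht v)))"
        by (rule frechet_derivative_at[symmetric])
      show "frechet_derivative hX (at y) (I \<sigma> J c y v) = JX (frechet_derivative hX (at y) v)"
        unfolding D using W(10) yW lam by (intro point_eqI) (simp_all add: exp_minus)
    qed
    ultimately show ?thesis
      using V inj openhV smooth_h
      by - (rule exI[of _ V], rule exI[of _ hX], rule exI[of _ JX], intro conjI; assumption)
  qed
  ultimately show ?thesis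
    unfolding complex_structure_def by blast
qed

end

section \<open>Exterior derivative of the fundamental forms\<close>

lemma ext_d_3:
  "ext_d \<alpha> c x [u, v, w] = frechet_derivative (\<lambda>y. \<alpha> c y [v, w]) (at x) u -
     frechet_derivative (\<lambda>y. \<alpha> c y [u, w]) (at x) v + frechet_derivative (\<lambda>y. \<alpha> c y [u, v]) (at x) w"
  by (simp add: ext_d_def numeral_3_eq_3)

text \<open>Smoothness of k is known for fixed arguments only, so the moving argument
  \<open>J c x u\<close> is expanded in a basis.\<close>

lemma smooth_on_fundamental_form:
  assumes "smooth_manifold M" "covariant_tensor 2 M k" "endomorphism_field M J" "c \<in> atlas M"
  shows "smooth_on (snd c ` fst c) (\<lambda>x. k c x [J c x u, v])"
proof -
  note op = open_chart_image[OF assms(1,4)]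
  have J: "smooth_on (snd c ` fst c) (\<lambda>x. J c x u)"
    using assms(3,4) unfolding endomorphism_field_def by blast
  have "smooth_on (snd c ` fst c) (\<lambda>x. \<Sum>e\<in>Basis. (J c x u \<bullet> e) * k c x [e, v])"
    by (intro smooth_on_sum smooth_on_mult op finite_Basis smooth_on_covariant_2(1)[OF assms(2,4)]
        smooth_on_bounded_linear_compose[OF bounded_linear_inner_left op J])
  then show ?thesis
  proof (rule smooth_on_cong[OF _ op])
    fix x assume x: "x \<in> snd c ` fst c"
    note lin = smooth_on_covariant_2(2)[OF assms(2,4) x, of v]
    have "k c x [\<Sum>e\<in>Basis. (J c x u \<bullet> e) *\<^sub>R e, v] = (\<Sum>e\<in>Basis. (J c x u \<bullet> e) * k c x [e, v])"
      unfolding linear_sum[OF lin] linear_scale[OF lin] by simp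
    then show "(\<Sum>e\<in>Basis. (J c x u \<bullet> e) * k c x [e, v]) = k c x [J c x u, v]"
      by (simp add: euclidean_representation)
  qed
qed

context twisted_product
begin

text \<open>Compatibility makes the fundamental form invariant under \<open>I\<close>, so d acts on
  the form itself. The derivative of its half-plane term contains dt twice, the Kaehler term is
  closed, and \<sigma> y dx2 \<and> dx3 yields \<sigma> dy \<and> dx2 \<and> dx3. Pulling back by
  \<open>- I\<close>, the inverse of \<open>I\<close>, turns dy into -dx1 and preserves dx2 \<and>
  dx3 because \<sigma>^2 = 1.\<close>

lemma d_c_I:
  assumes \<sigma>: "\<sigma> * \<sigma> = 1" and K: "kaehler N k J" and c: "c \<in> atlas X" and z: "z \<in> snd c ` fst c"
  shows "d_c (I \<sigma> J) (fundamental_form g (I \<sigma> J)) c z [u, v, w] = \<sigma> * H c z [u, v, w]"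
proof -
  let ?d = "fibre_chart c" and ?\<omega> = "form_act (I \<sigma> J) (fundamental_form g (I \<sigma> J))"
  note d = fibre_chart[OF c]
  have J: "complex_structure N J" "compatible N k J" "closed_form 2 N (fundamental_form k J)" "endomorphism_field N J"
    using K unfolding kaehler_def complex_structure_def almost_complex_structure_def by blast+
  have J2: "J d x (J d x v) = - v" if "d \<in> atlas N" "x \<in> snd d ` fst d" for d x v
    using J(1) that unfolding complex_structure_def almost_complex_structure_def by blast
  \<comment> \<open>F, P and Q are the three ingredients of the form: the fundamental form of N, dx1
    \<and> dt and dx2 \<and> dx3.\<close>
  define F where "F a b x = k ?d x [J ?d x a, b]" for a b x
  define P where "P a b = tor a $ 1 * ht b - ht a * tor b $ 1" for a b :: "((real^3) \<times> 'e) \<times> real"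
  define Q where "Q a b = tor a $ 2 * tor b $ 3 - tor a $ 3 * tor b $ 2" for a b :: "((real^3) \<times> 'e) \<times> real"
  have \<omega>: "?\<omega> c y [a, b] = lam * exp (- (lam * ht y)) * P a b + \<sigma> * exp (lam * ht y) * Q a b + F (fib a) (fib b) (fib y)"
    if y: "y \<in> snd c ` fst c" for y a b
  proof -
    have "?\<omega> c y [a, b] = g c y [I \<sigma> J c y (I \<sigma> J c y a), I \<sigma> J c y b]"
      by (simp add: form_act_def fundamental_form_def)
    also have "\<dots> = g c y [I \<sigma> J c y a, b]"
      using compatible_I[OF \<sigma> J(2)] c y unfolding compatible_def by blast
    finally show ?thesis
      unfolding g_I P_def Q_def F_def .
  qed
  have D: "frechet_derivative (\<lambda>y. ?\<omega> c y [a, b]) (at z) e =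
      - (lam * lam * exp (- (lam * ht z)) * ht e) * P a b + \<sigma> * lam * exp (lam * ht z) * ht e * Q a b +
      frechet_derivative (F (fib a) (fib b)) (at (fib z)) (fib e)" for a b e
  proof -
    have "smooth_on (snd ?d ` fst ?d) (F (fib a) (fib b))"
      unfolding F_def by (rule smooth_on_fundamental_form[OF N k_covariant J(4) d])
    then have "(F (fib a) (fib b) has_derivative frechet_derivative (F (fib a) (fib b)) (at (fib z))) (at (fib z))"
      by (rule smooth_on_has_derivative[OF _ fibre_point[OF c z]])
    then have F: "((\<lambda>y. F (fib a) (fib b) (fib y)) has_derivative
        (\<lambda>e. frechet_derivative (F (fib a) (fib b)) (at (fib z)) (fib e))) (at z)"
      using has_derivative_compose[OF has_derivative_snd[OF has_derivative_fst[OF has_derivative_ident]],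
          of "F (fib a) (fib b)" _ z UNIV] by simp
    have "((\<lambda>y. lam * exp (- (lam * ht y)) * P a b + \<sigma> * exp (lam * ht y) * Q a b) has_derivative
        (\<lambda>e. - (lam * lam * exp (- (lam * ht z)) * ht e) * P a b + \<sigma> * lam * exp (lam * ht z) * ht e * Q a b)) (at z)"
      by (auto intro!: derivative_eq_intros simp: algebra_simps)
    from has_derivative_add[OF this F]
    have "((\<lambda>y. ?\<omega> c y [a, b]) has_derivative (\<lambda>e. - (lam * lam * exp (- (lam * ht z)) * ht e) * P a b +
        \<sigma> * lam * exp (lam * ht z) * ht e * Q a b + frechet_derivative (F (fib a) (fib b)) (at (fib z)) (fib e))) (at z)"
      by (rule has_derivative_transform_within_open[OF _ open_X_chart[OF c] z]) (rule \<omega>[symmetric])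
    from fun_cong[OF frechet_derivative_at[OF this, symmetric]] show ?thesis .
  qed
  have closed: "frechet_derivative (F b e) (at (fib z)) a - frechet_derivative (F a e) (at (fib z)) b +
      frechet_derivative (F a b) (at (fib z)) e = 0" for a b e
  proof -
    have "\<forall>vs. length vs = Suc 2 \<longrightarrow> ext_d (fundamental_form k J) ?d (fib z) vs = 0"
      using J(3) d fibre_point[OF c z] unfolding closed_form_def field_eq_def by blast
    then have "ext_d (fundamental_form k J) ?d (fib z) [a, b, e] = 0"
      by simp
    then show ?thesis
      unfolding ext_d_3 by (simp add: fundamental_form_def F_def[abs_def])
  qed
  have lin: "linear (I \<sigma> J c z)"
  proof -
    have "linear (J ?d (fib z))"
      using J(4) d fibre_point[OF c z] unfolding endomorphism_field_def by blast
    then show ?thesis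
      using linear_add linear_scale by (intro linearI; intro point_eqI) (simp_all add: algebra_simps add_divide_distrib)
  qed
  have I2: "I \<sigma> J c z (I \<sigma> J c z v) = - v" for v
    by (rule I_square[OF \<sigma> c z]) (rule J2)
  have "inv (I \<sigma> J c z) = (\<lambda>u. - I \<sigma> J c z u)"
    using I2 linear_neg[OF lin] by (intro inv_equality) simp_all
  then have "d_c (I \<sigma> J) (fundamental_form g (I \<sigma> J)) c z [u, v, w] =
      ext_d ?\<omega> c z [- I \<sigma> J c z u, - I \<sigma> J c z v, - I \<sigma> J c z w]"
    unfolding d_c_def by (simp add: form_act_def[of "\<lambda>c x. inv (I \<sigma> J c x)"])
  moreover define u' v' w' where "u' = - I \<sigma> J c z u" and "v' = - I \<sigma> J c z v" and "w' = - I \<sigma> J c z w"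
  ultimately have "d_c (I \<sigma> J) (fundamental_form g (I \<sigma> J)) c z [u, v, w] = ext_d ?\<omega> c z [u', v', w']"
    by simp
  also have "\<dots> = - (lam * lam * exp (- (lam * ht z))) * (ht u' * P v' w' - ht v' * P u' w' + ht w' * P u' v') +
      \<sigma> * lam * exp (lam * ht z) * (ht u' * Q v' w' - ht v' * Q u' w' + ht w' * Q u' v')"
    unfolding ext_d_3 D using closed[of "fib v'" "fib w'" "fib u'"] by (simp add: algebra_simps)
  \<comment> \<open>This is dt \<and> dx1 \<and> dt on three vectors.\<close>
  also have "ht u' * P v' w' - ht v' * P u' w' + ht w' * P u' v' = 0"
    unfolding P_def by (simp add: algebra_simps)
  also have "\<sigma> * lam * exp (lam * ht z) * (ht u' * Q v' w' - ht v' * Q u' w' + ht w' * Q u' v') = \<sigma> * H c z [u, v, w]"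
  proof -
    have Q': "Q (- I \<sigma> J c z a) (- I \<sigma> J c z b) = Q a b" for a b
    proof -
      have "Q (- I \<sigma> J c z a) (- I \<sigma> J c z b) = (\<sigma> * \<sigma>) * Q a b"
        unfolding Q_def by (simp add: algebra_simps)
      then show ?thesis
        using \<sigma> by simp
    qed
    \<comment> \<open>Multiplied by \<open>lam\<close> exp(\<open>lam\<close> t), the height of a
      vector is its dy component; \<open>- I\<close> converts this into minus the dx1
      component.\<close>
    have ht': "lam * exp (lam * ht z) * ht (- I \<sigma> J c z a) = - tor a $ 1" for a
      using lam by (simp add: exp_minus)
    have "\<sigma> * lam * exp (lam * ht z) * (ht u' * Q v' w' - ht v' * Q u' w' + ht w' * Q u' v') =
        \<sigma> * ((lam * exp (lam * ht z) * ht u') * Q v' w' - (lam * exp (lam * ht z) * ht v') * Q u' w' +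
          (lam * exp (lam * ht z) * ht w') * Q u' v')"
      by (simp add: algebra_simps)
    also have "\<dots> = \<sigma> * H c z [u, v, w]"
      unfolding u'_def v'_def w'_def ht' Q' H_apply unfolding Q_def by (simp add: algebra_simps)
    finally show ?thesis .
  qed
  finally show ?thesis
    by simp
qed

section \<open>Invariance under the deck transformation\<close>

context
  fixes f :: "'t \<Rightarrow> 't" and h :: "'p \<Rightarrow> 'p" and s \<beta> \<gamma> :: real and A :: "real^3 \<Rightarrow> real^3"
  assumes f: "smooth_map T T f" and h: "smooth_map N N h"
    and deriv_f: "\<And>b b' p v. b \<in> atlas T \<Longrightarrow> b' \<in> atlas T \<Longrightarrow> p \<in> fst b \<Longrightarrow> f p \<in> fst b' \<Longrightarrow>
      chart_deriv b b' f p v = A v"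
    and A: "\<And>v. A v $ 1 = exp (lam * s) * v $ 1" "\<And>v. A v $ 2 = \<beta> * v $ 2 - \<gamma> * v $ 3"
      "\<And>v. A v $ 3 = \<gamma> * v $ 2 + \<beta> * v $ 3"
    and unimodular: "exp (lam * s) * (\<beta>\<^sup>2 + \<gamma>\<^sup>2) = 1"
begin

abbreviation \<Phi> :: "('t \<times> 'p) \<times> real \<Rightarrow> ('t \<times> 'p) \<times> real"
  where "\<Phi> \<equiv> map_prod (map_prod f h) (\<lambda>t. t + s)"

text \<open>In product charts the derivative is block diagonal: A on the torus, the derivative of h
  on N, the identity on heights. The three invariance proofs start from this.\<close>

lemma lift_at:
  assumes c: "c \<in> atlas X" "c' \<in> atlas X" and q: "q \<in> fst c" "\<Phi> q \<in> fst c'"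
  obtains p where "p \<in> fst (fibre_chart c)" "h p \<in> fst (fibre_chart c')"
    "fib (snd c q) = snd (fibre_chart c) p" "fib (snd c' (\<Phi> q)) = snd (fibre_chart c') (h p)"
    "ht (snd c' (\<Phi> q)) = ht (snd c q) + s"
    "\<forall>u. chart_deriv c c' \<Phi> q u = ((A (tor u), chart_deriv (fibre_chart c) (fibre_chart c') h p (fib u)), ht u)"
proof -
  obtain b where b: "b \<in> atlas T" "fibre_chart c \<in> atlas N" and eq: "c = prod_chart (prod_chart b (fibre_chart c)) (UNIV, id)"
    using atlas_X[OF c(1)] .
  obtain b' where b': "b' \<in> atlas T" "fibre_chart c' \<in> atlas N" and eq': "c' = prod_chart (prod_chart b' (fibre_chart c')) (UNIV, id)"
    using atlas_X[OF c(2)] .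
  define d d' where "d = fibre_chart c" and "d' = fibre_chart c'"
  note b = b[folded d_def] and b' = b'[folded d'_def] and eq = eq[folded d_def] and eq' = eq'[folded d'_def]
  obtain x p t where xp: "q = ((x, p), t)"
    by (metis surj_pair)
  have x: "x \<in> fst b" "p \<in> fst d" "f x \<in> fst b'" "h p \<in> fst d'"
    using q unfolding xp eq eq' by simp_all
  have TN: "smooth_manifold (product_manifold T N)" and fh: "smooth_map (product_manifold T N) (product_manifold T N) (map_prod f h)"
    by (rule smooth_manifold_product[OF T N], rule smooth_map_product[OF T T f N N h])
  have bd: "prod_chart b d \<in> atlas (product_manifold T N)" "prod_chart b' d' \<in> atlas (product_manifold T N)"
    unfolding atlas_product using b b' by blast+
  have "chart_deriv (UNIV, id) (UNIV, id) (\<lambda>t :: real. t + s) t = (\<lambda>v. v)"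
    by (rule frechet_derivative_at[symmetric]) (auto intro!: derivative_eq_intros)
  then have "chart_deriv c c' \<Phi> q = map_prod (map_prod (chart_deriv b b' f x) (chart_deriv d d' h p)) (\<lambda>v. v)"
    unfolding xp eq eq'
    using chart_deriv_product[OF TN TN fh smooth_manifold_euclidean smooth_manifold_euclidean smooth_map_translation[of s]
        bd, of "(UNIV, id)" "(UNIV, id)" "(x, p)" t]
      chart_deriv_product[OF T T f N N h b(1) b'(1) b(2) b'(2) x(1,3,2,4)] x by simp
  moreover have "chart_deriv b b' f x = A"
    using deriv_f[OF b(1) b'(1) x(1,3)] by (rule ext)
  ultimately have "\<forall>u. chart_deriv c c' \<Phi> q u = ((A (tor u), chart_deriv d d' h p (fib u)), ht u)"
    by (simp add: map_prod_def case_prod_unfold)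
  moreover have "fib (snd c q) = snd d p" "fib (snd c' (\<Phi> q)) = snd d' (h p)" "ht (snd c' (\<Phi> q)) = ht (snd c q) + s"
    unfolding xp by (subst eq eq', simp)+
  ultimately show thesis
    using that[of p] x(2,4) unfolding d_def d'_def by blast
qed

lemma exp_shift:
  "exp (lam * (t + s)) = exp (lam * t) * exp (lam * s)" "exp (- (lam * (t + s))) = exp (- (lam * t)) * exp (- (lam * s))"
  by (simp_all add: distrib_left exp_add exp_diff exp_minus field_simps)

text \<open>The two factors \<open>exp (lam * s)\<close> from A on the first axis cancel against the
  shifted 1 / y^2. On the plane A multiplies inner products by \<beta>^2 + \<gamma>^2 while the
  weight y gains \<open>exp (lam * s)\<close>, and \<open>unimodular\<close> says that these
  cancel.\<close>

lemma is_pullback_g: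
  assumes "is_pullback 2 N N h k k"
  shows "is_pullback 2 X X \<Phi> g g"
  unfolding is_pullback_def
proof (intro ballI impI allI)
  fix c c' q and vs :: "(((real^3) \<times> 'e) \<times> real) list"
  assume c: "c \<in> atlas X" "c' \<in> atlas X" and q: "q \<in> fst c" "\<Phi> q \<in> fst c'" and "length vs = 2"
  then obtain u v where vs: "vs = [u, v]"
    by (elim length_eq_2E)
  obtain p where p: "p \<in> fst (fibre_chart c)" "h p \<in> fst (fibre_chart c')"
      "fib (snd c q) = snd (fibre_chart c) p" "fib (snd c' (\<Phi> q)) = snd (fibre_chart c') (h p)"
      "ht (snd c' (\<Phi> q)) = ht (snd c q) + s"
      "\<forall>u. chart_deriv c c' \<Phi> q u = ((A (tor u), chart_deriv (fibre_chart c) (fibre_chart c') h p (fib u)), ht u)"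
    using lift_at[OF c q] .
  let ?D = "chart_deriv (fibre_chart c) (fibre_chart c') h p" and ?t = "ht (snd c q)"
  have kh: "k (fibre_chart c) (snd (fibre_chart c) p) [fib u, fib v] =
      k (fibre_chart c') (snd (fibre_chart c') (h p)) [?D (fib u), ?D (fib v)]"
    using assms fibre_chart c p(1,2) unfolding is_pullback_def by fastforce
  have S: "exp (- (lam * s)) * exp (lam * s) = 1"
    by (simp add: exp_minus)
  have 1: "exp (- (lam * ?t)) * exp (- (lam * s)) * (exp (- (lam * ?t)) * exp (- (lam * s))) * (A (tor u) $ 1 * A (tor v) $ 1)
      = exp (- (lam * ?t)) * exp (- (lam * ?t)) * (tor u $ 1 * tor v $ 1)"
  proof -
    have "exp (- (lam * ?t)) * exp (- (lam * s)) * (exp (- (lam * ?t)) * exp (- (lam * s))) * (A (tor u) $ 1 * A (tor v) $ 1)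
      = (exp (- (lam * s)) * exp (lam * s)) * (exp (- (lam * s)) * exp (lam * s)) *
        (exp (- (lam * ?t)) * exp (- (lam * ?t)) * (tor u $ 1 * tor v $ 1))"
      unfolding A by (simp only: mult_ac)
    then show ?thesis
      unfolding S by simp
  qed
  have 2: "exp (lam * ?t) * exp (lam * s) * (A (tor u) $ 2 * A (tor v) $ 2 + A (tor u) $ 3 * A (tor v) $ 3)
      = exp (lam * ?t) * (tor u $ 2 * tor v $ 2 + tor u $ 3 * tor v $ 3)"
  proof -
    have "exp (lam * ?t) * exp (lam * s) * (A (tor u) $ 2 * A (tor v) $ 2 + A (tor u) $ 3 * A (tor v) $ 3) =
        (exp (lam * s) * (\<beta>\<^sup>2 + \<gamma>\<^sup>2)) * (exp (lam * ?t) * (tor u $ 2 * tor v $ 2 + tor u $ 3 * tor v $ 3))"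
      unfolding A by (simp add: algebra_simps power2_eq_square)
    then show ?thesis
      unfolding unimodular by simp
  qed
  show "g c (snd c q) vs = g c' (snd c' (\<Phi> q)) (map (chart_deriv c c' \<Phi> q) vs)"
    unfolding vs list.map p(6)[rule_format] g_apply p(3-5) fst_conv snd_conv exp_shift 1 2 kh by simp
qed

text \<open>A multiplies the volume form of the torus by its determinant, which
  \<open>unimodular\<close> declares to be 1.\<close>

lemma is_pullback_H: "is_pullback 3 X X \<Phi> H H"
  unfolding is_pullback_def
proof (intro ballI impI allI)
  fix c c' q and vs :: "(((real^3) \<times> 'e) \<times> real) list"
  assume c: "c \<in> atlas X" "c' \<in> atlas X" and q: "q \<in> fst c" "\<Phi> q \<in> fst c'" and "length vs = 3"
  then obtain u v w where vs: "vs = [u, v, w]"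
    by (elim length_eq_3E)
  obtain p where p: "p \<in> fst (fibre_chart c)" "h p \<in> fst (fibre_chart c')"
      "fib (snd c q) = snd (fibre_chart c) p" "fib (snd c' (\<Phi> q)) = snd (fibre_chart c') (h p)"
      "ht (snd c' (\<Phi> q)) = ht (snd c q) + s"
      "\<forall>u. chart_deriv c c' \<Phi> q u = ((A (tor u), chart_deriv (fibre_chart c) (fibre_chart c') h p (fib u)), ht u)"
    using lift_at[OF c q] .
  have "H c' (snd c' (\<Phi> q)) (map (chart_deriv c c' \<Phi> q) vs) =
      (exp (lam * s) * (\<beta>\<^sup>2 + \<gamma>\<^sup>2)) * H c (snd c q) vs"
    unfolding vs list.map p(6)[rule_format] H_apply fst_conv snd_conv A by (simp add: algebra_simps power2_eq_square)
  then show "H c (snd c q) vs = H c' (snd c' (\<Phi> q)) (map (chart_deriv c c' \<Phi> q) vs)"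
    unfolding unimodular by simp
qed

text \<open>On the plane A is multiplication by the complex number \<beta> + i \<gamma> and so
  commutes with rotation by a right angle; on the half-plane x1 and y are scaled by the same
  factor.\<close>

lemma intertwines_I:
  assumes "intertwines N N h J J"
  shows "intertwines X X \<Phi> (I \<sigma> J) (I \<sigma> J)"
  unfolding intertwines_def
proof (intro ballI impI allI)
  fix c c' q v
  assume c: "c \<in> atlas X" "c' \<in> atlas X" and q: "q \<in> fst c" "\<Phi> q \<in> fst c'"
  obtain p where p: "p \<in> fst (fibre_chart c)" "h p \<in> fst (fibre_chart c')"
      "fib (snd c q) = snd (fibre_chart c) p" "fib (snd c' (\<Phi> q)) = snd (fibre_chart c') (h p)"
      "ht (snd c' (\<Phi> q)) = ht (snd c q) + s"
      "\<forall>u. chart_deriv c c' \<Phi> q u = ((A (tor u), chart_deriv (fibre_chart c) (fibre_chart c') h p (fib u)), ht u)"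
    using lift_at[OF c q] .
  have Jh: "chart_deriv (fibre_chart c) (fibre_chart c') h p (J (fibre_chart c) (snd (fibre_chart c) p) (fib v)) =
      J (fibre_chart c') (snd (fibre_chart c') (h p)) (chart_deriv (fibre_chart c) (fibre_chart c') h p (fib v))"
    using assms fibre_chart c p(1,2) unfolding intertwines_def by blast
  show "chart_deriv c c' \<Phi> q (I \<sigma> J c (snd c q) v) = I \<sigma> J c' (snd c' (\<Phi> q)) (chart_deriv c c' \<Phi> q v)"
    unfolding p(6)[rule_format]
    by (rule point_eqI)
      (simp_all only: fst_conv snd_conv I_components A p(3-5) Jh exp_shift,
        simp_all add: algebra_simps exp_minus)
qed

end

text \<open>The identity is the case s = 0, \<beta> = 1, \<gamma> = 0 of the map \<Phi>, and
  \<open>translation_atlas\<close> is the required statement about its derivative.\<close>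

lemma identity_transforms:
  shows is_pullback_id_g: "is_pullback 2 X X id g g"
    and is_pullback_id_H: "is_pullback 3 X X id H H"
    and intertwines_id_I: "endomorphism_field N J \<Longrightarrow> intertwines X X id (I \<sigma> J) (I \<sigma> J)"
proof -
  have id: "map_prod (map_prod id id) (\<lambda>t. t + 0) = (id :: ('t \<times> 'p) \<times> real \<Rightarrow> _)"
    by (simp add: fun_eq_iff)
  note * = smooth_map_id[OF T] smooth_map_id[OF N]
  have deriv: "chart_deriv b b' id p v = v" if "b \<in> atlas T" "b' \<in> atlas T" "p \<in> fst b" "id p \<in> fst b'" for b b' p v
    using translation_atlas that by simp
  have comps: "v $ 1 = exp (lam * 0) * v $ 1" "v $ 2 = 1 * v $ 2 - 0 * v $ 3" "v $ 3 = 0 * v $ 2 + 1 * v $ 3"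
    "exp (lam * 0) * (1\<^sup>2 + 0\<^sup>2) = 1" for v :: "real^3"
    by simp_all
  have "is_pullback 2 N N id k k"
    using k_covariant unfolding covariant_tensor_def by blast
  from is_pullback_g[OF * deriv comps this] show "is_pullback 2 X X id g g"
    unfolding id .
  from is_pullback_H[OF * deriv comps] show "is_pullback 3 X X id H H"
    unfolding id .
  assume "endomorphism_field N J"
  then have "intertwines N N id J J"
    unfolding endomorphism_field_def by blast
  from intertwines_I[OF * deriv comps this] show "intertwines X X id (I \<sigma> J) (I \<sigma> J)"
    unfolding id .
qed

end

section \<open>The monodromy of an admissible family\<close>

lemma at_within_01: "0 < t \<Longrightarrow> t < 1 \<Longrightarrow> at t within {0..1::real} = at t"
  by (rule at_within_interior) simp

lemma smooth01_continuous_on: "smooth01 f \<Longrightarrow> continuous_on {0..1} f"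
  unfolding smooth01_def
  by (drule spec[of _ 0]) (simp add: differentiable_imp_continuous_within continuous_on_eq_continuous_within)

lemma smooth01_differentiable:
  assumes "smooth01 f" "0 < t" "t < 1"
  shows "f differentiable (at t)"
proof -
  have "((D01 ^^ 0) f) differentiable (at t within {0..1})"
    using assms unfolding smooth01_def by (metis atLeastAtMost_iff less_imp_le)
  then show ?thesis
    using at_within_01[OF assms(2,3)] by simp
qed

lemma admissible_nonzero:
  assumes "admissible a\<^sub>1 b\<^sub>2 b\<^sub>3" "t \<in> {0..1}"
  shows "a\<^sub>1 t \<noteq> 0" "l_coeff b\<^sub>2 b\<^sub>3 t > 0"
proof -
  have "independent (rows (frame3 a\<^sub>1 b\<^sub>2 b\<^sub>3 t))"
    using assms unfolding admissible_def by blast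
  then have "0 \<notin> rows (frame3 a\<^sub>1 b\<^sub>2 b\<^sub>3 t)"
    using dependent_zero by blast
  then have row: "frame3 a\<^sub>1 b\<^sub>2 b\<^sub>3 t $ i \<noteq> 0" for i
    unfolding rows_def row_def by (metis (mono_tags, lifting) mem_Collect_eq UNIV_I vec_lambda_eta)
  show "a\<^sub>1 t \<noteq> 0"
    using row[of 1] unfolding frame3_def by (auto simp: vec_eq_iff forall_3)
  have "b\<^sub>2 t \<noteq> 0 \<or> b\<^sub>3 t \<noteq> 0"
    using row[of 2] unfolding frame3_def by (auto simp: vec_eq_iff forall_3)
  then show "l_coeff b\<^sub>2 b\<^sub>3 t > 0"
    unfolding l_coeff_def by (simp add: sum_power2_gt_zero_iff)
qed

text \<open>A change of sign would force a zero by the intermediate value theorem. This gives \<mu>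
  > 0, so that \<mu> can be written as an exponential.\<close>

lemma continuous_on_01_same_sign:
  fixes a :: "real \<Rightarrow> real"
  assumes "continuous_on {0..1} a" "\<And>t. t \<in> {0..1} \<Longrightarrow> a t \<noteq> 0"
  shows "a 1 / a 0 > 0"
proof (rule ccontr)
  assume "\<not> ?thesis"
  then have "a 0 \<le> 0 \<and> 0 \<le> a 1 \<or> a 1 \<le> 0 \<and> 0 \<le> a 0"
    by (auto simp: zero_less_divide_iff)
  then have "\<exists>t\<ge>0. t \<le> 1 \<and> a t = 0"
    using IVT'[of a 0 0 1] IVT2'[of a 1 0 0] assms(1) by auto
  then show False
    using assms(2) by auto
qed

lemma l_coeff_endpoints_differ:
  assumes adm: "admissible a\<^sub>1 b\<^sub>2 b\<^sub>3"
    and C: "C \<noteq> 0" "\<forall>t\<in>{0..1}. D01 (\<lambda>s. 1 / l_coeff b\<^sub>2 b\<^sub>3 s) t * (1 / a\<^sub>1 t) = C"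
  shows "l_coeff b\<^sub>2 b\<^sub>3 1 \<noteq> l_coeff b\<^sub>2 b\<^sub>3 0"
proof
  assume eq: "l_coeff b\<^sub>2 b\<^sub>3 1 = l_coeff b\<^sub>2 b\<^sub>3 0"
  let ?\<phi> = "\<lambda>s. 1 / l_coeff b\<^sub>2 b\<^sub>3 s"
  have smooth: "smooth01 b\<^sub>2" "smooth01 b\<^sub>3"
    using adm unfolding admissible_def by blast+
  have l: "l_coeff b\<^sub>2 b\<^sub>3 t \<noteq> 0" if "t \<in> {0..1}" for t
    using admissible_nonzero(2)[OF adm that] by simp
  have cont: "continuous_on {0..1} ?\<phi>"
    using l smooth01_continuous_on[OF smooth(1)] smooth01_continuous_on[OF smooth(2)]
    unfolding l_coeff_def by (intro continuous_intros) auto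
  have diff: "?\<phi> differentiable (at t)" if "0 < t" "t < 1" for t
    using l[of t] that smooth01_differentiable[OF smooth(1) that] smooth01_differentiable[OF smooth(2) that]
    unfolding l_coeff_def by (intro derivative_intros) auto
  obtain t where t: "0 < t" "t < 1" "?\<phi> 1 - ?\<phi> 0 = frechet_derivative ?\<phi> (at t) (1 - 0)"
    using mvt[of 0 1 ?\<phi> "\<lambda>t. frechet_derivative ?\<phi> (at t)"] cont diff
    unfolding frechet_derivative_works by auto
  have "(?\<phi> has_derivative frechet_derivative ?\<phi> (at t)) (at t)"
    using diff[OF t(1,2)] unfolding frechet_derivative_works .
  moreover have "linear (frechet_derivative ?\<phi> (at t))"
    using calculation by (rule has_derivative_linear)
  \<comment> \<open>A linear map on the reals is determined by its value at 1, and here this value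
    is the difference of the equal end values.\<close>
  then have "frechet_derivative ?\<phi> (at t) = (\<lambda>x. x *\<^sub>R 0)"
    using linear_scale[of "frechet_derivative ?\<phi> (at t)" _ 1] t(3) eq by (intro ext) (metis diff_self diff_zero mult.right_neutral real_scaleR_def)
  ultimately have "(?\<phi> has_vector_derivative 0) (at t)"
    unfolding has_vector_derivative_def by simp
  then have "D01 ?\<phi> t = 0"
    unfolding D01_def at_within_01[OF t(1,2)] by (rule vector_derivative_at)
  then show False
    using C t(1,2) by (metis atLeastAtMost_iff less_imp_le mult_zero_left)
qed

text \<open>The linear part of a torus map carrying one coframe to the other: it scales the first axis and
  multiplies the remaining plane, identified with the complex numbers, by \<open>\<beta> + \<i> \<gamma>\<close>.\<close>

definition monodromy :: "real \<Rightarrow> real \<Rightarrow> real \<Rightarrow> real^3^3" where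
  "monodromy \<mu> \<beta> \<gamma> = vector [vector [\<mu>, 0, 0], vector [0, \<beta>, - \<gamma>], vector [0, \<gamma>, \<beta>]]"

lemma monodromy_apply [simp]:
  "(monodromy \<mu> \<beta> \<gamma> *v x) $ 1 = \<mu> * x $ 1"
  "(monodromy \<mu> \<beta> \<gamma> *v x) $ 2 = \<beta> * x $ 2 - \<gamma> * x $ 3"
  "(monodromy \<mu> \<beta> \<gamma> *v x) $ 3 = \<gamma> * x $ 2 + \<beta> * x $ 3"
  by (simp_all add: monodromy_def matrix_vector_mult_def sum_3)

lemma det_monodromy: "det (monodromy \<mu> \<beta> \<gamma>) = \<mu> * (\<beta>\<^sup>2 + \<gamma>\<^sup>2)"
  by (simp add: monodromy_def det_3 algebra_simps power2_eq_square)

text \<open>The inverse of \<beta> + i \<gamma> is its conjugate divided by its squared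
  modulus.\<close>

lemma monodromy_inverse:
  assumes "\<mu> \<noteq> 0" "\<beta>\<^sup>2 + \<gamma>\<^sup>2 \<noteq> 0"
  shows "monodromy \<mu> \<beta> \<gamma> ** monodromy (1 / \<mu>) (\<beta> / (\<beta>\<^sup>2 + \<gamma>\<^sup>2)) (- \<gamma> / (\<beta>\<^sup>2 + \<gamma>\<^sup>2)) = mat 1"
proof -
  have "monodromy \<mu> \<beta> \<gamma> *v (monodromy (1 / \<mu>) (\<beta> / (\<beta>\<^sup>2 + \<gamma>\<^sup>2)) (- \<gamma> / (\<beta>\<^sup>2 + \<gamma>\<^sup>2)) *v x) = x" for x
  proof -
    define r where "r = \<beta>\<^sup>2 + \<gamma>\<^sup>2"
    have "\<beta> * (\<beta> / r * x $ 2 - - \<gamma> / r * x $ 3) - \<gamma> * (- \<gamma> / r * x $ 2 + \<beta> / r * x $ 3) = (\<beta>\<^sup>2 + \<gamma>\<^sup>2) / r * x $ 2"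
      "\<gamma> * (\<beta> / r * x $ 2 - - \<gamma> / r * x $ 3) + \<beta> * (- \<gamma> / r * x $ 2 + \<beta> / r * x $ 3) = (\<beta>\<^sup>2 + \<gamma>\<^sup>2) / r * x $ 3"
      by (simp_all add: algebra_simps power2_eq_square add_divide_distrib)
    then show ?thesis
      using assms unfolding r_def[symmetric] vec_eq_iff forall_3 monodromy_apply by simp
  qed
  then have "(monodromy \<mu> \<beta> \<gamma> ** monodromy (1 / \<mu>) (\<beta> / (\<beta>\<^sup>2 + \<gamma>\<^sup>2)) (- \<gamma> / (\<beta>\<^sup>2 + \<gamma>\<^sup>2))) *v x = mat 1 *v x" for x
    by (simp add: matrix_vector_mul_assoc[symmetric])
  then show ?thesis
    unfolding matrix_eq by blast
qed

text \<open>With b = \<open>b\<^sub>2\<close> + i \<open>b\<^sub>3\<close>, the coframe satisfies e2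
  + i e3 = (dx2 + i dx3) / b. So the hypothesis says (v2 + i v3) / b(0) = (D2 + i D3) / b(1): the
  plane is multiplied by b(1) / b(0), whose real and imaginary parts are the two quotients over
  l(0).\<close>

lemma coframe_pullback_derivative:
  assumes a: "a\<^sub>1 0 \<noteq> 0" "a\<^sub>1 1 \<noteq> 0" and l: "l_coeff b\<^sub>2 b\<^sub>3 0 > 0" "l_coeff b\<^sub>2 b\<^sub>3 1 > 0"
    and eq: "\<And>i. (coframe3 a\<^sub>1 b\<^sub>2 b\<^sub>3 0 $ i) \<bullet> v = (coframe3 a\<^sub>1 b\<^sub>2 b\<^sub>3 1 $ i) \<bullet> D"
  shows "D = monodromy (a\<^sub>1 1 / a\<^sub>1 0) ((b\<^sub>2 1 * b\<^sub>2 0 + b\<^sub>3 1 * b\<^sub>3 0) / l_coeff b\<^sub>2 b\<^sub>3 0)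
    ((b\<^sub>3 1 * b\<^sub>2 0 - b\<^sub>2 1 * b\<^sub>3 0) / l_coeff b\<^sub>2 b\<^sub>3 0) *v v"
proof -
  define l0 l1 where "l0 = l_coeff b\<^sub>2 b\<^sub>3 0" and "l1 = l_coeff b\<^sub>2 b\<^sub>3 1"
  have l1: "b\<^sub>2 1 * b\<^sub>2 1 + b\<^sub>3 1 * b\<^sub>3 1 = l1"
    unfolding l1_def l_coeff_def by (simp add: power2_eq_square)
  have pos: "l0 \<noteq> 0" "l1 \<noteq> 0"
    using l unfolding l0_def l1_def by simp_all
  have 1: "v $ 1 / a\<^sub>1 0 = D $ 1 / a\<^sub>1 1"
    using eq[of 1] unfolding coframe3_def by (simp add: inner_vec_def sum_3)
  have 2: "b\<^sub>2 0 / l0 * v $ 2 + b\<^sub>3 0 / l0 * v $ 3 = b\<^sub>2 1 / l1 * D $ 2 + b\<^sub>3 1 / l1 * D $ 3"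
    using eq[of 2] unfolding coframe3_def l0_def l1_def by (simp add: inner_vec_def sum_3)
  have 3: "- b\<^sub>3 0 / l0 * v $ 2 + b\<^sub>2 0 / l0 * v $ 3 = - b\<^sub>3 1 / l1 * D $ 2 + b\<^sub>2 1 / l1 * D $ 3"
    using eq[of 3] unfolding coframe3_def l0_def l1_def by (simp add: inner_vec_def sum_3)
  \<comment> \<open>Real part of the plane equation multiplied by b(1); the imaginary part is taken
    below to obtain \<open>D $ 3\<close>.\<close>
  have "b\<^sub>2 1 * (b\<^sub>2 0 / l0 * v $ 2 + b\<^sub>3 0 / l0 * v $ 3) - b\<^sub>3 1 * (- b\<^sub>3 0 / l0 * v $ 2 + b\<^sub>2 0 / l0 * v $ 3) =
      (b\<^sub>2 1 * b\<^sub>2 1 + b\<^sub>3 1 * b\<^sub>3 1) / l1 * D $ 2"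
    unfolding 2 3 by (simp add: algebra_simps add_divide_distrib)
  then have D2: "D $ 2 = (b\<^sub>2 1 * b\<^sub>2 0 + b\<^sub>3 1 * b\<^sub>3 0) / l0 * v $ 2 - (b\<^sub>3 1 * b\<^sub>2 0 - b\<^sub>2 1 * b\<^sub>3 0) / l0 * v $ 3"
    unfolding l1 using pos by (simp add: algebra_simps add_divide_distrib diff_divide_distrib)
  have "b\<^sub>3 1 * (b\<^sub>2 0 / l0 * v $ 2 + b\<^sub>3 0 / l0 * v $ 3) + b\<^sub>2 1 * (- b\<^sub>3 0 / l0 * v $ 2 + b\<^sub>2 0 / l0 * v $ 3) =
      (b\<^sub>2 1 * b\<^sub>2 1 + b\<^sub>3 1 * b\<^sub>3 1) / l1 * D $ 3"
    unfolding 2 3 by (simp add: algebra_simps add_divide_distrib)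
  then have D3: "D $ 3 = (b\<^sub>3 1 * b\<^sub>2 0 - b\<^sub>2 1 * b\<^sub>3 0) / l0 * v $ 2 + (b\<^sub>2 1 * b\<^sub>2 0 + b\<^sub>3 1 * b\<^sub>3 0) / l0 * v $ 3"
    unfolding l1 using pos by (simp add: algebra_simps add_divide_distrib diff_divide_distrib)
  have "D $ 1 = a\<^sub>1 1 / a\<^sub>1 0 * v $ 1"
    using 1 a by (simp add: field_simps)
  then show ?thesis
    using D2 D3 unfolding vec_eq_iff forall_3 monodromy_apply l0_def by blast
qed

text \<open>The squared modulus of b(1) / b(0), by multiplicativity of sums of two squares.\<close>

lemma monodromy_modulus:
  assumes "l_coeff b\<^sub>2 b\<^sub>3 0 > 0"
  shows "((b\<^sub>2 1 * b\<^sub>2 0 + b\<^sub>3 1 * b\<^sub>3 0) / l_coeff b\<^sub>2 b\<^sub>3 0)\<^sup>2 + ((b\<^sub>3 1 * b\<^sub>2 0 - b\<^sub>2 1 * b\<^sub>3 0) / l_coeff b\<^sub>2 b\<^sub>3 0)\<^sup>2 =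
    l_coeff b\<^sub>2 b\<^sub>3 1 / l_coeff b\<^sub>2 b\<^sub>3 0"
proof -
  have "(b\<^sub>2 1 * b\<^sub>2 0 + b\<^sub>3 1 * b\<^sub>3 0)\<^sup>2 + (b\<^sub>3 1 * b\<^sub>2 0 - b\<^sub>2 1 * b\<^sub>3 0)\<^sup>2 = l_coeff b\<^sub>2 b\<^sub>3 1 * l_coeff b\<^sub>2 b\<^sub>3 0"
    unfolding l_coeff_def by (simp add: power2_eq_square algebra_simps)
  then show ?thesis
    using assms by (simp add: power_divide add_divide_distrib[symmetric] power2_eq_square)
qed

section \<open>HyperKaehler automorphisms\<close>

text \<open>The metric is recovered from a fundamental form and its complex structure:
  \<open>k(X, Y) = \<omega>(-JX, Y)\<close>.\<close>

lemma is_pullback_metric: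
  fixes N :: "('p, 'e::euclidean_space) manifold"
  assumes K: "kaehler N k J" and \<psi>: "smooth_manifold N" "smooth_map N N \<psi>"
    and J: "intertwines N N \<psi> J J" and \<omega>: "is_pullback 2 N N \<psi> (fundamental_form k J) (fundamental_form k J)"
  shows "is_pullback 2 N N \<psi> k k"
  unfolding is_pullback_def
proof (intro ballI impI allI)
  fix c d p and vs :: "'e list"
  assume c: "c \<in> atlas N" "d \<in> atlas N" and p: "p \<in> fst c" "\<psi> p \<in> fst d" and "length vs = 2"
  then obtain u v where vs: "vs = [u, v]"
    by (elim length_eq_2E)
  let ?D = "chart_deriv c d \<psi> p" and ?x = "snd c p" and ?y = "snd d (\<psi> p)"
  have J2: "J e x (J e x w) = - w" and lin: "linear (J e x)" if "e \<in> atlas N" "x \<in> snd e ` fst e" for e x w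
    using K that unfolding kaehler_def complex_structure_def almost_complex_structure_def endomorphism_field_def by blast+
  have x: "?x \<in> snd c ` fst c" and y: "?y \<in> snd d ` fst d"
    using p by blast+
  have D: "linear ?D"
    using smooth_map_has_derivative[OF \<psi>(2,1) c p] by (rule has_derivative_linear)
  have inv: "J e z (- J e z w) = w" if "e \<in> atlas N" "z \<in> snd e ` fst e" for e z w
    using J2[OF that, of w] linear_neg[OF lin[OF that], of "J e z w"] by simp
  have "k c ?x [u, v] = fundamental_form k J c ?x [- J c ?x u, v]"
    unfolding fundamental_form_def using inv[OF c(1) x] by simp
  also have "\<dots> = fundamental_form k J d ?y (map ?D [- J c ?x u, v])"
    using \<omega> c p unfolding is_pullback_def by (metis length_Cons list.size(3) One_nat_def Suc_1)
  also have "?D (- J c ?x u) = - J d ?y (?D u)"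
    using J c p linear_neg[OF D] unfolding intertwines_def by simp
  then have "fundamental_form k J d ?y (map ?D [- J c ?x u, v]) = k d ?y [?D u, ?D v]"
    unfolding fundamental_form_def using inv[OF c(2) y] by simp
  finally show "k c ?x vs = k d ?y (map ?D vs)"
    unfolding vs by simp
qed

section \<open>Assembly: determinant of the monodromy, structure on the cover, descent\<close>

theorem theorem4p1:
  fixes N :: "('p, 'e::euclidean_space) manifold"
    and k :: "('p, 'e) cov_field"
    and J\<^sub>1 J\<^sub>2 J\<^sub>3 :: "('p, 'e) endo_field"
    and \<Gamma>\<^sub>0 :: "(real^3) set"
    and a\<^sub>1 b\<^sub>2 b\<^sub>3 :: "real \<Rightarrow> real"
    and \<rho> :: "(real^3) set \<Rightarrow> (real^3) set"
    and \<psi> :: "'p \<Rightarrow> 'p"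
  assumes "hyperkaehler N k J\<^sub>1 J\<^sub>2 J\<^sub>3" and "compact_space (mtop N)"
    and "lattice3 \<Gamma>\<^sub>0"
    and "admissible a\<^sub>1 b\<^sub>2 b\<^sub>3"
    and "diffeomorphism (torus3 \<Gamma>\<^sub>0) \<rho>"
    and "\<forall>i. is_pullback 1 (torus3 \<Gamma>\<^sub>0) (torus3 \<Gamma>\<^sub>0) \<rho>
           (torus_one_form (coframe3 a\<^sub>1 b\<^sub>2 b\<^sub>3 1 $ i)) (torus_one_form (coframe3 a\<^sub>1 b\<^sub>2 b\<^sub>3 0 $ i))"
    and "\<exists>C. C \<noteq> 0 \<and> (\<forall>t\<in>{0..1}. D01 (\<lambda>s. 1 / l_coeff b\<^sub>2 b\<^sub>3 s) t * (1 / a\<^sub>1 t) = C)"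
    and "diffeomorphism N \<psi>"
    and "\<forall>J\<in>{J\<^sub>1, J\<^sub>2, J\<^sub>3}. intertwines N N \<psi> J J \<and>
           is_pullback 2 N N \<psi> (fundamental_form k J) (fundamental_form k J)"
  shows "\<exists>g I\<^sub>p I\<^sub>m.
           generalized_kaehler (mapping_torus (product_manifold (torus3 \<Gamma>\<^sub>0) N) (map_prod \<rho> \<psi>)) g I\<^sub>p I\<^sub>m \<and>
           \<not> split_structure (mapping_torus (product_manifold (torus3 \<Gamma>\<^sub>0) N) (map_prod \<rho> \<psi>)) I\<^sub>p I\<^sub>m"
proof -
  let ?T = "torus3 \<Gamma>\<^sub>0" and ?M = "product_manifold (torus3 \<Gamma>\<^sub>0) N"
  have N_props: "smooth_manifold N" "topspace (mtop N) \<noteq> {}" "\<exists>m\<ge>1. DIM('e) = 4 * m"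
    and K: "kaehler N k J\<^sub>1" "kaehler N k J\<^sub>2" "kaehler N k J\<^sub>3"
    and quaternion: "\<And>c x v. c \<in> atlas N \<Longrightarrow> x \<in> snd c ` fst c \<Longrightarrow>
      J\<^sub>1 c x (J\<^sub>2 c x v) = J\<^sub>3 c x v \<and> - J\<^sub>2 c x (J\<^sub>1 c x v) = J\<^sub>3 c x v"
    using assms(1) unfolding hyperkaehler_def by blast+
  have T: "smooth_manifold ?T"
    by (rule smooth_manifold_torus3[OF assms(3)])
  have \<rho>: "bij_betw \<rho> (topspace (mtop ?T)) (topspace (mtop ?T))" "smooth_map ?T ?T \<rho>"
    and \<psi>: "smooth_map N N \<psi>"
    using assms(5,8) unfolding diffeomorphism_def by blast+
  define \<mu> where "\<mu> = a\<^sub>1 1 / a\<^sub>1 0"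
  define \<beta> where "\<beta> = (b\<^sub>2 1 * b\<^sub>2 0 + b\<^sub>3 1 * b\<^sub>3 0) / l_coeff b\<^sub>2 b\<^sub>3 0"
  define \<gamma> where "\<gamma> = (b\<^sub>3 1 * b\<^sub>2 0 - b\<^sub>2 1 * b\<^sub>3 0) / l_coeff b\<^sub>2 b\<^sub>3 0"
  define A where "A = monodromy \<mu> \<beta> \<gamma>"
  have a: "a\<^sub>1 t \<noteq> 0" and l: "l_coeff b\<^sub>2 b\<^sub>3 t > 0" if "t \<in> {0..1}" for t
    using admissible_nonzero[OF assms(4) that] by blast+
  have l0: "l_coeff b\<^sub>2 b\<^sub>3 0 > 0" and l1: "l_coeff b\<^sub>2 b\<^sub>3 1 > 0"
    using l by simp_all
  have deriv: "chart_deriv c d \<rho> p v = A *v v"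
    if "c \<in> atlas ?T" "d \<in> atlas ?T" "p \<in> fst c" "\<rho> p \<in> fst d" for c d p v
  proof -
    have "(coframe3 a\<^sub>1 b\<^sub>2 b\<^sub>3 0 $ i) \<bullet> v = (coframe3 a\<^sub>1 b\<^sub>2 b\<^sub>3 1 $ i) \<bullet> chart_deriv c d \<rho> p v" for i
    proof -
      have "\<forall>vs. length vs = 1 \<longrightarrow> torus_one_form (coframe3 a\<^sub>1 b\<^sub>2 b\<^sub>3 0 $ i) c (snd c p) vs =
          torus_one_form (coframe3 a\<^sub>1 b\<^sub>2 b\<^sub>3 1 $ i) d (snd d (\<rho> p)) (map (chart_deriv c d \<rho> p) vs)"
        using assms(6) that unfolding is_pullback_def by blast
      from this[rule_format, of "[v]"] show ?thesis
        by (simp add: torus_one_form_def)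
    qed
    then show ?thesis
      unfolding A_def \<mu>_def \<beta>_def \<gamma>_def
      using a l0 l1 by (intro coframe_pullback_derivative) simp_all
  qed
  have \<mu>: "\<mu> > 0"
    unfolding \<mu>_def using a smooth01_continuous_on assms(4) unfolding admissible_def
    by (intro continuous_on_01_same_sign) blast+
  have mod: "\<beta>\<^sup>2 + \<gamma>\<^sup>2 = l_coeff b\<^sub>2 b\<^sub>3 1 / l_coeff b\<^sub>2 b\<^sub>3 0"
    unfolding \<beta>_def \<gamma>_def by (rule monodromy_modulus[OF l0])
  then have mod_pos: "\<beta>\<^sup>2 + \<gamma>\<^sup>2 > 0"
    using l0 l1 by simp
  have lattice: "A *v x \<in> \<Gamma>\<^sub>0 \<longleftrightarrow> x \<in> \<Gamma>\<^sub>0" for x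
    using torus3_derivative_preserves_lattice[OF assms(3) \<rho>(2) matrix_vector_mul_linear deriv] \<rho>(1)
    unfolding bij_betw_def by blast
  define A' where "A' = monodromy (1 / \<mu>) (\<beta> / (\<beta>\<^sup>2 + \<gamma>\<^sup>2)) (- \<gamma> / (\<beta>\<^sup>2 + \<gamma>\<^sup>2))"
  have inv: "A ** A' = mat 1"
    unfolding A_def A'_def by (rule monodromy_inverse[OF less_imp_neq[OF \<mu>, symmetric] less_imp_neq[OF mod_pos, symmetric]])
  \<comment> \<open>\<open>A\<close> maps \<open>A' *v x\<close> to the lattice vector x, so the
    forward direction of \<open>lattice\<close> at \<open>A' *v x\<close> applies.\<close>
  have "A' *v x \<in> \<Gamma>\<^sub>0" if "x \<in> \<Gamma>\<^sub>0" for x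
    using lattice[of "A' *v x"] that inv by (simp add: matrix_vector_mul_assoc)
  then have "\<bar>det A\<bar> = 1"
    using lattice by (intro lattice3_automorphism_det[OF assms(3) inv]) simp_all
  \<comment> \<open>Both factors are positive, which excludes determinant -1.\<close>
  then have unimodular: "\<mu> * (\<beta>\<^sup>2 + \<gamma>\<^sup>2) = 1"
    unfolding A_def det_monodromy using mult_pos_pos[OF \<mu> mod_pos] by simp
  have "\<mu> \<noteq> 1"
  proof
    assume "\<mu> = 1"
    then have "l_coeff b\<^sub>2 b\<^sub>3 1 = l_coeff b\<^sub>2 b\<^sub>3 0"
      using unimodular mod l0 by simp
    then show False
      using l_coeff_endpoints_differ[OF assms(4)] assms(7) by blast
  qed
  define lam where "lam = ln \<mu>"
  \<comment> \<open>The product \<open>lam * 1\<close> matches the translation s = 1 of the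
    generator.\<close>
  have lam_\<mu>: "lam \<noteq> 0" "exp (lam * 1) = \<mu>"
    unfolding lam_def using \<mu> \<open>\<mu> \<noteq> 1\<close> by simp_all
  interpret twisted_product ?T N k lam
  proof
    show "riemannian_metric N k"
      using K(1) unfolding kaehler_def by blast
    show "chart_deriv b b' id p v = v" if "b \<in> atlas ?T" "b' \<in> atlas ?T" "p \<in> fst b" "p \<in> fst b'" for b b' p v
      by (rule chart_deriv_torus3_id[OF assms(3) that])
  qed (use T N_props lam_\<mu> in simp_all)
  let ?\<Phi> = "map_prod (map_prod \<rho> \<psi>) (\<lambda>t :: real. t + 1)"
  have A: "(A *v v) $ 1 = exp (lam * 1) * v $ 1" "(A *v v) $ 2 = \<beta> * v $ 2 - \<gamma> * v $ 3"
    "(A *v v) $ 3 = \<gamma> * v $ 2 + \<beta> * v $ 3" "exp (lam * 1) * (\<beta>\<^sup>2 + \<gamma>\<^sup>2) = 1" for v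
    unfolding lam_\<mu>(2) A_def using unimodular by simp_all
  note transform = \<rho>(2) \<psi> deriv A
  have k_inv: "is_pullback 2 N N \<psi> k k"
    using is_pullback_metric[OF K(1) N_props(1) \<psi>] assms(9) by blast
  have g_inv: "is_pullback 2 X X ?\<Phi> g g"
    by (rule is_pullback_g[OF transform k_inv])
  have H_inv: "is_pullback 3 X X ?\<Phi> H H"
    by (rule is_pullback_H[OF transform])
  have I_inv: "intertwines X X ?\<Phi> (I \<sigma> J) (I \<sigma> J)" if "J \<in> {J\<^sub>1, J\<^sub>2, J\<^sub>3}" for \<sigma> J
    by (rule intertwines_I[OF transform conjunct1[OF bspec[OF assms(9) that]]])
  have M: "smooth_manifold ?M" "diffeomorphism ?M (map_prod \<rho> \<psi>)"
    by (rule smooth_manifold_product[OF T N_props(1)], rule diffeomorphism_product[OF T assms(5) N_props(1) assms(8)])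
  interpret deck: deck_quotient X "deck_maps (topspace (mtop ?M)) (map_prod \<rho> \<psi>)" "orbit_rel (topspace (mtop ?M)) (map_prod \<rho> \<psi>)"
    by (rule deck_quotient_mapping_torus[OF M])
  have J: "kaehler N k J" "complex_structure N J" "compatible N k J" "endomorphism_field N J" if "J \<in> {J\<^sub>1, J\<^sub>2}" for J
  proof -
    show "kaehler N k J"
      using K that by blast
    then show J': "complex_structure N J" "compatible N k J"
      unfolding kaehler_def by blast+
    from J'(1) show "endomorphism_field N J"
      unfolding complex_structure_def almost_complex_structure_def by blast
  qed
  have d_c: "field_eq 3 X (d_c (I \<sigma> J) (fundamental_form g (I \<sigma> J))) (\<lambda>c x vs. \<sigma> * H c x vs)"
    if "\<sigma> * \<sigma> = 1" "J \<in> {J\<^sub>1, J\<^sub>2}" for \<sigma> J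
    unfolding field_eq_def
  proof (intro ballI allI impI)
    fix c z and vs :: "(((real^3) \<times> 'e) \<times> real) list"
    assume c: "c \<in> atlas X" "z \<in> snd c ` fst c" and "length vs = 3"
    then obtain u v w where "vs = [u, v, w]"
      by (elim length_eq_3E)
    then show "d_c (I \<sigma> J) (fundamental_form g (I \<sigma> J)) c z vs = \<sigma> * H c z vs"
      using d_c_I[OF that(1) J(1)[OF that(2)] c] by simp
  qed
  have gk: "generalized_kaehler deck.Q (deck.descend g) (deck.descend (I 1 J\<^sub>1)) (deck.descend (I (-1) J\<^sub>2))"
  proof (rule deck.generalized_kaehler_descend)
    show "even DIM(((real^3) \<times> 'e) \<times> real)"
      using N_props(3) by auto
    show "riemannian_metric X g"
      by (rule riemannian_metric_g[OF is_pullback_id_g])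
    show "complex_structure X (I 1 J\<^sub>1)" "complex_structure X (I (-1) J\<^sub>2)"
      by (intro complex_structure_I J intertwines_id_I; simp)+
    show "compatible X g (I 1 J\<^sub>1)" "compatible X g (I (-1) J\<^sub>2)"
      by (intro compatible_I J; simp)+
    show "differential_form 3 X H" "closed_form 3 X H"
      by (rule differential_form_H[OF is_pullback_id_H], rule closed_form_H)
    show "field_eq 3 X (d_c (I 1 J\<^sub>1) (fundamental_form g (I 1 J\<^sub>1))) H"
      using d_c[of 1 J\<^sub>1] by simp
    \<comment> \<open>Here \<sigma> = -1, and this sign cancels the minus sign in the condition on
      the second structure.\<close>
    show "field_eq 3 X (\<lambda>c x vs. - d_c (I (-1) J\<^sub>2) (fundamental_form g (I (-1) J\<^sub>2)) c x vs) H"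
      using d_c[of "-1" J\<^sub>2] unfolding field_eq_def by simp
    fix \<phi> assume \<phi>: "\<phi> \<in> deck_maps (topspace (mtop ?M)) (map_prod \<rho> \<psi>)"
    show "is_pullback 2 X X \<phi> g g"
      by (rule deck_map_is_pullback[OF M \<phi> is_pullback_id_g g_inv])
    show "is_pullback 3 X X \<phi> H H"
      by (rule deck_map_is_pullback[OF M \<phi> is_pullback_id_H H_inv])
    show "intertwines X X \<phi> (I 1 J\<^sub>1) (I 1 J\<^sub>1)"
      by (rule deck_map_intertwines[OF M \<phi> intertwines_id_I[OF J(4)] I_inv]) simp_all
    show "intertwines X X \<phi> (I (-1) J\<^sub>2) (I (-1) J\<^sub>2)"
      by (rule deck_map_intertwines[OF M \<phi> intertwines_id_I[OF J(4)] I_inv]) simp_all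
  qed
  have ns: "\<not> split_structure deck.Q (deck.descend (I 1 J\<^sub>1)) (deck.descend (I (-1) J\<^sub>2))"
  proof (rule deck.not_split_descend)
    fix c z assume c: "c \<in> atlas X" "z \<in> snd c ` fst c"
    note d = fibre_chart[OF c(1)] fibre_point[OF c]
    obtain n :: 'e where n: "n \<in> Basis"
      using nonempty_Basis by blast
    \<comment> \<open>A test vector tangent to N, since the two structures commute in the remaining
      directions.\<close>
    let ?v = "((0 :: real^3, n), 0 :: real)" and ?J = "\<lambda>J. J (fibre_chart c) (fib z)"
    have lin: "linear (?J J\<^sub>3)" and J3: "?J J\<^sub>3 (?J J\<^sub>3 n) = - n"
      using K(3) d unfolding kaehler_def complex_structure_def almost_complex_structure_def endomorphism_field_def by blast+
    have "?J J\<^sub>3 n \<noteq> 0"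
      using J3 linear_0[OF lin] nonzero_Basis[OF n] by auto
    then have "2 *\<^sub>R ?J J\<^sub>3 n \<noteq> 0"
      by simp
    then have "?J J\<^sub>3 n \<noteq> - ?J J\<^sub>3 n"
      unfolding scaleR_2 eq_neg_iff_add_eq_0 .
    moreover have "?J J\<^sub>1 (?J J\<^sub>2 n) = ?J J\<^sub>3 n" "?J J\<^sub>2 (?J J\<^sub>1 n) = - ?J J\<^sub>3 n"
      using quaternion[OF d, of n] by (auto simp: minus_equation_iff)
    ultimately have "fib (I 1 J\<^sub>1 c z (I (-1) J\<^sub>2 c z ?v)) \<noteq> fib (I (-1) J\<^sub>2 c z (I 1 J\<^sub>1 c z ?v))"
      by simp
    then show "\<exists>v. I 1 J\<^sub>1 c z (I (-1) J\<^sub>2 c z v) \<noteq> I (-1) J\<^sub>2 c z (I 1 J\<^sub>1 c z v)"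
      by metis
  next
    show "topspace (mtop X) \<noteq> {}"
      using N_props(2) topspace_torus3[OF assms(3)] by (simp add: topspace_product)
  qed
  show ?thesis
    unfolding mapping_torus_eq using gk ns by blast
qed

end
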